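(* Let $N\ge1$ and let $H\in C^2(\mathbf{R}^N\times\mathbf{R}^N;\mathbf{R})$ satisfy: there exist $\kappa>0$ and $h\in C(\mathbf{R};\mathbf{R}_+)$ with $h(r)/r\to0$ as $r\to+\infty$ such that $|\nabla_\xi H(x,\xi)|\le\kappa(1+|\xi|)$, $|\nabla_x H(x,\xi)|\le h(|x|)+\kappa|\xi|$, $|\nabla^2H(x,\xi)|\le\kappa$ for all $(x,\xi)$. Let $\Phi_t=(X_t,\Xi_t)$ be its Hamiltonian flow. Let $U^{in}$ be a continuous vector field on $\mathbf{R}^N$ with $|U^{in}(y)|/|y|\to0$ as $|y|\to\infty$ and such that for every bounded open $\Omega\subset\mathbf{R}^N$ and all $k,l$, $\partial_lU^{in}_k|_\Omega\in L^{N,1}(\Omega)$. Let $t\in\mathbf{R}$, let $\rho^{in}$ be a probability density on $\mathbf{R}^N$, let $\mu^{in}$ be the monokinetic measure with momentum profile $U^{in}$ and density $\rho^{in}$, and let $\mu(t):=\Phi_t\#\mu^{in}$, $\rho(t):=\Pi\#\mu(t)$. (a) The following are equivalent: $\rho(t)(C_t)=0$; $\rho(t)(\mathbf{R}^N\setminus C_t)=1$; $\rho^{in}=0$ a.e. on $Z_t$. (b) Under any of the equivalent conditions in (a), $\rho(t)\ll\mathcal{L}^N$ with $$\frac{d\rho(t)}{d\mathcal{L}^N}(x)=\sum_{y\in F_t^{-1}(\{x\})}\frac{\rho^{in}(y)}{J_t(y)}\quad\text{for a.e. }x\in\mathbf{R}^N.$$ (c) Under any of the equivalent conditions in (a), $\mu(t)$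 has a disintegration with respect to $\mathcal{L}^N$ on $\mathbf{R}^N_x$ and the projection $\Pi$ given by $$\mu(t,x,\cdot)=\sum_{y\in F_t^{-1}(\{x\})}\frac{\rho^{in}(y)}{J_t(y)}\,\delta_{\Xi_t(y,U^{in}(y))}\quad\text{for a.e. }x\in\mathbf{R}^N.$$
   Context: $\Phi_t(x,\xi)=(X_t(x,\xi),\Xi_t(x,\xi))$ solves $\dot X=\nabla_\xi H(X,\Xi)$, $\dot\Xi=-\nabla_xH(X,\Xi)$, $\Phi_0=\mathrm{Id}$. $L^{N,1}(\Omega)$ is the Lorentz space of measurable $f$ with $\int_0^\infty(\mathcal{L}^N(\{|f|\ge\lambda\}))^{1/N}d\lambda<\infty$; under this assumption $U^{in}$ is differentiable outside the Lebesgue-null set $E$ of its non-differentiability points. $F_t(y):=X_t(y,U^{in}(y))$; for $y\notin E$, $J_t(y):=|\det DF_t(y)|$; $Z_t:=\{y\in\mathbf{R}^N\setminus E: J_t(y)=0\}$; $C_t:=\{x: F_t^{-1}(\{x\})\cap(Z_t\cup E)\ne\emptyset\}$. The monokinetic measure with momentum profile $U^{in}$ and density $\rho^{in}$ is the Borel measure $\mu^{in}$ on $\mathbf{R}^N_x\times\mathbf{R}^N_\xi$ defined by $\iint\phi\,d\mu^{in}=\int_{\mathbf{R}^N}\phi(x,U^{in}(x))\rho^{in}(x)\,dx$ for $\phi\in C_c$, i.e. $\mu^{in}(x,\cdot)=\rho^{in}(x)\delta_{U^{in}(x)}$. $\Pi(x,\xi):=x$ and $\#$ denotes push-forward. *)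

theory Defs
  imports "HOL-Analysis.Analysis"
begin

fun Ck :: "nat \<Rightarrow> ('a::euclidean_space \<Rightarrow> real) \<Rightarrow> bool" where
  "Ck 0 f = continuous_on UNIV f"
| "Ck (Suc k) f = ((\<forall>x. f differentiable (at x)) \<and>
                    (\<forall>v. Ck k (\<lambda>x. frechet_derivative f (at x) v)))"

definition smooth_fun :: "('a::euclidean_space \<Rightarrow> real) \<Rightarrow> bool" where
  "smooth_fun f \<longleftrightarrow> (\<forall>k. Ck k f)"

definition supp_cl :: "('a::euclidean_space \<Rightarrow> real) \<Rightarrow> 'a set" where
  "supp_cl f = closure {x. f x \<noteq> 0}"

definition test_fun :: "'a::euclidean_space set \<Rightarrow> ('a \<Rightarrow> real) \<Rightarrow> bool" where
  "test_fun \<Omega> \<phi> \<longleftrightarrow> smooth_fun \<phi> \<and> compact (supp_cl \<phi>) \<and> supp_cl \<phi> \<subseteq> \<Omega>"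

definition weak_partial ::
  "(real^'n) set \<Rightarrow> (real^'n \<Rightarrow> real) \<Rightarrow> 'n \<Rightarrow> (real^'n \<Rightarrow> real) \<Rightarrow> bool" where
  "weak_partial \<Omega> f l g \<longleftrightarrow>
     (\<forall>K. compact K \<and> K \<subseteq> \<Omega> \<longrightarrow>
          integrable (lebesgue_on K) f \<and> integrable (lebesgue_on K) g) \<and>
     (\<forall>\<phi>. test_fun \<Omega> \<phi> \<longrightarrow>
          (\<integral>x. f x * frechet_derivative \<phi> (at x) (axis l 1) \<partial>lebesgue)
            = - (\<integral>x. g x * \<phi> x \<partial>lebesgue))"

definition lorentz_N1 :: "(real^'n) set \<Rightarrow> (real^'n \<Rightarrow> real) \<Rightarrow> bool" where
  "lorentz_N1 \<Omega> f \<longleftrightarrow> f \<in> borel_measurable (lebesgue_on \<Omega>) \<and>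
     (\<integral>\<^sup>+ s. indicator {0<..} s *
          ennreal ((measure lebesgue {x\<in>\<Omega>. s \<le> \<bar>f x\<bar>}) powr (1 / real CARD('n))) \<partial>lborel)
       < \<infinity>"

text \<open>Hamiltonian vector field from the gradient (grad_x H, grad_xi H).\<close>
definition ham_field :: "('a::real_normed_vector \<times> 'a) \<Rightarrow> 'a \<times> 'a" where
  "ham_field g = (snd g, - fst g)"

definition monokinetic ::
  "('a::euclidean_space \<Rightarrow> 'a) \<Rightarrow> ('a \<Rightarrow> real) \<Rightarrow> ('a \<times> 'a) measure" where
  "monokinetic U \<rho> = distr (density lebesgue (\<lambda>x. ennreal (\<rho> x))) borel (\<lambda>x. (x, U x))"

definition nondiff_set :: "(real^'n \<Rightarrow> real^'n) \<Rightarrow> (real^'n) set" where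
  "nondiff_set U = {y. \<not> U differentiable (at y)}"

definition Fmap :: "(real \<Rightarrow> ((real^'n) \<times> (real^'n)) \<Rightarrow> ((real^'n) \<times> (real^'n))) \<Rightarrow>
    (real^'n \<Rightarrow> real^'n) \<Rightarrow> real \<Rightarrow> real^'n \<Rightarrow> real^'n" where
  "Fmap \<Phi> U t y = fst (\<Phi> t (y, U y))"

definition Jac :: "(real \<Rightarrow> ((real^'n) \<times> (real^'n)) \<Rightarrow> ((real^'n) \<times> (real^'n))) \<Rightarrow>
    (real^'n \<Rightarrow> real^'n) \<Rightarrow> real \<Rightarrow> real^'n \<Rightarrow> real" where
  "Jac \<Phi> U t y = \<bar>det (matrix (frechet_derivative (Fmap \<Phi> U t) (at y)))\<bar>"

definition Zset :: "(real \<Rightarrow> ((real^'n) \<times> (real^'n)) \<Rightarrow> ((real^'n) \<times> (real^'n))) \<Rightarrow>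
    (real^'n \<Rightarrow> real^'n) \<Rightarrow> real \<Rightarrow> (real^'n) set" where
  "Zset \<Phi> U t = {y. y \<notin> nondiff_set U \<and> Jac \<Phi> U t y = 0}"

definition Cset :: "(real \<Rightarrow> ((real^'n) \<times> (real^'n)) \<Rightarrow> ((real^'n) \<times> (real^'n))) \<Rightarrow>
    (real^'n \<Rightarrow> real^'n) \<Rightarrow> real \<Rightarrow> (real^'n) set" where
  "Cset \<Phi> U t = {x. Fmap \<Phi> U t -` {x} \<inter> (Zset \<Phi> U t \<union> nondiff_set U) \<noteq> {}}"

end

theory Submission
  imports Defs
begin

text \<open>
  The regularity of \<open>U\<close> enters through one oscillation estimate. On a cube \<open>Q\<close>, differentiating mollifiers
  that contract to a point bounds \<open>u - b \<bullet> _\<close>, up to a constant, by the Riesz potential of order one of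
  \<open>\<Sum>l. |\<partial>\<^sub>l u - b\<^sub>l|\<close>. The Lorentz condition yields a weight \<open>W\<close> with \<open>W (|\<nabla>u - b|)\<close> integrable such that
  this potential is at most a constant times \<open>(\<integral>\<^sub>Q W (|\<nabla>u - b|))\<close> to the power \<open>1 / N\<close>.
  With \<open>b\<close> close to \<open>\<nabla>u(x)\<close>, Lebesgue's differentiation theorem makes \<open>U\<close> differentiable almost everywhere;
  with \<open>b = 0\<close>, a covering argument gives Lusin's condition (N) for \<open>U\<close>, and also for \<open>F\<^sub>t\<close>, whose oscillation is
  controlled by that of \<open>U\<close> because the flow is Lipschitz.

  Hence \<open>C\<^sub>t\<close> is Lebesgue null, by Sard's lemma on \<open>Z\<^sub>t\<close> and condition (N) on \<open>E\<close>. Outside \<open>Z\<^sub>t \<union> E\<close>, up to a null set,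
  the space is a countable union of compact sets on which \<open>F\<^sub>t\<close> is injective with nonzero Jacobian, and the change of
  variables formula on these pieces yields the density and the disintegration. The preimage
  of a null set is almost contained in \<open>Z\<^sub>t\<close>, so \<open>\<rho>(t)(C\<^sub>t)\<close> is the integral of the initial density over \<open>Z\<^sub>t\<close>.
\<close>

text \<open>The power \<open>1 / N\<close> in the oscillation estimate serves both applications.
  Raised to the power \<open>N\<close>, the oscillation on a cube is at most a constant times the
  integral of a fixed density over it, which is additive over nonoverlapping cubes; images of null
  sets are therefore null. On a cube of side \<open>r\<close>, the same bound is a multiple of
  \<open>r\<close> times the \<open>N\<close>-th root of an average, hence \<open>o(r)\<close> where
  averages of the weight can be made small. A gradient merely in \<open>L^N\<close> gives no such
  bound when N >= 2, because the Riesz kernel \<open>|y - x|^(1 - N)\<close> just fails to lie in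
  the dual space. The way out is to cut the kernel at a radius that depends on the level \<sigma> of
  the gradient. Close to \<open>x\<close>, each level contributes at most its radius, whatever the
  gradient is, and the Lorentz condition provides radii with finite integral over all levels. Away
  from \<open>x\<close>, the kernel is bounded, and the bounds add up to the weight. A free factor
  \<tau> in the radius is balanced at the end, which produces the root. The null set in the
  differentiation theorem depends on \<open>b\<close>; this is why \<open>b\<close> runs through a
  countable dense set.\<close>

section \<open>Measures of differentiable images\<close>

text \<open>The library states the change of variables results for well-ordered index types only; they are
  transported to an arbitrary finite index type along a bijection.\<close>

typedef ('a::finite) index = "{..<CARD('a)}"
  by (auto intro: finite_UNIV_card_ge_0 exI[of _ 0])

instantiation index :: (finite) "{finite, wellorder}"
begin

definition less_eq_index :: "'a index \<Rightarrow> 'a index \<Rightarrow> bool" where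
  "less_eq_index i j \<longleftrightarrow> Rep_index i \<le> Rep_index j"

definition less_index :: "'a index \<Rightarrow> 'a index \<Rightarrow> bool" where
  "less_index i j \<longleftrightarrow> Rep_index i < Rep_index j"

instance
proof
  have "UNIV = (Abs_index ` {..<CARD('a)} :: 'a index set)"
    using type_definition.Abs_image[OF type_definition_index] by auto
  then show "finite (UNIV :: 'a index set)"
    by (metis finite_imageI finite_lessThan)
next
  fix P :: "'a index \<Rightarrow> bool" and i :: "'a index"
  assume step: "\<And>j. (\<And>k. k < j \<Longrightarrow> P k) \<Longrightarrow> P j"
  show "P i"
    by (induction i rule: measure_induct_rule[where f = Rep_index])
      (rule step, auto simp: less_index_def)
qed (auto simp: less_eq_index_def less_index_def Rep_index_inject)

end

lemma card_index: "CARD('a::finite index) = CARD('a)"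
proof -
  have "bij_betw Rep_index (UNIV :: 'a index set) {..<CARD('a)}"
    using type_definition_index bij_betw_def type_definition.Rep_range type_definition.Rep_inject
    by (metis injI)
  then show ?thesis
    by (simp add: bij_betw_same_card)
qed

definition reindex :: "'a::finite index \<Rightarrow> 'a" where
  "reindex = (SOME f. bij f)"

lemma bij_reindex: "bij (reindex :: 'a::finite index \<Rightarrow> 'a)"
proof -
  have "\<exists>f :: 'a index \<Rightarrow> 'a. bij f"
    by (rule finite_same_card_bij) (auto simp: card_index)
  then show ?thesis
    unfolding reindex_def by (rule someI_ex)
qed

text \<open>Conjugation by \<sigma> is a bijection between the permutations of the two index types
  and preserves signs, so the Leibniz expansions match term by term. No order on either type is
  involved.\<close>

lemma det_reindex:
  fixes A :: "real^'n^'n" and \<sigma> :: "'m::finite \<Rightarrow> 'n"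
  assumes \<sigma>: "bij \<sigma>"
  shows "det (\<chi> i j. A $ \<sigma> i $ \<sigma> j) = det A"
proof -
  let ?f = "map_permutation UNIV \<sigma>"
  let ?g = "map_permutation UNIV (inv \<sigma>)"
  have inj: "inj \<sigma>" "inj (inv \<sigma>)"
    using \<sigma> by (auto simp: bij_is_inj bij_imp_bij_inv)
  have o: "\<sigma> \<circ> inv \<sigma> = id"
    using bij_is_surj[OF \<sigma>] surj_iff by blast
  have fg: "?f (?g a) = a" if "a permutes UNIV" for a
    using map_permutation_compose[of "inv \<sigma>" UNIV UNIV \<sigma> a] inj(1) bij_imp_bij_inv[OF \<sigma>] that o by simp
  have "det A = (\<Sum>p\<in>{p. p permutes (UNIV :: 'm set)}.
      of_int (sign (?f p)) * prod (\<lambda>i. A $ i $ (?f p) i) UNIV)"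
    unfolding det_def
  proof (rule sum.reindex_bij_witness[where i = ?f and j = ?g], goal_cases)
    case (1 a) then show ?case
      using fg by simp
  next
    case (2 a) then show ?case
      using map_permutation_permutes[of "inv \<sigma>" UNIV UNIV a] \<sigma> by (auto simp: bij_imp_bij_inv)
  next
    case (3 a) then show ?case
      by (subst map_permutation_compose) (use \<sigma> inj in \<open>auto simp: bij_is_inj\<close>)
  next
    case (4 a) then show ?case
      using map_permutation_permutes[of "\<sigma>" UNIV UNIV a] \<sigma> by auto
  next
    case (5 a)
    have "?f (?g a) = a"
      using 5 fg by simp
    then show ?case by simp
  qed
  also have "\<dots> = (\<Sum>p\<in>{p. p permutes (UNIV :: 'm set)}.
      of_int (sign p) * prod (\<lambda>i. A $ \<sigma> i $ \<sigma> (p i)) UNIV)"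
  proof (rule sum.cong[OF refl])
    fix p :: "'m \<Rightarrow> 'm" assume "p \<in> {p. p permutes (UNIV :: 'm set)}"
    then have p: "p permutes UNIV" by simp
    have "prod (\<lambda>i. A $ i $ (?f p) i) UNIV = prod (\<lambda>i. A $ \<sigma> i $ (?f p) (\<sigma> i)) UNIV"
      by (rule prod.reindex_bij_betw[OF \<sigma>, symmetric])
    also have "\<dots> = prod (\<lambda>i. A $ \<sigma> i $ \<sigma> (p i)) UNIV"
      using inj by (simp add: map_permutation_apply)
    finally show "of_int (sign (?f p)) * prod (\<lambda>i. A $ i $ (?f p) i) UNIV =
        of_int (sign p) * prod (\<lambda>i. A $ \<sigma> i $ \<sigma> (p i)) UNIV"
      using sign_map_permutation[OF inj(1) p] by simp
  qed
  also have "\<dots> = det (\<chi> i j. A $ \<sigma> i $ \<sigma> j)"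
    by (simp add: det_def)
  finally show ?thesis by simp
qed

definition to_idx :: "real^'n \<Rightarrow> real^('n index)" where
  "to_idx x = (\<chi> i. x $ reindex i)"

definition of_idx :: "real^('n index) \<Rightarrow> real^'n" where
  "of_idx x = (\<chi> i. x $ inv reindex i)"

lemma of_to_idx [simp]: "of_idx (to_idx x) = x"
  by (simp add: of_idx_def to_idx_def vec_eq_iff surj_f_inv_f[OF bij_is_surj[OF bij_reindex]])

lemma to_of_idx [simp]: "to_idx (of_idx x) = x"
  by (simp add: of_idx_def to_idx_def vec_eq_iff inv_f_f[OF bij_is_inj[OF bij_reindex]])

lemma linear_to_idx: "linear to_idx"
  by (auto intro!: linearI simp: to_idx_def vec_eq_iff)

lemma linear_of_idx: "linear of_idx"
  by (auto intro!: linearI simp: of_idx_def vec_eq_iff)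

lemma has_derivative_to_idx: "(to_idx has_derivative to_idx) F"
  by (simp add: linear_to_idx linear_imp_has_derivative)

lemma has_derivative_of_idx: "(of_idx has_derivative of_idx) F"
  by (simp add: linear_of_idx linear_imp_has_derivative)

text \<open>Conjugation by the relabelling permutes rows and columns by the same bijection, so even
  the sign of the determinant is preserved.\<close>

lemma det_conj_idx:
  fixes f :: "real^'n \<Rightarrow> real^'n"
  shows "det (matrix (\<lambda>x. to_idx (f (of_idx x)))) = det (matrix f)"
proof -
  have "of_idx (axis j 1) = (axis (reindex j) 1 :: real^'n)" for j :: "'n index"
    by (auto simp: of_idx_def axis_def vec_eq_iff inv_f_f[OF bij_is_inj[OF bij_reindex]]
        surj_f_inv_f[OF bij_is_surj[OF bij_reindex]])
  then have "matrix (\<lambda>x. to_idx (f (of_idx x))) = (\<chi> i j. matrix f $ reindex i $ reindex j)"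
    by (simp add: matrix_def to_idx_def)
  then show ?thesis
    using det_reindex[OF bij_reindex] by metis
qed

text \<open>Lebesgue measure is determined by its values on boxes, and relabelling the coordinates
  only reorders the factors of the volume of a box.\<close>

lemma lborel_distr_to_idx: "distr lborel borel to_idx = (lborel :: (real^('n::finite index)) measure)"
proof (rule lborel_eqI[symmetric])
  have meas: "(to_idx :: real^'n \<Rightarrow> _) \<in> borel_measurable borel"
    by (intro borel_measurable_continuous_onI linear_continuous_on)
      (simp add: linear_linear linear_to_idx)
  fix l u :: "real^('n index)"
  assume lu: "\<And>b. b \<in> Basis \<Longrightarrow> l \<bullet> b \<le> u \<bullet> b"
  then have lu': "l $ i \<le> u $ i" for i
    by (metis axis_in_Basis_iff inner_axis inner_commute real_inner_1_right Basis_real_def singletonI)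
  have r: "inv reindex (reindex i) = i" "reindex (inv reindex j) = j" for i :: "'n index" and j
    by (auto simp: inv_f_f[OF bij_is_inj[OF bij_reindex]]
        surj_f_inv_f[OF bij_is_surj[OF bij_reindex]])
  have eq: "to_idx -` box l u = box (of_idx l) (of_idx u)"
    by (auto simp: mem_box_cart to_idx_def of_idx_def r) (metis r)+
  have "emeasure (distr lborel borel to_idx) (box l u) = emeasure lborel (box (of_idx l) (of_idx u))"
    using meas by (simp add: emeasure_distr eq)
  also have "\<dots> = ennreal (measure lborel (cbox (of_idx l) (of_idx u)))"
  proof -
    have "of_idx l \<bullet> b \<le> of_idx u \<bullet> b" if "b \<in> Basis" for b
      using that by (auto simp: Basis_vec_def inner_axis of_idx_def lu')
    then show ?thesis
      by (simp add: emeasure_lborel_box content_cbox inner_diff_left)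
  qed
  also have "measure lborel (cbox (of_idx l) (of_idx u)) = (\<Prod>i\<in>UNIV. of_idx u $ i - of_idx l $ i)"
    by (rule content_cbox_cart) (auto simp: of_idx_def lu' interval_ne_empty_cart)
  also have "\<dots> = (\<Prod>i\<in>UNIV. u $ i - l $ i)"
    by (subst prod.reindex_bij_betw[OF bij_reindex, symmetric]) (simp add: of_idx_def r)
  also have "\<dots> = measure lborel (cbox l u)"
    by (rule content_cbox_cart[symmetric]) (auto simp: lu' interval_ne_empty_cart)
  also have "\<dots> = (\<Prod>b\<in>Basis. (u - l) \<bullet> b)"
    using lu by (simp add: content_cbox inner_diff_left)
  finally show "emeasure (distr lborel borel to_idx) (box l u) = ennreal (\<Prod>b\<in>Basis. (u - l) \<bullet> b)" .
qed simp


lemma lebesgue_distr_to_idx: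
  "distr lebesgue lebesgue to_idx = (lebesgue :: (real^('n::finite index)) measure)"
proof -
  have meas: "(to_idx :: real^'n \<Rightarrow> _) \<in> borel_measurable borel"
    by (intro borel_measurable_continuous_onI linear_continuous_on)
      (simp add: linear_linear linear_to_idx)
  have "completion (distr lebesgue lborel (to_idx :: real^'n \<Rightarrow> _)) = distr lebesgue (completion lborel) to_idx"
    using meas
    by (intro completion.completion_distr_eq)
      (auto simp: distr_completion lborel_distr_to_idx measurable_completion cong: distr_cong)
  moreover have "distr lebesgue lborel (to_idx :: real^'n \<Rightarrow> _) = lborel"
    using meas by (simp add: distr_completion lborel_distr_to_idx cong: distr_cong)
  ultimately show ?thesis by simp
qed

lemma to_idx_vimage_eq: "to_idx -` A = of_idx ` (A :: (real^('n::finite index)) set)"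
proof
  show "to_idx -` A \<subseteq> of_idx ` A" by (metis image_eqI of_to_idx subsetI vimage_eq)
qed auto

lemma measurable_to_idx: "(to_idx :: real^'n \<Rightarrow> real^('n::finite index)) \<in> lebesgue \<rightarrow>\<^sub>M lebesgue"
proof (rule measurableI)
  fix A :: "(real^'n index) set" assume A: "A \<in> sets lebesgue"
  show "to_idx -` A \<inter> space lebesgue \<in> sets lebesgue"
    using differentiable_image_in_sets_lebesgue[OF A, of of_idx]
    by (simp add: to_idx_vimage_eq linear_of_idx linear_imp_differentiable_on card_index)
qed simp

lemma to_idx_image_lebesgue: "A \<in> sets lebesgue \<Longrightarrow> to_idx ` A \<in> sets lebesgue"
  using differentiable_image_in_sets_lebesgue[of A to_idx]
  by (auto simp: linear_to_idx linear_imp_differentiable_on card_index)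

lemma emeasure_to_idx_image:
  assumes A: "A \<in> sets lebesgue"
  shows "emeasure lebesgue (to_idx ` A) = emeasure lebesgue A"
proof -
  have "emeasure lebesgue (to_idx ` A) = emeasure (distr lebesgue lebesgue to_idx) (to_idx ` A)"
    by (simp add: lebesgue_distr_to_idx)
  also have "\<dots> = emeasure lebesgue (to_idx -` (to_idx ` A))"
    by (subst emeasure_distr[OF measurable_to_idx to_idx_image_lebesgue[OF A]]) simp
  also have "to_idx -` (to_idx ` A) = A"
    by (simp add: to_idx_vimage_eq image_image)
  finally show ?thesis .
qed

lemma has_derivative_conj_idx:
  assumes "\<And>x. x \<in> S \<Longrightarrow> (f has_derivative f' x) (at x within S)" "y \<in> to_idx ` S"
  shows "((\<lambda>y. to_idx (f (of_idx y))) has_derivative (\<lambda>v. to_idx (f' (of_idx y) (of_idx v))))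
    (at y within to_idx ` S)"
proof -
  have im: "of_idx ` to_idx ` S = S" by (simp add: image_image)
  have "((\<lambda>y. f (of_idx y)) has_derivative (\<lambda>v. f' (of_idx y) (of_idx v))) (at y within to_idx ` S)"
    by (rule has_derivative_in_compose2[where t = S and g = f and f = of_idx])
      (use assms im in \<open>auto intro: has_derivative_of_idx\<close>)
  from has_derivative_compose[OF this, of to_idx to_idx] has_derivative_to_idx show ?thesis
    by blast
qed

theorem baby_Sard_finite:
  fixes f :: "real^'n \<Rightarrow> real^'n"
  assumes der: "\<And>x. x \<in> S \<Longrightarrow> (f has_derivative f' x) (at x within S)"
    and sing: "\<And>x. x \<in> S \<Longrightarrow> det (matrix (f' x)) = 0"
  shows "negligible (f ` S)"
proof -
  let ?g = "\<lambda>y. to_idx (f (of_idx y))"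
  let ?g' = "\<lambda>y v. to_idx (f' (of_idx y) (of_idx v))"
  have "negligible (?g ` (to_idx ` S))"
  proof (rule baby_Sard)
    fix y assume y: "y \<in> to_idx ` S"
    show "(?g has_derivative ?g' y) (at y within to_idx ` S)"
      by (rule has_derivative_conj_idx[OF der y])
    then show "rank (matrix (?g' y)) < CARD('n index)"
      using y sing by (auto simp: det_eq_0_rank[symmetric] det_conj_idx)
  qed simp
  then have "negligible (of_idx ` ?g ` to_idx ` S)"
    by (rule negligible_differentiable_image_negligible[rotated])
      (auto simp: linear_of_idx linear_imp_differentiable_on card_index)
  also have "of_idx ` ?g ` to_idx ` S = f ` S"
    by (simp add: image_image)
  finally show ?thesis .
qed

lemma borel_measurable_det_Jacobian_finite:
  fixes f :: "real^'n \<Rightarrow> real^'n"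
  assumes S: "S \<in> sets lebesgue" and f: "\<And>x. x \<in> S \<Longrightarrow> (f has_derivative f' x) (at x within S)"
  shows "(\<lambda>x. det (matrix (f' x))) \<in> borel_measurable (lebesgue_on S)"
proof -
  let ?g' = "\<lambda>y v. to_idx (f' (of_idx y) (of_idx v))"
  have "(\<lambda>y. det (matrix (?g' y))) \<in> borel_measurable (lebesgue_on (to_idx ` S))"
    by (rule borel_measurable_det_Jacobian[OF to_idx_image_lebesgue[OF S] has_derivative_conj_idx[OF f]])
  moreover have "to_idx \<in> lebesgue_on S \<rightarrow>\<^sub>M lebesgue_on (to_idx ` S)"
    by (intro measurable_restrict_space2 measurable_restrict_space1 measurable_to_idx) auto
  ultimately have "(\<lambda>x. det (matrix (?g' (to_idx x)))) \<in> borel_measurable (lebesgue_on S)"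
    by (rule measurable_compose[rotated])
  then show ?thesis
    by (simp add: det_conj_idx)
qed

text \<open>An extended-valued form of the change of variables, ready to be read as an equality
  between a push-forward and a measure with density. Finite measure of the image makes the
  real-valued version applicable.\<close>

theorem emeasure_differentiable_image:
  fixes f :: "real^'n \<Rightarrow> real^'n"
  assumes S: "S \<in> sets lebesgue"
    and der: "\<And>x. x \<in> S \<Longrightarrow> (f has_derivative f' x) (at x within S)"
    and inj: "inj_on f S" and fS: "f ` S \<in> lmeasurable"
  shows "emeasure lebesgue (f ` S) = (\<integral>\<^sup>+x. indicator S x * ennreal \<bar>det (matrix (f' x))\<bar> \<partial>lebesgue)"
proof -
  let ?g = "\<lambda>y. to_idx (f (of_idx y))"
  let ?g' = "\<lambda>y v. to_idx (f' (of_idx y) (of_idx v))"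
  let ?T = "to_idx ` S"
  let ?j = "\<lambda>y. \<bar>det (matrix (?g' y))\<bar>"
  note T = to_idx_image_lebesgue[OF S]
  note der' = has_derivative_conj_idx[OF der]
  have gT: "?g ` ?T = to_idx ` f ` S"
    by (simp add: image_image)
  have em: "emeasure lebesgue (?g ` ?T) = emeasure lebesgue (f ` S)"
    unfolding gT using fS by (intro emeasure_to_idx_image) auto
  have "?g ` ?T \<in> lmeasurable"
    using fS em to_idx_image_lebesgue[of "f ` S"] unfolding gT by (auto simp: fmeasurable_def)
  moreover have "inj_on ?g ?T"
    using inj by (simp add: inj_on_def ball_simps) (metis of_to_idx)
  ultimately have "(?j has_integral measure lebesgue (?g ` ?T)) ?T"
    using has_measure_differentiable_image[OF T der'] by auto
  then have "(\<integral>\<^sup>+y. ennreal (indicator ?T y * ?j y) \<partial>lborel) = ennreal (measure lebesgue (?g ` ?T))"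
    by (intro nn_integral_has_integral_lebesgue) auto
  also have "\<dots> = emeasure lebesgue (?g ` ?T)"
    using \<open>?g ` ?T \<in> lmeasurable\<close> by (simp add: emeasure_eq_measure2 fmeasurableD2 emeasure_eq_ennreal_measure)
  also have "\<dots> = emeasure lebesgue (f ` S)" by (rule em)
  finally have 1: "emeasure lebesgue (f ` S) = (\<integral>\<^sup>+y. ennreal (indicator ?T y * ?j y) \<partial>lebesgue)"
    by (simp add: nn_integral_completion)
  have jm: "(\<lambda>y. indicator ?T y * ?j y) \<in> borel_measurable lebesgue"
  proof -
    have "?j \<in> borel_measurable (lebesgue_on ?T)"
      using borel_measurable_det_Jacobian[OF T der'] by measurable
    then show ?thesis
      using T by (simp add: borel_measurable_restrict_space_iff)
  qed
  have "(\<integral>\<^sup>+y. ennreal (indicator ?T y * ?j y) \<partial>lebesgue)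
      = (\<integral>\<^sup>+y. ennreal (indicator ?T y * ?j y) \<partial>distr lebesgue lebesgue to_idx)"
    by (simp add: lebesgue_distr_to_idx)
  also have "\<dots> = (\<integral>\<^sup>+x. ennreal (indicator ?T (to_idx x) * ?j (to_idx x)) \<partial>lebesgue)"
    using jm by (intro nn_integral_distr measurable_to_idx) simp
  also have "\<dots> = (\<integral>\<^sup>+x. indicator S x * ennreal \<bar>det (matrix (f' x))\<bar> \<partial>lebesgue)"
  proof (intro nn_integral_cong)
    fix x :: "real^'n"
    have "(to_idx x \<in> ?T) = (x \<in> S)" by (metis image_iff of_to_idx)
    then show "ennreal (indicator ?T (to_idx x) * ?j (to_idx x)) = indicator S x * ennreal \<bar>det (matrix (f' x))\<bar>"
      by (auto simp: indicator_def det_conj_idx)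
  qed
  finally show ?thesis using 1 by simp
qed

section \<open>Differentiability of flows\<close>

text \<open>The square of the norm stays differentiable where \<open>e\<close> vanishes. Adding
  \<open>\<epsilon>\<^sup>2\<close> to it absorbs the forcing term, since twice the product of
  \<epsilon> and the norm is at most the sum of their squares; this accounts for the summand 1 in
  the rate.\<close>

lemma gronwall_sq:
  fixes e :: "real \<Rightarrow> 'a::real_inner"
  assumes der: "\<And>s. (e has_vector_derivative e' s) (at s)"
    and bound: "\<And>s. 0 \<le> s \<Longrightarrow> s \<le> t \<Longrightarrow> norm (e' s) \<le> K * norm (e s) + \<epsilon>"
    and nonneg: "0 \<le> t" "0 \<le> K" "0 \<le> \<epsilon>"
  shows "(norm (e t))\<^sup>2 \<le> ((norm (e 0))\<^sup>2 + \<epsilon>\<^sup>2) * exp ((2 * K + 1) * t)"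
proof -
  define L where "L = 2 * K + 1"
  define \<phi> where "\<phi> s = (e s \<bullet> e s + \<epsilon>\<^sup>2) * exp (- (L * s))" for s
  have d: "((\<lambda>s. e s \<bullet> e s) has_real_derivative 2 * (e s \<bullet> e' s)) (at s)" for s
    using der[of s] unfolding has_vector_derivative_def has_field_derivative_def
    by (auto intro!: derivative_eq_intros simp: inner_commute algebra_simps)
  have d\<phi>: "(\<phi> has_real_derivative (2 * (e s \<bullet> e' s) - L * (e s \<bullet> e s + \<epsilon>\<^sup>2)) * exp (- (L * s))) (at s)" for s
    unfolding \<phi>_def by (auto intro!: derivative_eq_intros d simp: algebra_simps)
  have neg: "(2 * (e s \<bullet> e' s) - L * (e s \<bullet> e s + \<epsilon>\<^sup>2)) * exp (- (L * s)) \<le> 0" if s: "0 \<le> s" "s \<le> t" for s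
  proof -
    let ?n = "norm (e s)"
    have "e s \<bullet> e' s \<le> ?n * norm (e' s)" by (rule norm_cauchy_schwarz)
    also have "\<dots> \<le> ?n * (K * ?n + \<epsilon>)"
      by (intro mult_left_mono bound s) simp
    finally have "2 * (e s \<bullet> e' s) \<le> 2 * K * ?n\<^sup>2 + 2 * ?n * \<epsilon>"
      by (simp add: power2_eq_square algebra_simps)
    also have "2 * ?n * \<epsilon> \<le> ?n\<^sup>2 + \<epsilon>\<^sup>2"
      by (rule sum_squares_bound)
    also have "2 * K * ?n\<^sup>2 + (?n\<^sup>2 + \<epsilon>\<^sup>2) \<le> L * (?n\<^sup>2 + \<epsilon>\<^sup>2)"
      using nonneg by (simp add: L_def algebra_simps)
    finally show ?thesis
      by (simp add: mult_le_0_iff power2_norm_eq_inner)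
  qed
  have "\<phi> t \<le> \<phi> 0"
    by (rule DERIV_nonpos_imp_nonincreasing[OF nonneg(1)]) (use d\<phi> neg in blast)
  then have "(norm (e t))\<^sup>2 + \<epsilon>\<^sup>2 \<le> ((norm (e 0))\<^sup>2 + \<epsilon>\<^sup>2) * exp (L * t)"
    by (simp add: \<phi>_def power2_norm_eq_inner exp_minus field_simps)
  moreover have "0 \<le> \<epsilon>\<^sup>2" by simp
  ultimately show ?thesis unfolding L_def by linarith
qed

text \<open>Reversing time covers negative \<open>t\<close>. Bounding the exponential by its own
  square makes the right side of the squared estimate a perfect square, at the price of a rate twice
  as large as necessary.\<close>

lemma gronwall_norm:
  fixes e :: "real \<Rightarrow> 'a::real_inner"
  assumes der: "\<And>s. (e has_vector_derivative e' s) (at s)"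
    and bound: "\<And>s. \<bar>s\<bar> \<le> \<bar>t\<bar> \<Longrightarrow> norm (e' s) \<le> K * norm (e s) + \<epsilon>"
    and nonneg: "0 \<le> K" "0 \<le> \<epsilon>"
  shows "norm (e t) \<le> (norm (e 0) + \<epsilon>) * exp ((2 * K + 1) * \<bar>t\<bar>)"
proof -
  let ?E = "exp ((2 * K + 1) * \<bar>t\<bar>)"
  have "(norm (e t))\<^sup>2 \<le> ((norm (e 0))\<^sup>2 + \<epsilon>\<^sup>2) * ?E"
  proof (cases "0 \<le> t")
    case True
    then show ?thesis
      using gronwall_sq[of e e' t K \<epsilon>] assms by simp
  next
    case False
    have d: "((\<lambda>s. e (- s)) has_vector_derivative - e' (- s)) (at s)" for s
      using vector_diff_chain_at[OF has_vector_derivative_minus[OF has_vector_derivative_id] der[of "- s"]]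
      by (simp add: o_def)
    show ?thesis
      using gronwall_sq[of "\<lambda>s. e (- s)" "\<lambda>s. - e' (- s)" "- t" K \<epsilon>] d False assms by simp
  qed
  also have "\<dots> \<le> (norm (e 0) + \<epsilon>)\<^sup>2 * ?E\<^sup>2"
  proof (rule mult_mono)
    show "(norm (e 0))\<^sup>2 + \<epsilon>\<^sup>2 \<le> (norm (e 0) + \<epsilon>)\<^sup>2"
      using nonneg by (simp add: power2_sum)
    have "1 \<le> ?E" using nonneg by simp
    then show "?E \<le> ?E\<^sup>2" by (simp add: power2_eq_square)
  qed auto
  finally show ?thesis
    using nonneg by (simp add: power_mult_distrib[symmetric] power2_le_iff_abs_le)
qed

text \<open>A criterion without a candidate derivative: asymptotically, \<open>w\<close> respects the linear relations
  among small vectors. For a flow it follows from Gronwall, so no variational equation has to be solved.\<close>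

lemma has_derivative_from_linear_relations:
  fixes w :: "'a::euclidean_space \<Rightarrow> 'b::banach"
  assumes A: "\<And>\<epsilon>. \<epsilon> > 0 \<Longrightarrow> \<exists>\<delta>>0. \<forall>(I :: 'a option set) c v.
      finite I \<and> (\<forall>i\<in>I. norm (v i) < \<delta>) \<and> (\<Sum>i\<in>I. c i *\<^sub>R v i) = 0 \<longrightarrow>
      norm (\<Sum>i\<in>I. c i *\<^sub>R w (v i)) \<le> \<epsilon> * (\<Sum>i\<in>I. \<bar>c i\<bar> * norm (v i))"
  shows "\<exists>D. (w has_derivative D) (at 0)"
proof -
  define P where "P \<epsilon> \<delta> \<longleftrightarrow> (\<forall>(I :: 'a option set) c v.
      finite I \<and> (\<forall>i\<in>I. norm (v i) < \<delta>) \<and> (\<Sum>i\<in>I. c i *\<^sub>R v i) = 0 \<longrightarrow>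
      norm (\<Sum>i\<in>I. c i *\<^sub>R w (v i)) \<le> \<epsilon> * (\<Sum>i\<in>I. \<bar>c i\<bar> * norm (v i)))" for \<epsilon> \<delta>
  have PI: "\<exists>\<delta>. \<delta> > 0 \<and> P \<epsilon> \<delta>" if "\<epsilon> > 0" for \<epsilon>
    unfolding P_def by (rule A[OF that])
  have PD: "norm (\<Sum>i\<in>I. c i *\<^sub>R w (v i)) \<le> \<epsilon> * (\<Sum>i\<in>I. \<bar>c i\<bar> * norm (v i))"
    if "P \<epsilon> \<delta>" "finite I" "\<forall>i\<in>I. norm (v i) < \<delta>" "(\<Sum>i\<in>I. c i *\<^sub>R v i) = 0"
    for \<epsilon> \<delta> c v and I :: "'a option set"
    using that unfolding P_def by (elim allE impE) (rule conjI[OF _ conjI])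
  have w0: "w 0 = 0"
  proof -
    obtain \<delta> where "\<delta> > 0" and D: "P 1 \<delta>" using PI[OF zero_less_one] by auto
    have "norm (\<Sum>i\<in>{None}. 1 *\<^sub>R w 0) \<le> 1 * (\<Sum>i\<in>{None::'a option}. \<bar>1\<bar> * norm (0::'a))"
      using PD[OF D, of "{None}" "\<lambda>_. 0" "\<lambda>_. 1"] \<open>\<delta> > 0\<close> by simp
    then show ?thesis by simp
  qed
  \<comment> \<open>Difference quotients of \<open>w\<close> in the direction \<open>b\<close>, with
    step \<open>1 / (k + 1)\<close>. Their limits are the only candidates for the partial
    derivatives.\<close>
  define X where "X b k = real (Suc k) *\<^sub>R w (b /\<^sub>R real (Suc k))" for b k
  have "Cauchy (X b)" if b: "b \<in> Basis" for b
  proof (rule CauchyI)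
    fix e :: real assume "e > 0"
    then have "e / 3 > 0" by simp
    from PI[OF this] obtain \<delta> where "\<delta> > 0" and D: "P (e / 3) \<delta>" by auto
    obtain M where M: "inverse (real (Suc M)) < \<delta>"
      using reals_Archimedean[OF \<open>\<delta> > 0\<close>] by blast
    have small: "norm (b /\<^sub>R real (Suc k)) < \<delta>" if "k \<ge> M" for k
    proof -
      have "inverse (real (Suc k)) \<le> inverse (real (Suc M))"
        using that by (intro le_imp_inverse_le) auto
      then have "inverse (real (Suc k)) < \<delta>" using M by linarith
      then show ?thesis using b by (simp del: of_nat_Suc)
    qed
    show "\<exists>M. \<forall>m\<ge>M. \<forall>n\<ge>M. norm (X b m - X b n) < e"
    proof (intro exI allI impI)
      fix m n assume mn: "M \<le> m" "M \<le> n"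
      \<comment> \<open>The relation used is that \<open>m + 1\<close> times
        \<open>b / (m + 1)\<close> equals \<open>n + 1\<close> times \<open>b / (n + 1)\<close>. The
        index \<open>Some 0\<close> is just some second element of the index type.\<close>
      let ?c = "\<lambda>i::'a option. if i = None then real (Suc m) else - real (Suc n)"
      let ?v = "\<lambda>i::'a option. if i = None then b /\<^sub>R real (Suc m) else b /\<^sub>R real (Suc n)"
      have "norm (\<Sum>i\<in>{None, Some 0}. ?c i *\<^sub>R w (?v i)) \<le> e / 3 * (\<Sum>i\<in>{None, Some 0}. \<bar>?c i\<bar> * norm (?v i))"
      proof (rule PD[OF D])
        show "\<forall>i\<in>{None, Some 0}. norm (?v i) < \<delta>"
          using small[OF mn(1)] small[OF mn(2)] by (simp del: of_nat_Suc)
        show "(\<Sum>i\<in>{None, Some 0}. ?c i *\<^sub>R ?v i) = 0"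
          by (simp del: of_nat_Suc)
      qed simp
      also have "(\<Sum>i\<in>{None, Some 0}. \<bar>?c i\<bar> * norm (?v i)) = 2"
        using b by (simp del: of_nat_Suc)
      finally show "norm (X b m - X b n) < e"
        using \<open>e > 0\<close> by (simp add: X_def del: of_nat_Suc)
    qed
  qed
  then have "\<exists>L. X b \<longlonglongrightarrow> L" if "b \<in> Basis" for b
    using that Cauchy_convergent_iff convergent_def by blast
  then obtain D where D: "\<And>b. b \<in> Basis \<Longrightarrow> X b \<longlonglongrightarrow> D b"
    by metis
  define T where "T v = (\<Sum>b\<in>Basis. (v \<bullet> b) *\<^sub>R D b)" for v
  have "bounded_linear T"
    unfolding T_def by (intro bounded_linear_sum bounded_linear_scaleR_const bounded_linear_inner_left)
  have "(w has_derivative T) (at 0)"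
    unfolding has_derivative_at_alt
  proof (intro conjI allI impI \<open>bounded_linear T\<close>)
    fix e :: real assume e: "e > 0"
    \<comment> \<open>The relation below has one term for \<open>y\<close> and one for each basis
      vector, and each of them weighs at most \<open>norm y\<close>.\<close>
    let ?N = "1 + real DIM('a)"
    have "e / ?N > 0" using e by (intro divide_pos_pos add_pos_nonneg) auto
    from PI[OF this] obtain \<delta> where "\<delta> > 0" and R: "P (e / ?N) \<delta>" by auto
    obtain M where M: "inverse (real (Suc M)) < \<delta>"
      using reals_Archimedean[OF \<open>\<delta> > 0\<close>] by blast
    have "norm (w y - w 0 - T (y - 0)) \<le> e * norm (y - 0)" if y: "norm (y - 0) < \<delta>" for y
    proof -
      \<comment> \<open>The relation expands \<open>y\<close> in the basis: \<open>None\<close>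
        carries \<open>y\<close>, and \<open>Some b\<close> carries the small multiple of
        \<open>b\<close> occurring in \<open>X b k\<close>. The bound does not depend on
        \<open>k\<close>, so it survives the limit.\<close>
      let ?S = "insert None (Some ` Basis) :: 'a option set"
      have fin: "finite ?S" by simp
      have sum_split: "(\<Sum>i\<in>?S. f i) = f None + (\<Sum>b\<in>Basis. f (Some b))" for f :: "'a option \<Rightarrow> 'c::comm_monoid_add"
        by (subst sum.insert) (auto simp: sum.reindex)
      have bnd: "norm (w y - (\<Sum>b\<in>Basis. (y \<bullet> b) *\<^sub>R X b k)) \<le> e * norm y" if k: "k \<ge> M" for k
      proof -
        let ?c = "\<lambda>i. case i of None \<Rightarrow> 1 | Some b \<Rightarrow> - (y \<bullet> b) * real (Suc k)"
        let ?v = "\<lambda>i. case i of None \<Rightarrow> y | Some b \<Rightarrow> b /\<^sub>R real (Suc k)"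
        have "inverse (real (Suc k)) \<le> inverse (real (Suc M))"
          using k by (intro le_imp_inverse_le) auto
        then have "inverse (real (Suc k)) < \<delta>" using M by linarith
        then have small: "\<forall>i\<in>?S. norm (?v i) < \<delta>"
          using y by (auto simp del: of_nat_Suc)
        have "(\<Sum>i\<in>?S. ?c i *\<^sub>R ?v i) = y - (\<Sum>b\<in>Basis. (y \<bullet> b) *\<^sub>R b)"
          unfolding sum_split by (simp add: sum_negf divide_inverse[symmetric] del: of_nat_Suc)
        then have "(\<Sum>i\<in>?S. ?c i *\<^sub>R ?v i) = 0"
          by (simp add: euclidean_representation)
        from PD[OF R fin small this]
        have "norm (\<Sum>i\<in>?S. ?c i *\<^sub>R w (?v i)) \<le> e / ?N * (\<Sum>i\<in>?S. \<bar>?c i\<bar> * norm (?v i))" .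
        moreover have "(\<Sum>i\<in>?S. \<bar>?c i\<bar> * norm (?v i)) \<le> ?N * norm y"
        proof -
          have "(\<Sum>i\<in>?S. \<bar>?c i\<bar> * norm (?v i)) = norm y + (\<Sum>b\<in>Basis. \<bar>y \<bullet> b\<bar>)"
          unfolding sum_split by (simp add: abs_mult divide_inverse[symmetric] del: of_nat_Suc)
        also have "\<dots> \<le> norm y + (\<Sum>b\<in>(Basis::'a set). norm y)"
          by (intro add_left_mono sum_mono Basis_le_norm)
          also have "\<dots> = ?N * norm y" by (simp add: algebra_simps)
          finally show ?thesis .
        qed
        then have "e / ?N * (\<Sum>i\<in>?S. \<bar>?c i\<bar> * norm (?v i)) \<le> e / ?N * (?N * norm y)"
          using \<open>e / ?N > 0\<close> by (intro mult_left_mono) auto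
        moreover have "e / ?N * (?N * norm y) = e * norm y"
          by (simp add: add_pos_nonneg add_nonneg_eq_0_iff)
        ultimately have "norm (\<Sum>i\<in>?S. ?c i *\<^sub>R w (?v i)) \<le> e * norm y"
          by linarith
        also have "(\<Sum>i\<in>?S. ?c i *\<^sub>R w (?v i)) = w y - (\<Sum>b\<in>Basis. (y \<bullet> b) *\<^sub>R X b k)"
          unfolding sum_split by (simp add: X_def sum_negf del: of_nat_Suc)
        finally show ?thesis .
      qed
      have "(\<lambda>k. norm (w y - (\<Sum>b\<in>Basis. (y \<bullet> b) *\<^sub>R X b k))) \<longlonglongrightarrow> norm (w y - T y)"
        unfolding T_def by (intro tendsto_intros D)
      then have "norm (w y - T y) \<le> e * norm y"
        by (rule LIMSEQ_le_const2) (use bnd in blast)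
      then show ?thesis by (simp add: w0)
    qed
    then show "\<exists>d>0. \<forall>y. norm (y - 0) < d \<longrightarrow> norm (w y - w 0 - T (y - 0)) \<le> e * norm (y - 0)"
      using \<open>\<delta> > 0\<close> by blast
  qed
  then show ?thesis by blast
qed

text \<open>Along a compact piece of a trajectory the linearisation error has to be small uniformly
  in time; this follows from uniform continuity of the derivative and the mean value
  inequality.\<close>

lemma uniform_linearization:
  fixes G :: "'a::euclidean_space \<Rightarrow> 'a" and G' :: "'a \<Rightarrow> 'a \<Rightarrow>\<^sub>L 'a"
  assumes G: "\<And>q. (G has_derivative blinfun_apply (G' q)) (at q)"
    and cont: "continuous_on UNIV G'" and K: "compact K" and "\<epsilon> > 0"
  shows "\<exists>\<delta>>0. \<forall>q\<in>K. \<forall>w :: 'a. norm w < \<delta> \<longrightarrow> norm (G (q + w) - G q - G' q w) \<le> \<epsilon> * norm w"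
proof -
  \<comment> \<open>The unit thickening of \<open>K\<close> is still compact and contains the
    segments from \<open>q\<close> to \<open>q + w\<close> for all \<open>w\<close> of norm less
    than 1.\<close>
  let ?K = "{q + w | q w. q \<in> K \<and> w \<in> cball 0 1}"
  have "compact ?K" by (intro compact_sums K compact_cball)
  then have "uniformly_continuous_on ?K G'"
    by (intro compact_uniformly_continuous continuous_on_subset[OF cont]) auto
  then obtain d where d: "d > 0" "\<And>x y. x \<in> ?K \<Longrightarrow> y \<in> ?K \<Longrightarrow> dist y x < d \<Longrightarrow> dist (G' y) (G' x) < \<epsilon>"
    using \<open>\<epsilon> > 0\<close> unfolding uniformly_continuous_on_def by meson
  show ?thesis
  proof (intro exI conjI ballI allI impI)
    show "min d 1 > 0" using d by simp
    fix q w :: 'a assume q: "q \<in> K" and w: "norm w < min d 1"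
    have "norm (G (q + w) - G q - G' q (q + w - q)) \<le> norm (q + w - q) * \<epsilon>"
    proof (rule differentiable_bound_linearization[where f' = "\<lambda>x. blinfun_apply (G' x)" and S = "ball q (min d 1)"])
      fix s :: real assume "s \<in> {0..1}"
      then have "norm (s *\<^sub>R w) \<le> norm w" by (simp add: mult_left_le_one_le)
      then show "q + s *\<^sub>R (q + w - q) \<in> ball q (min d 1)" using w by (simp add: dist_norm)
    next
      fix x assume x: "x \<in> ball q (min d 1)"
      have "q \<in> ?K" using q by (auto intro: exI[of _ q])
      moreover have "x \<in> ?K" using q x
        by (intro CollectI exI[of _ q] exI[of _ "x - q"]) (auto simp: dist_norm norm_minus_commute)
      ultimately have "dist (G' x) (G' q) < \<epsilon>" using d(2) x by (auto simp: dist_commute)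
      then show "onorm (blinfun_apply (G' x) - blinfun_apply (G' q)) \<le> \<epsilon>"
        by (simp add: dist_norm norm_blinfun.rep_eq minus_blinfun.rep_eq fun_diff_def)
    qed (use d has_derivative_at_withinI[OF G] in auto)
    then show "norm (G (q + w) - G q - G' q w) \<le> \<epsilon> * norm w"
      by (simp add: mult.commute)
  qed
qed

lemma flow_Lipschitz:
  fixes G :: "'a::euclidean_space \<Rightarrow> 'a"
  assumes lip: "\<And>p q. norm (G p - G q) \<le> \<kappa> * norm (p - q)" and "\<kappa> \<ge> 0"
    and flow0: "\<And>p. \<Phi> 0 p = p"
    and ode: "\<And>p s. ((\<lambda>s. \<Phi> s p) has_vector_derivative G (\<Phi> s p)) (at s)"
  shows "norm (\<Phi> t p - \<Phi> t q) \<le> exp ((2 * \<kappa> + 1) * \<bar>t\<bar>) * norm (p - q)"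
proof -
  have "((\<lambda>s. \<Phi> s p - \<Phi> s q) has_vector_derivative G (\<Phi> s p) - G (\<Phi> s q)) (at s)" for s
    by (intro has_vector_derivative_diff ode)
  from gronwall_norm[OF this, of t \<kappa> 0] lip \<open>\<kappa> \<ge> 0\<close> show ?thesis
    by (simp add: flow0 mult.commute)
qed

text \<open>A linear combination of displacements whose initial vectors cancel starts at 0 and
  solves the linearised equation up to the sum of the remainders. Gronwall keeps it small, which is
  the criterion in terms of linear relations.\<close>

theorem flow_differentiable:
  fixes G :: "'a::euclidean_space \<Rightarrow> 'a" and G' :: "'a \<Rightarrow> 'a \<Rightarrow>\<^sub>L 'a"
  assumes G: "\<And>q. (G has_derivative blinfun_apply (G' q)) (at q)"
    and cont: "continuous_on UNIV G'" and bound: "\<And>q. norm (G' q) \<le> \<kappa>"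
    and flow0: "\<And>p. \<Phi> 0 p = p"
    and ode: "\<And>p s. ((\<lambda>s. \<Phi> s p) has_vector_derivative G (\<Phi> s p)) (at s)"
  shows "\<Phi> t differentiable (at p)"
proof -
  have "\<kappa> \<ge> 0" by (rule order_trans[OF norm_ge_zero bound])
  have lip: "norm (G p - G q) \<le> \<kappa> * norm (p - q)" for p q
    by (rule differentiable_bound[of UNIV G "\<lambda>q. blinfun_apply (G' q)" \<kappa> p q])
      (use G bound[unfolded norm_blinfun.rep_eq] in auto)
  define A where "A = exp ((2 * \<kappa> + 1) * \<bar>t\<bar>)"
  have "A > 0" by (simp add: A_def)
  have A: "norm (\<Phi> s (p + v) - \<Phi> s p) \<le> A * norm v" if "\<bar>s\<bar> \<le> \<bar>t\<bar>" for s v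
  proof -
    have "norm (\<Phi> s (p + v) - \<Phi> s p) \<le> exp ((2 * \<kappa> + 1) * \<bar>s\<bar>) * norm v"
      using flow_Lipschitz[OF lip \<open>\<kappa> \<ge> 0\<close> flow0 ode, of s "p + v" p] by simp
    also have "\<dots> \<le> A * norm v"
      unfolding A_def using that \<open>\<kappa> \<ge> 0\<close> by (intro mult_right_mono) (auto intro: mult_left_mono)
    finally show ?thesis .
  qed
  define K where "K = (\<lambda>s. \<Phi> s p) ` {-\<bar>t\<bar>..\<bar>t\<bar>}"
  have "compact K"
    unfolding K_def
    by (intro compact_continuous_image continuous_at_imp_continuous_on ballI has_vector_derivative_continuous[OF ode])
      auto
  define w where "w v = \<Phi> t (p + v) - \<Phi> t p" for v
  have "\<exists>D. (w has_derivative D) (at 0)"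
  proof (rule has_derivative_from_linear_relations)
    fix \<epsilon> :: real assume "\<epsilon> > 0"
    \<comment> \<open>One factor \<open>A\<close> compensates the growth of each displacement, the
      other the amplification of the remainder by Gronwall.\<close>
    then have "\<epsilon> / (A * A) > 0" using \<open>A > 0\<close> by simp
    then obtain \<delta> where "\<delta> > 0" and \<delta>:
      "\<forall>q\<in>K. \<forall>w :: 'a. norm w < \<delta> \<longrightarrow> norm (G (q + w) - G q - G' q w) \<le> \<epsilon> / (A * A) * norm w"
      using uniform_linearization[OF G cont \<open>compact K\<close>, of "\<epsilon> / (A * A)"] by auto
    have main: "norm (\<Sum>i\<in>I. c i *\<^sub>R w (v i)) \<le> \<epsilon> * (\<Sum>i\<in>I. \<bar>c i\<bar> * norm (v i))"
      if I: "finite I" "\<forall>i\<in>I. norm (v i) < \<delta> / A" "(\<Sum>i\<in>I. c i *\<^sub>R v i) = 0"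
      for I :: "'a option set" and c v
    proof -
      let ?w = "\<lambda>i s. \<Phi> s (p + v i) - \<Phi> s p"
      let ?w' = "\<lambda>i s. G (\<Phi> s (p + v i)) - G (\<Phi> s p)"
      let ?e = "\<lambda>s. \<Sum>i\<in>I. c i *\<^sub>R ?w i s" and ?e' = "\<lambda>s. \<Sum>i\<in>I. c i *\<^sub>R ?w' i s"
      let ?r = "\<epsilon> / A * (\<Sum>i\<in>I. \<bar>c i\<bar> * norm (v i))"
      have "norm (?e t) \<le> (norm (?e 0) + ?r) * A"
        unfolding A_def
      proof (rule gronwall_norm[where e = ?e and e' = ?e' and t = t])
        show "(?e has_vector_derivative ?e' s) (at s)" for s
          by (intro has_vector_derivative_sum bounded_linear.has_vector_derivative[OF bounded_linear_scaleR_right]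
              has_vector_derivative_diff ode)
        show "0 \<le> \<epsilon> / exp ((2 * \<kappa> + 1) * \<bar>t\<bar>) * (\<Sum>i\<in>I. \<bar>c i\<bar> * norm (v i))"
          using \<open>\<epsilon> > 0\<close> by (intro mult_nonneg_nonneg sum_nonneg) auto
        fix s :: real assume s: "\<bar>s\<bar> \<le> \<bar>t\<bar>"
        then have "\<Phi> s p \<in> K"
          unfolding K_def by (intro imageI) (simp add: abs_le_iff)
        have rem: "norm (?w' i s - G' (\<Phi> s p) (?w i s)) \<le> \<epsilon> / A * norm (v i)" if "i \<in> I" for i
        proof -
          have "norm (?w i s) \<le> A * norm (v i)" by (rule A[OF s])
          also have "\<dots> < \<delta>"
            using I(2) that \<open>A > 0\<close> by (auto simp: field_simps)
          finally have "norm (?w i s) < \<delta>" .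
          from \<delta>[rule_format, OF \<open>\<Phi> s p \<in> K\<close> this]
          have "norm (?w' i s - G' (\<Phi> s p) (?w i s)) \<le> \<epsilon> / (A * A) * norm (?w i s)"
            by simp
          also have "\<dots> \<le> \<epsilon> / (A * A) * (A * norm (v i))"
            using \<open>\<epsilon> > 0\<close> \<open>A > 0\<close> by (intro mult_left_mono A[OF s]) auto
          finally show ?thesis using \<open>A > 0\<close> by simp
        qed
        have scaleR_split: "a *\<^sub>R x = a *\<^sub>R y + a *\<^sub>R (x - y)" for a and x y :: 'a
          by (simp add: scaleR_diff_right)
        have split: "?e' s = G' (\<Phi> s p) (?e s) + (\<Sum>i\<in>I. c i *\<^sub>R (?w' i s - G' (\<Phi> s p) (?w i s)))"
          unfolding blinfun.sum_right blinfun.scaleR_right sum.distrib[symmetric]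
          by (rule sum.cong[OF refl]) (rule scaleR_split)
        have "norm (?e' s) \<le> norm (G' (\<Phi> s p) (?e s)) + (\<Sum>i\<in>I. norm (c i *\<^sub>R (?w' i s - G' (\<Phi> s p) (?w i s))))"
          unfolding split by (rule order_trans[OF norm_triangle_ineq add_left_mono[OF norm_sum]])
        also have "\<dots> \<le> \<kappa> * norm (?e s) + (\<Sum>i\<in>I. \<bar>c i\<bar> * (\<epsilon> / A * norm (v i)))"
        proof (intro add_mono sum_mono)
          show "norm (G' (\<Phi> s p) (?e s)) \<le> \<kappa> * norm (?e s)"
            by (rule order_trans[OF norm_blinfun mult_right_mono[OF bound norm_ge_zero]])
          show "norm (c i *\<^sub>R (?w' i s - G' (\<Phi> s p) (?w i s))) \<le> \<bar>c i\<bar> * (\<epsilon> / A * norm (v i))" if "i \<in> I" for i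
            unfolding norm_scaleR by (rule mult_left_mono[OF rem[OF that] abs_ge_zero])
        qed
        also have "(\<Sum>i\<in>I. \<bar>c i\<bar> * (\<epsilon> / A * norm (v i))) = ?r"
          unfolding sum_distrib_left by (rule sum.cong) simp_all
        finally show "norm (?e' s) \<le> \<kappa> * norm (?e s) + \<epsilon> / exp ((2 * \<kappa> + 1) * \<bar>t\<bar>) * (\<Sum>i\<in>I. \<bar>c i\<bar> * norm (v i))"
          unfolding A_def .
      qed (use \<open>\<kappa> \<ge> 0\<close> in auto)
      also have "?e 0 = 0" using I(3) by (simp add: flow0)
      finally show ?thesis using \<open>A > 0\<close> by (simp add: w_def)
    qed
    show "\<exists>\<delta>>0. \<forall>(I :: 'a option set) c v.
      finite I \<and> (\<forall>i\<in>I. norm (v i) < \<delta>) \<and> (\<Sum>i\<in>I. c i *\<^sub>R v i) = 0 \<longrightarrow>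
      norm (\<Sum>i\<in>I. c i *\<^sub>R w (v i)) \<le> \<epsilon> * (\<Sum>i\<in>I. \<bar>c i\<bar> * norm (v i))"
    proof (intro exI[of _ "\<delta> / A"] conjI allI impI)
      show "\<delta> / A > 0" using \<open>\<delta> > 0\<close> \<open>A > 0\<close> by simp
    qed (elim conjE, rule main)
  qed
  then obtain D where D: "(w has_derivative D) (at (p - p))" by auto
  have "((\<lambda>x. x - p) has_derivative (\<lambda>v. v)) (at p)"
    by (auto intro!: derivative_eq_intros)
  from has_derivative_add_const[OF has_derivative_compose[OF this D]]
  have "((\<lambda>x. w (x - p) + \<Phi> t p) has_derivative D) (at p)" by simp
  moreover have "(\<lambda>x. w (x - p) + \<Phi> t p) = \<Phi> t" by (auto simp: w_def)
  ultimately show ?thesis by (auto simp: differentiable_def)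
qed

section \<open>Test functions\<close>

text \<open>The polynomial factor makes this class closed under differentiation.\<close>

definition flat :: "real poly \<Rightarrow> real \<Rightarrow> real" where
  "flat p x = (if x > 0 then poly p (1 / x) * exp (- (1 / x)) else 0)"

lemma poly_exp_minus_tendsto_0: "((\<lambda>u. poly p u * exp (- u)) \<longlongrightarrow> (0::real)) at_top"
proof -
  have "((\<lambda>u. \<Sum>i\<le>degree p. coeff p i * (u ^ i / exp u)) \<longlongrightarrow> (\<Sum>i\<le>degree p. coeff p i * 0)) at_top"
    by (intro tendsto_intros tendsto_power_div_exp_0)
  then show ?thesis
    by (simp add: poly_altdef sum_distrib_right exp_minus divide_inverse mult.assoc)
qed

lemma flat_right_0: "((\<lambda>x. poly p (1 / x) * exp (- (1 / x))) \<longlongrightarrow> 0) (at_right (0::real))"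
  using filterlim_compose[OF poly_exp_minus_tendsto_0 filterlim_inverse_at_top_right, of p]
  by (simp add: divide_inverse)

text \<open>For positive \<open>x\<close>, differentiating \<open>p(1 / x) exp(-1 / x)\<close>
  replaces \<open>p\<close> by \<open>u^2 (p - p')\<close> in the variable \<open>u = 1 / x\<close>;
  the exponential decay makes the formula persist at 0.\<close>

lemma flat_has_derivative:
  "(flat p has_real_derivative flat ([:0, 0, 1:] * (p - pderiv p)) x) (at x)"
proof -
  consider "x > 0" | "x < 0" | "x = 0" by linarith
  then show ?thesis
  proof cases
    case 1
    have "((\<lambda>x. poly p (1 / x) * exp (- (1 / x))) has_real_derivative flat ([:0, 0, 1:] * (p - pderiv p)) x) (at x)"
      using 1 by (auto intro!: derivative_eq_intros simp: flat_def field_simps power2_eq_square)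
    moreover have "eventually (\<lambda>y. y \<in> {0<..}) (nhds x)"
      using 1 by (intro eventually_nhds_in_open) auto
    ultimately show ?thesis
      by (subst DERIV_cong_ev[OF refl _ refl]) (auto elim!: eventually_mono simp: flat_def)
  next
    case 2
    have "eventually (\<lambda>y. y \<in> {..<0}) (nhds x)"
      using 2 by (intro eventually_nhds_in_open) auto
    then show ?thesis
      using 2 by (subst DERIV_cong_ev[OF refl, where g = "\<lambda>_. 0"])
        (auto elim!: eventually_mono simp: flat_def)
  next
    case 3
    \<comment> \<open>Dividing by \<open>h\<close> multiplies the polynomial by its variable, so the
      right difference quotient at 0 is of the same type and tends to 0.\<close>
    have "((\<lambda>h. poly (pCons 0 p) (1 / h) * exp (- (1 / h))) \<longlongrightarrow> 0) (at_right (0::real))"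
      by (rule flat_right_0)
    then have "((\<lambda>h. (flat p (0 + h) - flat p 0) / h) \<longlongrightarrow> 0) (at_right 0)"
      by (rule Lim_transform_eventually)
        (auto simp: eventually_at_right_field flat_def intro!: exI[of _ 1])
    moreover have "((\<lambda>h. (flat p (0 + h) - flat p 0) / h) \<longlongrightarrow> 0) (at_left 0)"
      by (rule Lim_transform_eventually[OF tendsto_const])
        (auto simp: eventually_at_left_field flat_def intro!: exI[of _ "-1"])
    ultimately have "((\<lambda>h. (flat p (0 + h) - flat p 0) / h) \<longlongrightarrow> 0) (at 0)"
      by (simp add: filterlim_split_at)
    then show ?thesis
      using 3 by (simp add: DERIV_def flat_def)
  qed
qed

lemma Ck_continuous: "Ck k f \<Longrightarrow> continuous_on UNIV f"
  by (cases k) (auto intro!: continuous_at_imp_continuous_on differentiable_imp_continuous_within)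

lemma Ck_Suc_imp: "Ck (Suc k) f \<Longrightarrow> Ck k f"
proof (induction k arbitrary: f)
  case 0
  then show ?case using Ck_continuous[of "Suc 0" f] by simp
next
  case (Suc k)
  then show ?case by (metis Ck.simps(2))
qed

lemma CkI:
  assumes "\<And>x. (f has_derivative f' x) (at x)" "\<And>v. Ck k (\<lambda>x. f' x v)"
  shows "Ck (Suc k) f"
proof -
  have "frechet_derivative f (at x) = f' x" for x
    using assms(1) frechet_derivative_at by metis
  then show ?thesis
    using assms by (auto simp: differentiable_def)
qed

lemma CkD: "Ck (Suc k) f \<Longrightarrow> (f has_derivative frechet_derivative f (at x)) (at x)"
  "Ck (Suc k) f \<Longrightarrow> Ck k (\<lambda>x. frechet_derivative f (at x) v)"
  by (auto simp: frechet_derivative_works)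

lemma Ck_const: "Ck k (\<lambda>x. c)"
proof (induction k arbitrary: c)
  case (Suc k)
  show ?case by (rule CkI[where f' = "\<lambda>_ _. 0"]) (auto intro: Suc)
qed simp

lemma Ck_add: "Ck k f \<Longrightarrow> Ck k g \<Longrightarrow> Ck k (\<lambda>x. f x + g x)"
proof (induction k arbitrary: f g)
  case 0
  then show ?case by (auto intro: continuous_intros)
next
  case (Suc k)
  show ?case
    by (rule CkI[OF has_derivative_add[OF CkD(1)[OF Suc.prems(1)] CkD(1)[OF Suc.prems(2)]]])
      (intro Suc.IH CkD(2) Suc.prems)
qed

lemma Ck_mult: "Ck k f \<Longrightarrow> Ck k g \<Longrightarrow> Ck k (\<lambda>x. f x * g x)"
proof (induction k arbitrary: f g)
  case 0
  then show ?case by (auto intro: continuous_intros)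
next
  case (Suc k)
  show ?case
  proof (rule CkI[OF has_derivative_mult[OF CkD(1)[OF Suc.prems(1)] CkD(1)[OF Suc.prems(2)]]])
    fix v
    show "Ck k (\<lambda>x. f x * frechet_derivative g (at x) v + frechet_derivative f (at x) v * g x)"
      by (rule Ck_add; rule Suc.IH)
        (rule Ck_Suc_imp[OF Suc.prems(1)] Ck_Suc_imp[OF Suc.prems(2)]
          CkD(2)[OF Suc.prems(1)] CkD(2)[OF Suc.prems(2)])+
  qed
qed

lemma Ck_prod: "finite A \<Longrightarrow> (\<And>i. i \<in> A \<Longrightarrow> Ck k (f i)) \<Longrightarrow> Ck k (\<lambda>x. \<Prod>i\<in>A. f i x)"
  by (induction A rule: finite_induct) (auto intro: Ck_const Ck_mult)

lemma Ck_affine_coord: "Ck k (\<lambda>x :: real^'n. a * (x $ i) + b)"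
proof (cases k)
  case 0
  then show ?thesis by (auto intro!: continuous_intros)
next
  case (Suc m)
  have "((\<lambda>x :: real^'n. a * (x $ i) + b) has_derivative (\<lambda>v. a * v $ i)) (at x)" for x
    by (auto intro!: derivative_eq_intros bounded_linear_imp_has_derivative bounded_linear_vec_nth)
  then show ?thesis unfolding Suc by (rule CkI) (rule Ck_const)
qed

lemma Ck_flat: "Ck k (\<lambda>x :: real^'n. flat p (a * (x $ i) + b))"
proof (induction k arbitrary: p)
  case 0
  have "continuous_on UNIV (flat p)"
    using flat_has_derivative DERIV_isCont continuous_at_imp_continuous_on by blast
  then show ?case
    by (auto intro!: continuous_on_compose2[of UNIV "flat p"] continuous_intros)
next
  case (Suc k)
  let ?q = "[:0, 0, 1:] * (p - pderiv p)"
  have "((\<lambda>x :: real^'n. flat p (a * (x $ i) + b)) has_derivative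
      (\<lambda>v. flat ?q (a * (x $ i) + b) * (a * v $ i))) (at x)" for x
  proof -
    have "((\<lambda>x. a * (x $ i) + b) has_derivative (\<lambda>v. a * v $ i)) (at x)"
      by (auto intro!: derivative_eq_intros bounded_linear_imp_has_derivative bounded_linear_vec_nth)
    moreover have "(flat p has_derivative (\<lambda>h. flat ?q (a * (x $ i) + b) * h)) (at (a * (x $ i) + b))"
      using flat_has_derivative[of p] unfolding has_field_derivative_def by simp
    ultimately show ?thesis by (rule has_derivative_compose)
  qed
  then show ?case
    by (rule CkI) (rule Ck_mult[OF Suc.IH Ck_const])
qed

definition bump1 :: "real \<Rightarrow> real" where
  "bump1 t = flat 1 (1 / 2 - t) * flat 1 (1 / 2 + t)"

text \<open>A product over the coordinates instead of a radial bump: the support is a cube and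
  smoothness reduces to one variable. The integral is not normalised to 1 but carried along as
  \<open>bump_mass\<close>.\<close>

definition bumpN :: "real^'n \<Rightarrow> real" where
  "bumpN z = (\<Prod>i\<in>UNIV. bump1 (z $ i))"

lemma bump1_nonneg: "0 \<le> bump1 t" and bump1_le: "bump1 t \<le> 1"
  and bump1_pos: "\<bar>t\<bar> < 1 / 2 \<Longrightarrow> 0 < bump1 t" and bump1_zero: "1 / 2 \<le> \<bar>t\<bar> \<Longrightarrow> bump1 t = 0"
  by (auto simp: bump1_def flat_def intro!: mult_le_one)

lemma bumpN_nonneg: "0 \<le> bumpN z" and bumpN_le: "bumpN z \<le> 1"
  by (auto simp: bumpN_def intro: prod_nonneg prod_le_1 bump1_nonneg bump1_le)

lemma bumpN_nonzeroD: "bumpN z \<noteq> 0 \<Longrightarrow> \<bar>z $ i\<bar> < 1 / 2"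
  using bump1_zero[of "z $ i"] by (force simp: bumpN_def not_less[symmetric])

lemma Ck_bumpN: "Ck k (\<lambda>y :: real^'n. bumpN ((1 / r) *\<^sub>R (y - p)))"
proof -
  have "(\<lambda>y :: real^'n. bumpN ((1 / r) *\<^sub>R (y - p))) = (\<lambda>y. \<Prod>i\<in>UNIV.
      flat 1 ((- 1 / r) * (y $ i) + (1 / 2 + p $ i / r)) * flat 1 ((1 / r) * (y $ i) + (1 / 2 - p $ i / r)))"
    by (simp add: bumpN_def bump1_def algebra_simps diff_divide_distrib)
  then show ?thesis
    by (simp only:) (intro Ck_prod Ck_mult Ck_flat, simp)
qed

lemma Ck_bumpN_0: "Ck k (bumpN :: real^'n \<Rightarrow> real)"
  using Ck_bumpN[of k 1 0] by simp

lemma continuous_bumpN: "continuous_on S (bumpN :: real^'n \<Rightarrow> real)"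
  using Ck_continuous[OF Ck_bumpN_0] continuous_on_subset by blast

text \<open>The factor \<open>y $ l - x $ l\<close> is, up to scaling, a component of the velocity
  of a homothety centred at \<open>x\<close>. These are the test functions that yield the
  representation of \<open>u x\<close> by the weak gradient.\<close>

lemma test_fun_bump:
  fixes p x :: "real^'n"
  assumes r: "r > 0" and sub: "cbox (\<chi> i. p $ i - r / 2) (\<chi> i. p $ i + r / 2) \<subseteq> \<Omega>"
  shows "test_fun \<Omega> (\<lambda>y. c * bumpN ((1 / r) *\<^sub>R (y - p)) * (y $ l - x $ l))" (is "test_fun _ ?f")
proof -
  let ?C = "cbox (\<chi> i. p $ i - r / 2) (\<chi> i. p $ i + r / 2)"
  have "{y. ?f y \<noteq> 0} \<subseteq> ?C"
  proof
    fix y assume "y \<in> {y. ?f y \<noteq> 0}"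
    then have "bumpN ((1 / r) *\<^sub>R (y - p)) \<noteq> 0" by auto
    then have "\<bar>((1 / r) *\<^sub>R (y - p)) $ i\<bar> < 1 / 2" for i by (rule bumpN_nonzeroD)
    then have "\<bar>y $ i - p $ i\<bar> < r / 2" for i
      using r by (simp add: abs_mult field_simps)
    then have "p $ i - r / 2 \<le> y $ i \<and> y $ i \<le> p $ i + r / 2" for i
      by (smt (verit))
    then show "y \<in> ?C" by (simp add: mem_box_cart)
  qed
  then have supp: "supp_cl ?f \<subseteq> ?C"
    unfolding supp_cl_def by (rule closure_minimal) (rule closed_cbox)
  have "closed (supp_cl ?f)" by (simp add: supp_cl_def)
  moreover have "bounded (supp_cl ?f)" by (rule bounded_subset[OF bounded_cbox supp])
  ultimately have "compact (supp_cl ?f)" by (simp add: compact_eq_bounded_closed)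
  moreover have "smooth_fun ?f"
    unfolding smooth_fun_def
  proof
    fix k
    have "Ck k (\<lambda>y. y $ l - x $ l)"
      using Ck_affine_coord[of k 1 l "- (x $ l)"] by simp
    from Ck_mult[OF Ck_mult[OF Ck_const Ck_bumpN] this] show "Ck k ?f" .
  qed
  moreover have "supp_cl ?f \<subseteq> \<Omega>" using supp sub by (rule order_trans)
  ultimately show ?thesis by (simp add: test_fun_def)
qed

section \<open>Averages of integrable functions over balls\<close>

lemma outer_regular_open:
  fixes \<theta> :: "'a::euclidean_space \<Rightarrow> ennreal"
  assumes [measurable]: "\<theta> \<in> borel_measurable borel" and fin: "(\<integral>\<^sup>+x. \<theta> x \<partial>lborel) < \<infinity>"
    and B: "B \<in> sets borel" and "e > 0"
  obtains V where "open V" "B \<subseteq> V" "emeasure (density lborel \<theta>) V < emeasure (density lborel \<theta>) B + ennreal e"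
proof -
  let ?M = "density lborel \<theta>"
  have fM: "emeasure ?M (space ?M) \<noteq> \<infinity>"
    using fin by (simp add: emeasure_density)
  have "emeasure ?M B \<noteq> \<infinity>"
    using fM emeasure_space[of ?M B] by (auto simp: top_unique)
  then have "(INF V \<in> {V. B \<subseteq> V \<and> open V}. emeasure ?M V) < emeasure ?M B + ennreal e"
    using outer_regular[OF _ fM B] \<open>e > 0\<close>
      ennreal_add_left_cancel_less[of "emeasure ?M B" 0 "ennreal e"] by (simp add: ennreal_zero_less_divide)
  then obtain V where "B \<subseteq> V" "open V" "emeasure ?M V < emeasure ?M B + ennreal e"
    by (auto simp: Inf_less_iff)
  then show ?thesis by (intro that)
qed

text \<open>Vitali's theorem covers almost all of \<open>A\<close> by disjoint balls inside an open
  set that carries little mass beyond the set where \<theta> is below \<alpha>. On their union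
  \<open>?D\<close> the mass is at least \<beta> times the volume but at most \<alpha> times the
  volume plus that excess, which forces the volume to be small.\<close>

lemma negligible_large_ball_average:
  fixes \<theta> :: "'a::euclidean_space \<Rightarrow> ennreal"
  assumes meas[measurable]: "\<theta> \<in> borel_measurable borel" and fin: "(\<integral>\<^sup>+x. \<theta> x \<partial>lborel) < \<infinity>"
    and \<alpha>\<beta>: "0 \<le> \<alpha>" "\<alpha> < \<beta>"
    and A: "\<And>x. x \<in> A \<Longrightarrow> \<theta> x < ennreal \<alpha>"
      "\<And>x \<delta>. x \<in> A \<Longrightarrow> 0 < \<delta> \<Longrightarrow> \<exists>r. 0 < r \<and> r < \<delta> \<and>
         ennreal \<beta> * emeasure lborel (cball x r) < emeasure (density lborel \<theta>) (cball x r)"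
  shows "negligible A"
  unfolding negligible_outer_le
proof (intro allI impI)
  fix e :: real assume "e > 0"
  let ?M = "density lborel \<theta>"
  \<comment> \<open>The excess mass divided by \<open>\<beta> - \<alpha>\<close> bounds the volume
    of the balls, and this choice makes the quotient equal to \<open>e\<close>.\<close>
  define e' where "e' = e * (\<beta> - \<alpha>)"
  have "e' > 0" using \<open>e > 0\<close> \<alpha>\<beta> by (simp add: e'_def)
  \<comment> \<open>Outer regularity is applied to this Borel superset of \<open>A\<close>, as
    \<open>A\<close> itself need not be measurable.\<close>
  let ?T = "{x. \<theta> x < ennreal \<alpha>}"
  have T[measurable]: "?T \<in> sets borel" by measurable
  obtain V where V: "open V" "?T \<subseteq> V" "emeasure ?M V < emeasure ?M ?T + ennreal e'"
    using outer_regular_open[OF meas fin T \<open>e' > 0\<close>] .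
  have fM: "emeasure ?M X < \<infinity>" for X
    using fin emeasure_space[of ?M X] by (auto simp: emeasure_density top_unique less_top[symmetric])
  have [measurable]: "V \<in> sets borel" using V by simp
  have "emeasure ?M V = emeasure ?M ?T + emeasure ?M (V - ?T)"
    using V(2) by (subst plus_emeasure) (auto simp: Un_absorb1)
  with V(3) fM[of ?T] have VT: "emeasure ?M (V - ?T) \<le> ennreal e'"
    by (metis ennreal_add_left_cancel_less less_imp_le)
  let ?K = "{(x, r). x \<in> A \<and> 0 < r \<and> cball x r \<subseteq> V \<and>
     ennreal \<beta> * emeasure lborel (cball x r) < emeasure ?M (cball x r)}"
  have K_pos: "0 < snd i" if "i \<in> ?K" for i
    using that by auto
  have cover: "\<exists>i. i \<in> ?K \<and> x \<in> cball (fst i) (snd i) \<and> snd i < d" if x: "x \<in> A" and d: "0 < d" for x d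
  proof -
    have "x \<in> V" using A(1)[OF x] V(2) by auto
    then obtain \<epsilon> where \<epsilon>: "\<epsilon> > 0" "cball x \<epsilon> \<subseteq> V" using V(1) open_contains_cball by blast
    obtain r where r: "0 < r" "r < min d \<epsilon>"
      "ennreal \<beta> * emeasure lborel (cball x r) < emeasure ?M (cball x r)"
      using A(2)[OF x, of "min d \<epsilon>"] d \<epsilon> by auto
    have "cball x r \<subseteq> V" using order_trans[OF subset_cball \<epsilon>(2)] r(2) by simp
    then show ?thesis
      using x r by (intro exI[of _ "(x, r)"]) simp
  qed
  obtain C where C: "countable C" "C \<subseteq> ?K"
    "pairwise (\<lambda>i j. disjnt (cball (fst i) (snd i)) (cball (fst j) (snd j))) C"
    "negligible (A - (\<Union>i \<in> C. cball (fst i) (snd i)))"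
    by (rule Vitali_covering_theorem_cballs[OF K_pos cover])
  let ?D = "\<Union>i \<in> C. cball (fst i) (snd i)"
  have D[measurable]: "?D \<in> sets borel" using C(1) by (intro sets.countable_UN') auto
  have disj: "disjoint_family_on (\<lambda>i. cball (fst i) (snd i)) C"
    using C(3) by (auto simp: disjoint_family_on_def pairwise_def disjnt_def)
  have "ennreal \<beta> * emeasure lborel ?D = (\<integral>\<^sup>+i. ennreal \<beta> * emeasure lborel (cball (fst i) (snd i)) \<partial>count_space C)"
    using C(1) disj by (subst emeasure_UN_countable) (auto simp: nn_integral_cmult)
  also have "\<dots> \<le> (\<integral>\<^sup>+i. emeasure ?M (cball (fst i) (snd i)) \<partial>count_space C)"
    using subsetD[OF C(2)] by (intro nn_integral_mono) (fastforce intro: less_imp_le)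
  also have "\<dots> = emeasure ?M ?D"
    using C(1) disj by (subst emeasure_UN_countable) auto
  finally have 1: "ennreal \<beta> * emeasure lborel ?D \<le> emeasure ?M ?D" .
  have "cball (fst i) (snd i) \<subseteq> V" if "i \<in> C" for i
    using subsetD[OF C(2) that] by auto
  then have "?D \<subseteq> V" by (rule UN_least)
  have "emeasure ?M ?D = emeasure ?M (?D \<inter> ?T) + emeasure ?M (?D - ?T)"
    by (subst plus_emeasure) (auto simp: Int_Diff_Un)
  also have "emeasure ?M (?D - ?T) \<le> ennreal e'"
    using \<open>?D \<subseteq> V\<close> by (intro order_trans[OF emeasure_mono VT]) auto
  also have "emeasure ?M (?D \<inter> ?T) \<le> (\<integral>\<^sup>+x. ennreal \<alpha> * indicator ?D x \<partial>lborel)"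
    by (subst emeasure_density) (auto intro!: nn_integral_mono simp: indicator_def less_imp_le)
  also have "\<dots> = ennreal \<alpha> * emeasure lborel ?D"
    by (simp add: nn_integral_cmult_indicator)
  finally have 2: "emeasure ?M ?D \<le> ennreal \<alpha> * emeasure lborel ?D + ennreal e'" by (simp add: add_mono)
  have "ennreal \<beta> * emeasure lborel ?D < \<infinity>" using 1 fM[of ?D] by (rule le_less_trans)
  then have finD: "emeasure lborel ?D < \<infinity>"
    using \<alpha>\<beta> by (auto simp: ennreal_mult_less_top)
  let ?m = "measure lborel ?D"
  have Dm: "emeasure lborel ?D = ennreal ?m"
    using finD by (simp add: emeasure_eq_ennreal_measure)
  have "ennreal (\<beta> * ?m) \<le> ennreal (\<alpha> * ?m + e')"
    using order_trans[OF 1 2] \<alpha>\<beta> \<open>e' > 0\<close> unfolding Dm by (simp add: ennreal_mult ennreal_plus)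
  then have "\<beta> * ?m \<le> \<alpha> * ?m + e'"
    using \<alpha>\<beta> \<open>e' > 0\<close> by (subst (asm) ennreal_le_iff) auto
  then have "?m * (\<beta> - \<alpha>) \<le> e * (\<beta> - \<alpha>)" by (simp add: e'_def algebra_simps)
  then have m: "?m \<le> e" using \<alpha>\<beta> by simp
  have Dl: "?D \<in> lmeasurable"
    using finD by (auto simp: fmeasurable_def)
  then have "?D \<union> (A - ?D) \<in> lmeasurable"
    by (rule fmeasurable.Un[OF _ negligible_imp_measurable[OF C(4)]])
  moreover have "measure lebesgue (?D \<union> (A - ?D)) \<le> measure lebesgue ?D"
    using measure_Un_le[of ?D lebesgue "A - ?D"] C(4) fmeasurableD[OF Dl]
      fmeasurableD[OF negligible_imp_measurable[OF C(4)]] negligible_imp_measure0[OF C(4)] by simp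
  moreover have "measure lebesgue ?D = ?m" by simp
  ultimately show "\<exists>T. A \<subseteq> T \<and> T \<in> lmeasurable \<and> measure lebesgue T \<le> e"
    using m by (intro exI[of _ "?D \<union> (A - ?D)"]) auto
qed

text \<open>Only this upper half of the differentiation theorem is used later. A failure at \<beta>
  is detected by two rationals between \<open>\<theta> x\<close> and \<beta>, so countably many
  negligible sets suffice.\<close>

theorem AE_eventually_ball_average_le:
  fixes \<theta> :: "'a::euclidean_space \<Rightarrow> ennreal"
  assumes [measurable]: "\<theta> \<in> borel_measurable borel" and fin: "(\<integral>\<^sup>+x. \<theta> x \<partial>lborel) < \<infinity>"
  shows "AE x in lebesgue. \<forall>\<beta>. \<theta> x < ennreal \<beta> \<longrightarrow>
    (\<exists>\<delta>>0. \<forall>r. 0 < r \<and> r < \<delta> \<longrightarrow>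
       emeasure (density lborel \<theta>) (cball x r) \<le> ennreal \<beta> * emeasure lborel (cball x r))"
proof -
  let ?M = "density lborel \<theta>"
  define A where "A \<alpha> \<beta> = {x. \<theta> x < ennreal \<alpha> \<and> (\<forall>\<delta>>0. \<exists>r. 0 < r \<and> r < \<delta> \<and>
         ennreal \<beta> * emeasure lborel (cball x r) < emeasure ?M (cball x r))}" for \<alpha> \<beta> :: real
  let ?I = "{(\<alpha>, \<beta>). \<alpha> \<in> \<rat> \<and> \<beta> \<in> \<rat> \<and> 0 \<le> \<alpha> \<and> \<alpha> < (\<beta>::real)}"
  have "negligible (A \<alpha> \<beta>)" if "(\<alpha>, \<beta>) \<in> ?I" for \<alpha> \<beta>
  proof (rule negligible_large_ball_average[OF assms, of \<alpha> \<beta>])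
    show "0 \<le> \<alpha>" "\<alpha> < \<beta>" using that by auto
    show "\<theta> x < ennreal \<alpha>" if "x \<in> A \<alpha> \<beta>" for x
      using that by (simp add: A_def)
    show "\<exists>r. 0 < r \<and> r < \<delta> \<and> ennreal \<beta> * emeasure lborel (cball x r) < emeasure ?M (cball x r)"
      if "x \<in> A \<alpha> \<beta>" "0 < \<delta>" for x \<delta>
      using that by (simp add: A_def)
  qed
  moreover have "countable ?I"
    by (rule countable_subset[of _ "\<rat> \<times> \<rat>"]) (auto simp: countable_rat)
  ultimately have neg: "negligible (\<Union>i\<in>?I. A (fst i) (snd i))"
    by (intro negligible_countable_Union) auto
  show ?thesis
  proof (rule AE_I')
    show "(\<Union>i\<in>?I. A (fst i) (snd i)) \<in> null_sets lebesgue"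
      using neg by (simp add: negligible_iff_null_sets)
    show "{x \<in> space lebesgue. \<not> (\<forall>\<beta>. \<theta> x < ennreal \<beta> \<longrightarrow>
      (\<exists>\<delta>>0. \<forall>r. 0 < r \<and> r < \<delta> \<longrightarrow>
       emeasure ?M (cball x r) \<le> ennreal \<beta> * emeasure lborel (cball x r)))}
      \<subseteq> (\<Union>i\<in>?I. A (fst i) (snd i))"
    proof
      fix x assume "x \<in> {x \<in> space lebesgue. \<not> (\<forall>\<beta>. \<theta> x < ennreal \<beta> \<longrightarrow>
      (\<exists>\<delta>>0. \<forall>r. 0 < r \<and> r < \<delta> \<longrightarrow>
       emeasure ?M (cball x r) \<le> ennreal \<beta> * emeasure lborel (cball x r)))}"
      then obtain \<beta> where lt: "\<theta> x < ennreal \<beta>"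
        and neg: "\<not> (\<exists>\<delta>>0. \<forall>r. 0 < r \<and> r < \<delta> \<longrightarrow> emeasure ?M (cball x r) \<le> ennreal \<beta> * emeasure lborel (cball x r))"
        by auto
      obtain c where c: "\<theta> x = ennreal c" "0 \<le> c" "c < \<beta>"
        using lt by (cases "\<theta> x") (auto simp: ennreal_less_iff)
      obtain \<alpha> where a: "\<alpha> \<in> \<rat>" "c < \<alpha>" "\<alpha> < \<beta>" using Rats_dense_in_real[OF c(3)] by blast
      obtain b where b: "b \<in> \<rat>" "\<alpha> < b" "b < \<beta>" using Rats_dense_in_real[OF a(3)] by blast
      have "x \<in> A \<alpha> b"
        unfolding A_def
      proof (intro CollectI conjI allI impI)
        show "\<theta> x < ennreal \<alpha>" using c a by (simp add: ennreal_lessI)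
        fix \<delta> :: real assume "\<delta> > 0"
        then obtain r where r: "0 < r" "r < \<delta>" "ennreal \<beta> * emeasure lborel (cball x r) < emeasure ?M (cball x r)"
          using neg by (auto simp: not_le)
        have "ennreal b * emeasure lborel (cball x r) \<le> ennreal \<beta> * emeasure lborel (cball x r)"
          using b by (intro mult_right_mono ennreal_leI) auto
        then show "\<exists>r. 0 < r \<and> r < \<delta> \<and> ennreal b * emeasure lborel (cball x r) < emeasure ?M (cball x r)"
          using r le_less_trans[OF _ r(3)] by (intro exI[of _ r]) simp
      qed
      then show "x \<in> (\<Union>i\<in>?I. A (fst i) (snd i))"
        using a b c by (intro UN_I[of "(\<alpha>, b)"]) auto
    qed
  qed
qed

section \<open>Oscillation of functions with a weak gradient\<close>

text \<open>Links the gauge integral over a cube, where differentiation under the integral sign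
  takes place, with the integral over the whole space in the weak formulation.\<close>

lemma lborel_cont_integral:
  fixes F :: "'a::euclidean_space \<Rightarrow> real"
  assumes F: "continuous_on UNIV F" and supp: "\<And>y. y \<notin> cbox a b \<Longrightarrow> F y = 0"
  shows "integrable lborel F" "integral (cbox a b) F = integral\<^sup>L lborel F"
proof -
  have "integrable lborel (\<lambda>x. indicator (cbox a b) x *\<^sub>R F x)"
    using F by (intro borel_integrable_compact compact_cbox) (rule continuous_on_subset, auto)
  moreover have "(\<lambda>x. indicator (cbox a b) x *\<^sub>R F x) = F"
    using supp by (auto simp: indicator_def fun_eq_iff)
  ultimately show int: "integrable lborel F" by simp
  have "integral (cbox a b) F = integral UNIV (\<lambda>x. if x \<in> cbox a b then F x else 0)"
    by (rule integral_restrict_UNIV[symmetric])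
  also have "(\<lambda>x. if x \<in> cbox a b then F x else 0) = F"
    using supp by auto
  also have "integral UNIV F = integral\<^sup>L lborel F"
    by (rule integral_lborel[OF int])
  finally show "integral (cbox a b) F = integral\<^sup>L lborel F" .
qed

lemma nn_integral_affine_bump:
  fixes h :: "real^'n \<Rightarrow> ennreal"
  assumes [measurable]: "h \<in> borel_measurable borel" and r: "r > 0"
  shows "(\<integral>\<^sup>+z. h (p + r *\<^sub>R z) * ennreal (bumpN z) \<partial>lborel) =
    (\<integral>\<^sup>+y. h y * ennreal (bumpN ((1 / r) *\<^sub>R (y - p)) / r ^ CARD('n)) \<partial>lborel)"
proof -
  have [measurable]: "(bumpN :: real^'n \<Rightarrow> real) \<in> borel_measurable borel"
    by (intro borel_measurable_continuous_onI continuous_bumpN)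
  have "(\<integral>\<^sup>+y. h y * ennreal (bumpN ((1 / r) *\<^sub>R (y - p)) / r ^ CARD('n)) \<partial>lborel)
     = (\<integral>\<^sup>+y. h y * ennreal (bumpN ((1 / r) *\<^sub>R (y - p)) / r ^ CARD('n))
         \<partial>density (distr lborel borel (\<lambda>z. p + r *\<^sub>R z)) (\<lambda>_. ennreal (\<bar>r\<bar> ^ DIM(real^'n))))"
    using r lborel_affine[of r p] by simp
  also have "\<dots> = (\<integral>\<^sup>+z. ennreal (r ^ CARD('n)) * (h (p + r *\<^sub>R z) * ennreal (bumpN z / r ^ CARD('n))) \<partial>lborel)"
    using r by (simp add: nn_integral_density nn_integral_distr)
  also have "\<dots> = (\<integral>\<^sup>+z. h (p + r *\<^sub>R z) * ennreal (bumpN z) \<partial>lborel)"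
  proof (intro nn_integral_cong)
    fix z :: "real^'n"
    have "ennreal (r ^ CARD('n)) * ennreal (bumpN z / r ^ CARD('n)) = ennreal (bumpN z)"
      using r by (subst ennreal_mult[symmetric]) (auto simp: bumpN_nonneg)
    then show "ennreal (r ^ CARD('n)) * (h (p + r *\<^sub>R z) * ennreal (bumpN z / r ^ CARD('n))) =
        h (p + r *\<^sub>R z) * ennreal (bumpN z)"
      by (metis mult.left_commute)
  qed
  finally show ?thesis by simp
qed

lemma integral_affine_bump:
  fixes h :: "real^'n \<Rightarrow> real"
  assumes [measurable]: "h \<in> borel_measurable borel" and r: "r > 0"
  shows "(\<integral>z. h (p + r *\<^sub>R z) * bumpN z \<partial>lborel) =
    (\<integral>y. h y * (bumpN ((1 / r) *\<^sub>R (y - p)) / r ^ CARD('n)) \<partial>lborel)"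
proof -
  have [measurable]: "(bumpN :: real^'n \<Rightarrow> real) \<in> borel_measurable borel"
    by (intro borel_measurable_continuous_onI continuous_bumpN)
  have "(\<integral>y. h y * (bumpN ((1 / r) *\<^sub>R (y - p)) / r ^ CARD('n)) \<partial>lborel)
     = (\<integral>y. h y * (bumpN ((1 / r) *\<^sub>R (y - p)) / r ^ CARD('n))
         \<partial>density (distr lborel borel (\<lambda>z. p + r *\<^sub>R z)) (\<lambda>_. ennreal (\<bar>r\<bar> ^ DIM(real^'n))))"
    using r lborel_affine[of r p] by simp
  also have "\<dots> = (\<integral>z. (r ^ CARD('n)) * (h (p + r *\<^sub>R z) * (bumpN z / r ^ CARD('n))) \<partial>lborel)"
    using r by (subst integral_density) (auto simp: integral_distr)
  also have "\<dots> = (\<integral>z. h (p + r *\<^sub>R z) * bumpN z \<partial>lborel)"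
    using r by (intro Bochner_Integration.integral_cong) auto
  finally show ?thesis by simp
qed

definition bump_mass :: "'n::finite itself \<Rightarrow> real" where
  "bump_mass _ = integral\<^sup>L lborel (bumpN :: real^'n \<Rightarrow> real)"

definition dbump :: "'n \<Rightarrow> real^'n \<Rightarrow> real" where
  "dbump l z = frechet_derivative bumpN (at z) (axis l 1)"

lemma bumpN_outside: "z \<notin> cbox (\<chi> i. - 1 / 2) (\<chi> i. 1 / 2) \<Longrightarrow> bumpN z = 0"
proof (rule ccontr)
  assume z: "z \<notin> cbox (\<chi> i. - 1 / 2) (\<chi> i. 1 / 2)" and "bumpN z \<noteq> 0"
  then have "\<bar>z $ i\<bar> < 1 / 2" for i by (intro bumpN_nonzeroD)
  then have "- 1 / 2 \<le> z $ i \<and> z $ i \<le> 1 / 2" for i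
    by (smt (verit) field_sum_of_halves)
  then show False using z by (simp add: mem_box_cart)
qed

lemma integrable_bumpN_mult:
  fixes f :: "real^'n \<Rightarrow> real"
  assumes "continuous_on UNIV f"
  shows "integrable lborel (\<lambda>z. f z * bumpN z)"
  by (rule lborel_cont_integral(1)[where a = "\<chi> i. - 1 / 2" and b = "\<chi> i. 1 / 2"])
    (auto intro!: continuous_intros continuous_bumpN assms simp: bumpN_outside)

lemma integrable_bumpN: "integrable lborel (bumpN :: real^'n \<Rightarrow> real)"
  using integrable_bumpN_mult[of "\<lambda>_. 1"] by simp

lemma bump_mass_pos: "bump_mass TYPE('n::finite) > 0"
proof -
  have "bumpN (0 :: real^'n) > 0"
    using bump1_pos[of 0] by (simp add: bumpN_def prod_pos)
  have "integral\<^sup>L lborel (bumpN :: real^'n \<Rightarrow> real) \<noteq> 0"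
  proof
    assume "integral\<^sup>L lborel (bumpN :: real^'n \<Rightarrow> real) = 0"
    then have "AE z in lborel. bumpN (z :: real^'n) = 0"
      by (subst (asm) integral_nonneg_eq_0_iff_AE) (auto simp: integrable_bumpN bumpN_nonneg)
    then have neg: "{z :: real^'n. bumpN z \<noteq> 0} \<in> null_sets lborel"
      using AE_iff_null[of lborel "\<lambda>z :: real^'n. bumpN z = 0"]
      by (simp add: open_Collect_neq continuous_bumpN borel_open)
    moreover have "open {z :: real^'n. bumpN z \<noteq> 0}"
      by (intro open_Collect_neq continuous_bumpN continuous_intros)
    ultimately have "{z :: real^'n. bumpN z \<noteq> 0} = {}"
      using open_not_negligible[of "{z :: real^'n. bumpN z \<noteq> 0}"]
      by (auto simp: negligible_iff_null_sets null_sets_completionI)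
    then show False using \<open>bumpN (0 :: real^'n) > 0\<close> by auto
  qed
  moreover have "integral\<^sup>L lborel (bumpN :: real^'n \<Rightarrow> real) \<ge> 0"
    by (intro Bochner_Integration.integral_nonneg bumpN_nonneg)
  ultimately show ?thesis unfolding bump_mass_def by linarith
qed

lemma bumpN_has_derivative:
  fixes z :: "real^'n"
  shows "(bumpN has_derivative (\<lambda>v. \<Sum>l\<in>UNIV. v $ l * dbump l z)) (at z)"
proof -
  let ?D = "frechet_derivative bumpN (at z)"
  have D: "(bumpN has_derivative ?D) (at z)"
    by (rule CkD(1)[OF Ck_bumpN_0[of "Suc 0"]])
  then interpret D: bounded_linear ?D by (rule has_derivative_bounded_linear)
  have "?D v = (\<Sum>l\<in>UNIV. v $ l * dbump l z)" for v
  proof -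
    have "?D v = ?D (\<Sum>l\<in>UNIV. (v $ l) *\<^sub>R axis l 1)"
      using basis_expansion[of v] by (simp add: scalar_mult_eq_scaleR)
    also have "\<dots> = (\<Sum>l\<in>UNIV. v $ l * dbump l z)"
      by (simp add: D.sum D.scaleR dbump_def)
    finally show ?thesis .
  qed
  then have "?D = (\<lambda>v. \<Sum>l\<in>UNIV. v $ l * dbump l z)" by auto
  then show ?thesis using D by simp
qed

lemma continuous_dbump: "continuous_on S (dbump l)"
  using Ck_continuous[OF CkD(2)[OF Ck_bumpN_0[of "Suc 0"], of "axis l 1"]] continuous_on_subset
  unfolding dbump_def by blast

text \<open>A zero of the nonnegative function \<open>bumpN\<close> is a minimum, so its gradient
  vanishes there.\<close>

lemma dbump_zero:
  fixes z :: "real^'n"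
  assumes "bumpN z = 0"
  shows "dbump l z = 0"
proof -
  have "(\<lambda>v. \<Sum>l\<in>UNIV. v $ l * dbump l z) = (\<lambda>v. 0)"
    by (rule differential_zero_maxmin[OF _ _ bumpN_has_derivative, where S = UNIV])
      (auto simp: assms bumpN_nonneg)
  then have "(\<Sum>k\<in>UNIV. axis l 1 $ k * dbump k z) = 0" by meson
  then show ?thesis by (simp add: axis_def if_distrib[of "\<lambda>x. x * _"] cong: if_cong)
qed

section \<open>Bumps contracted by a homothety, and the representation formula\<close>

text \<open>The bump of width \<open>r\<close> around \<open>c\<close>, shrunk to the point \<open>x\<close> by the homothety of ratio \<open>s\<close>.\<close>

definition hbump :: "real^'n \<Rightarrow> real^'n \<Rightarrow> real \<Rightarrow> real \<Rightarrow> real^'n \<Rightarrow> real" where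
  "hbump x c r s y = bumpN ((1 / (s * r)) *\<^sub>R (y - (x + s *\<^sub>R (c - x)))) / (s * r) ^ CARD('n)"

definition hcube :: "real^'n \<Rightarrow> real \<Rightarrow> (real^'n) set" where
  "hcube c r = cbox (\<chi> i. c $ i - r) (\<chi> i. c $ i + r)"

lemma mem_hcube: "y \<in> hcube c r \<longleftrightarrow> (\<forall>i. \<bar>y $ i - c $ i\<bar> \<le> r)"
  unfolding hcube_def mem_box_cart by (auto simp: abs_le_iff algebra_simps)

text \<open>Convexity of the cube: contracting the smaller cube around \<open>c\<close> towards a
  point \<open>x\<close> of the large one never leaves the large one.\<close>

lemma hcube_homothety:
  assumes x: "x \<in> hcube c r" and s: "0 < s" "s \<le> 1" and r: "r > 0"
  shows "cbox (\<chi> i. (x + s *\<^sub>R (c - x)) $ i - s * r / 2) (\<chi> i. (x + s *\<^sub>R (c - x)) $ i + s * r / 2) \<subseteq> hcube c r"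
proof
  fix y assume "y \<in> cbox (\<chi> i. (x + s *\<^sub>R (c - x)) $ i - s * r / 2) (\<chi> i. (x + s *\<^sub>R (c - x)) $ i + s * r / 2)"
  then have y: "\<bar>y $ i - (x $ i + s * (c $ i - x $ i))\<bar> \<le> s * r / 2" for i
  proof -
    have "x $ i + s * (c $ i - x $ i) - s * r / 2 \<le> y $ i \<and> y $ i \<le> x $ i + s * (c $ i - x $ i) + s * r / 2"
      using \<open>y \<in> _\<close> by (simp add: mem_box_cart)
    then show ?thesis unfolding abs_le_iff by linarith
  qed
  show "y \<in> hcube c r"
    unfolding mem_hcube
  proof
    fix i
    have "y $ i - c $ i = (y $ i - (x $ i + s * (c $ i - x $ i))) + (1 - s) * (x $ i - c $ i)"
      by (simp add: algebra_simps)
    also have "\<bar>\<dots>\<bar> \<le> s * r / 2 + (1 - s) * r"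
      using x s y[of i] unfolding mem_hcube
      by (intro order_trans[OF abs_triangle_ineq] add_mono) (auto simp: abs_mult intro: mult_left_mono)
    also have "\<dots> \<le> r" using s r by (simp add: algebra_simps)
    finally show "\<bar>y $ i - c $ i\<bar> \<le> r" .
  qed
qed

lemma hbump_arg:
  fixes x y c :: "real^'n"
  assumes "s > 0" "r > 0"
  shows "(1 / (s * r)) *\<^sub>R (y - (x + s *\<^sub>R (c - x))) = (1 / (s * r)) *\<^sub>R (y - x) - (1 / r) *\<^sub>R (c - x)"
  using assms by (simp add: vec_eq_iff field_simps)

lemma hbump_nonzeroD:
  assumes "hbump x c r s y \<noteq> 0" and s: "s > 0" and r: "r > 0"
  shows "y \<in> cbox (\<chi> i. (x + s *\<^sub>R (c - x)) $ i - s * r / 2) (\<chi> i. (x + s *\<^sub>R (c - x)) $ i + s * r / 2)"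
proof -
  have "\<bar>((1 / (s * r)) *\<^sub>R (y - (x + s *\<^sub>R (c - x)))) $ i\<bar> < 1 / 2" for i
    by (rule bumpN_nonzeroD) (use assms in \<open>auto simp: hbump_def\<close>)
  then have "\<bar>(y - (x + s *\<^sub>R (c - x))) $ i / (s * r)\<bar> < 1 / 2" for i
    by simp
  then have d: "\<bar>(y - (x + s *\<^sub>R (c - x))) $ i\<bar> < 1 / 2 * (s * r)" for i
    using s r unfolding abs_divide by (subst pos_divide_less_eq[symmetric]) auto
  then have "(x + s *\<^sub>R (c - x)) $ i - s * r / 2 \<le> y $ i \<and> y $ i \<le> (x + s *\<^sub>R (c - x)) $ i + s * r / 2" for i
    using d[of i] unfolding vector_minus_component[of y] abs_less_iff by linarith
  then show ?thesis by (simp add: mem_box_cart)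
qed

text \<open>This is the partial derivative, in the coordinate \<open>l\<close> of \<open>y\<close>,
  of \<open>hbump x c r s y * (y $ l - x $ l) / s\<close>, that is, one term of the divergence of
  the bump times the velocity of the homothety.\<close>

definition hbump_d :: "real^'n \<Rightarrow> real^'n \<Rightarrow> real \<Rightarrow> real \<Rightarrow> real^'n \<Rightarrow> 'n \<Rightarrow> real" where
  "hbump_d x c r s y l = (let w = (1 / (s * r)) *\<^sub>R (y - (x + s *\<^sub>R (c - x))) in
     (bumpN w + (y $ l - x $ l) * dbump l w / (s * r)) / (s * (s * r) ^ CARD('n)))"

lemma hbump_outside:
  assumes x: "x \<in> hcube c r" and s: "0 < s" "s \<le> 1" and r: "r > 0" and y: "y \<notin> hcube c r"
  shows "hbump x c r s y = 0" and "hbump_d x c r s y l = 0"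
proof -
  show *: "hbump x c r s y = 0"
    using hbump_nonzeroD[of x c r s y] hcube_homothety[OF x s r] s r y by blast
  then have "bumpN ((1 / (s * r)) *\<^sub>R (y - (x + s *\<^sub>R (c - x)))) = 0"
    using s r by (simp add: hbump_def)
  then show "hbump_d x c r s y l = 0"
    by (simp add: hbump_d_def dbump_zero)
qed

text \<open>The continuity equation: as \<open>s\<close> varies, the mass of the bump is transported
  by the velocity field \<open>(y - x) / s\<close>, so the derivative in \<open>s\<close> is minus a
  divergence. The weak formulation can then move the derivatives onto \<open>u\<close>.\<close>

lemma hbump_has_derivative:
  fixes x c y :: "real^'n"
  assumes s: "s > 0" and r: "r > 0"
  shows "((\<lambda>s. hbump x c r s y) has_real_derivative - (\<Sum>l\<in>UNIV. hbump_d x c r s y l)) (at s)"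
proof -
  let ?n = "CARD('n)"
  \<comment> \<open>In this form of the argument \<open>s\<close> enters only through the scalar
    \<open>1 / (s * r)\<close>.\<close>
  let ?W = "\<lambda>s. (1 / (s * r)) *\<^sub>R (y - x) - (1 / r) *\<^sub>R (c - x)"
  let ?w = "(1 / (s * r)) *\<^sub>R (y - (x + s *\<^sub>R (c - x)))"
  have w: "?W s = ?w" by (rule hbump_arg[OF s r, symmetric])
  define d where "d = (\<Sum>l\<in>UNIV. (y $ l - x $ l) * dbump l ?w)"
  define a where "a = - 1 / (s * s * r)"
  have "((\<lambda>s. 1 / (s * r)) has_real_derivative a) (at s)"
    unfolding a_def using s r by (auto intro!: derivative_eq_intros simp: field_simps power2_eq_square)
  then have "((\<lambda>s. 1 / (s * r)) has_derivative (*) a) (at s)"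
    unfolding has_field_derivative_def .
  from has_derivative_diff[OF has_derivative_scaleR_left[OF this] has_derivative_const]
  have W: "(?W has_derivative (\<lambda>h. (a * h) *\<^sub>R (y - x))) (at s)"
    by simp
  have "((\<lambda>s. bumpN (?W s)) has_derivative
      (\<lambda>h. \<Sum>l\<in>UNIV. ((a * h) *\<^sub>R (y - x)) $ l * dbump l (?W s))) (at s)"
    by (rule has_derivative_compose[OF W bumpN_has_derivative])
  moreover have "(\<lambda>h. \<Sum>l\<in>UNIV. ((a * h) *\<^sub>R (y - x)) $ l * dbump l (?W s)) = (*) (a * d)"
    unfolding w d_def by (auto simp: sum_distrib_left sum_distrib_right mult_ac fun_eq_iff intro!: sum.cong)
  ultimately have num: "((\<lambda>s. bumpN (?W s)) has_real_derivative a * d) (at s)"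
    by (simp add: has_field_derivative_def)
  have "((\<lambda>s. (s * r) ^ ?n) has_real_derivative ?n * (s * r) ^ (?n - 1) * r) (at s)"
    by (auto intro!: derivative_eq_intros)
  moreover have "?n * (s * r) ^ (?n - 1) * r = ?n * (s * r) ^ ?n / s"
    using s power_Suc[of "s * r" "?n - 1"] by (simp add: field_simps)
  ultimately have den: "((\<lambda>s. (s * r) ^ ?n) has_real_derivative ?n * (s * r) ^ ?n / s) (at s)"
    by simp
  have nz: "(s * r) ^ ?n \<noteq> 0" using s r by simp
  have quot: "((\<lambda>s. bumpN (?W s) / (s * r) ^ ?n) has_real_derivative
      ((a * d) * (s * r) ^ ?n - bumpN (?W s) * (?n * (s * r) ^ ?n / s)) / ((s * r) ^ ?n * (s * r) ^ ?n)) (at s)"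
    by (rule DERIV_divide[OF num den nz])
  have alg: "((a * d) * P - b * (k * P / s)) / (P * P) = - ((k * b + d / (s * r)) / (s * P))"
    if "P \<noteq> 0" for P b k :: real
    using that s r unfolding a_def by (simp add: field_simps)
  have "(\<Sum>l\<in>UNIV. hbump_d x c r s y l) = (?n * bumpN ?w + d / (s * r)) / (s * (s * r) ^ ?n)"
    unfolding hbump_d_def Let_def by (simp add: d_def sum.distrib flip: sum_divide_distrib)
  then have eq: "((a * d) * (s * r) ^ ?n - bumpN (?W s) * (?n * (s * r) ^ ?n / s)) / ((s * r) ^ ?n * (s * r) ^ ?n)
      = - (\<Sum>l\<in>UNIV. hbump_d x c r s y l)"
    unfolding w by (simp only: alg[OF nz])
  have ev: "eventually (\<lambda>s. s \<in> {0<..}) (nhds s)"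
    using s by (intro eventually_nhds_in_open) auto
  have "eventually (\<lambda>s. bumpN (?W s) / (s * r) ^ ?n = hbump x c r s y) (nhds s)"
    using ev by (rule eventually_mono) (simp add: hbump_def hbump_arg[OF _ r])
  then show ?thesis
    using quot unfolding eq by (simp add: DERIV_cong_ev[OF refl _ refl])
qed

lemma test_hbump_derivative:
  fixes x c y :: "real^'n"
  assumes s: "s > 0" and r: "r > 0"
  shows "frechet_derivative (\<lambda>y. (1 / (s * (s * r) ^ CARD('n))) *
      bumpN ((1 / (s * r)) *\<^sub>R (y - (x + s *\<^sub>R (c - x)))) * (y $ l - x $ l)) (at y) (axis l 1) = hbump_d x c r s y l"
proof -
  let ?w = "\<lambda>y. (1 / (s * r)) *\<^sub>R (y - (x + s *\<^sub>R (c - x)))"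
  let ?a = "1 / (s * (s * r) ^ CARD('n))"
  have w: "(?w has_derivative (\<lambda>v. (1 / (s * r)) *\<^sub>R v)) (at y)"
    by (auto intro!: derivative_eq_intros)
  have b: "((\<lambda>y. bumpN (?w y)) has_derivative (\<lambda>v. \<Sum>k\<in>UNIV. ((1 / (s * r)) *\<^sub>R v) $ k * dbump k (?w y))) (at y)"
    by (rule has_derivative_compose[OF w bumpN_has_derivative])
  have l: "((\<lambda>y. y $ l - x $ l) has_derivative (\<lambda>v. v $ l)) (at y)"
    by (auto intro!: derivative_eq_intros bounded_linear_imp_has_derivative bounded_linear_vec_nth)
  have "((\<lambda>y. ?a * bumpN (?w y) * (y $ l - x $ l)) has_derivative
      (\<lambda>v. ?a * bumpN (?w y) * v $ l +
        ?a * (\<Sum>k\<in>UNIV. ((1 / (s * r)) *\<^sub>R v) $ k * dbump k (?w y)) * (y $ l - x $ l))) (at y)"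
    by (rule has_derivative_mult[OF has_derivative_mult_right[OF b] l])
  then have deriv: "frechet_derivative (\<lambda>y. ?a * bumpN (?w y) * (y $ l - x $ l)) (at y) =
      (\<lambda>v. ?a * bumpN (?w y) * v $ l +
        ?a * (\<Sum>k\<in>UNIV. ((1 / (s * r)) *\<^sub>R v) $ k * dbump k (?w y)) * (y $ l - x $ l))"
    by (rule frechet_derivative_at[symmetric])
  have coord: "(\<Sum>k\<in>UNIV. ((1 / (s * r)) *\<^sub>R axis l 1) $ k * dbump k (?w y)) = dbump l (?w y) / (s * r)"
    by (simp add: axis_def if_distrib[of "\<lambda>x. x * _"] if_distrib[of "\<lambda>x. x / _"] cong: if_cong)
  show ?thesis
  proof -
    have alg: "(1 / K) * b * 1 + (1 / K) * (d / q) * m = (b + m * d / q) / K" for K b d q m :: real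
      by (simp add: add_divide_distrib mult.commute)
    have "frechet_derivative (\<lambda>y. ?a * bumpN (?w y) * (y $ l - x $ l)) (at y) (axis l 1) =
        ?a * bumpN (?w y) * 1 + ?a * (dbump l (?w y) / (s * r)) * (y $ l - x $ l)"
      unfolding deriv coord by (simp only: axis_nth)
    then show ?thesis
      unfolding alg hbump_d_def Let_def .
  qed
qed

text \<open>Joint continuity holds only away from \<open>s = 0\<close>, where the bump concentrates;
  this is why the fundamental theorem is first applied on an interval starting at a positive
  \<open>e\<close>.\<close>

lemma continuous_hbump:
  fixes x c :: "real^'n"
  assumes r: "r > 0" and e: "e > 0"
  shows "continuous_on ({e..} \<times> UNIV) (\<lambda>(s, y). hbump x c r s y)"
    and "continuous_on ({e..} \<times> UNIV) (\<lambda>(s, y). hbump_d x c r s y l)"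
proof -
  let ?A = "{e..} \<times> (UNIV :: (real^'n) set)"
  let ?W = "\<lambda>p. (1 / (fst p * r)) *\<^sub>R (snd p - (x + fst p *\<^sub>R (c - x)))"
  have nz: "\<forall>p\<in>?A. fst p * r \<noteq> 0" "\<forall>p\<in>?A. (fst p * r) ^ CARD('n) \<noteq> 0"
    "\<forall>p\<in>?A. fst p * (fst p * r) ^ CARD('n) \<noteq> 0"
    using e r by auto
  have w: "continuous_on ?A ?W"
    by (intro continuous_on_scaleR continuous_on_divide nz continuous_intros)
  have cb: "continuous_on ?A (\<lambda>p. bumpN (?W p))"
    by (rule continuous_on_compose2[OF continuous_bumpN[of UNIV] w]) simp
  have cd: "continuous_on ?A (\<lambda>p. dbump l (?W p))"
    by (rule continuous_on_compose2[OF continuous_dbump[of UNIV] w]) simp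
  have "continuous_on ?A (\<lambda>p. hbump x c r (fst p) (snd p))"
    unfolding hbump_def by (intro continuous_on_divide cb nz continuous_intros)
  then show "continuous_on ?A (\<lambda>(s, y). hbump x c r s y)"
    unfolding case_prod_unfold .
  have "continuous_on ?A (\<lambda>p. hbump_d x c r (fst p) (snd p) l)"
    unfolding hbump_d_def Let_def by (intro continuous_on_divide continuous_on_add continuous_on_mult cb cd nz continuous_intros)
  then show "continuous_on ?A (\<lambda>(s, y). hbump_d x c r s y l)"
    unfolding case_prod_unfold .
qed

lemma continuous_hbump_y:
  fixes x c :: "real^'n"
  assumes r: "r > 0" and s: "s > 0"
  shows "continuous_on A (hbump x c r s)" and "continuous_on A (\<lambda>y. hbump_d x c r s y l)"
proof -
  have p: "continuous_on A (\<lambda>y. (s, y))" by (intro continuous_intros)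
  show "continuous_on A (hbump x c r s)"
    using continuous_on_compose2[OF continuous_hbump(1)[OF r s, of x c] p] by auto
  show "continuous_on A (\<lambda>y. hbump_d x c r s y l)"
    using continuous_on_compose2[OF continuous_hbump(2)[OF r s, of x c l] p] by auto
qed

text \<open>The derivatives are Borel representatives and the integrals are taken with respect to
  \<open>lborel\<close>, so that compositions with affine maps and Fubini's theorem need no care
  about completions.\<close>

locale weak_gradient =
  fixes u :: "real^'n \<Rightarrow> real" and g :: "'n \<Rightarrow> real^'n \<Rightarrow> real" and \<Omega> :: "(real^'n) set"
  assumes u_cont: "continuous_on UNIV u"
    and g_meas [measurable]: "\<And>l. g l \<in> borel_measurable borel"
    and g_int: "\<And>l K. compact K \<Longrightarrow> K \<subseteq> \<Omega> \<Longrightarrow> integrable lborel (\<lambda>y. indicator K y * g l y)"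
    and weak: "\<And>l \<phi>. test_fun \<Omega> \<phi> \<Longrightarrow>
      (\<integral>y. u y * frechet_derivative \<phi> (at y) (axis l 1) \<partial>lborel) = - (\<integral>y. g l y * \<phi> y \<partial>lborel)"

lemma bumpN_measurable [measurable]: "(bumpN :: real^'n \<Rightarrow> real) \<in> borel_measurable borel"
  by (intro borel_measurable_continuous_onI continuous_bumpN)

text \<open>The test function is the bump times a velocity component, followed by the substitution
  that undoes the homothety. Integrability is recorded separately because subtracting the constant
  \<open>b $ l\<close> from the gradient requires it.\<close>

lemma (in weak_gradient) weak_hbump:
  assumes x: "x \<in> hcube c r" and s: "0 < s" "s \<le> 1" and r: "r > 0" and \<Omega>: "hcube c r \<subseteq> \<Omega>"
  shows "(\<integral>y. u y * hbump_d x c r s y l \<partial>lborel) =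
      - (\<integral>z. g l (x + s *\<^sub>R (c - x + r *\<^sub>R z)) * (c - x + r *\<^sub>R z) $ l * bumpN z \<partial>lborel)"
    and "integrable lborel (\<lambda>z. g l (x + s *\<^sub>R (c - x + r *\<^sub>R z)) * (c - x + r *\<^sub>R z) $ l * bumpN z)"
proof -
  let ?p = "x + s *\<^sub>R (c - x)"
  let ?\<phi> = "\<lambda>y. (1 / (s * (s * r) ^ CARD('n))) * bumpN ((1 / (s * r)) *\<^sub>R (y - ?p)) * (y $ l - x $ l)"
  let ?h = "\<lambda>y. g l y * ((y $ l - x $ l) / s)"
  have sr: "s * r > 0" using s r by simp
  have "test_fun \<Omega> ?\<phi>"
    by (rule test_fun_bump[OF sr]) (use hcube_homothety[OF x s r] \<Omega> in blast)
  from weak[OF this, of l]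
  have 1: "(\<integral>y. u y * hbump_d x c r s y l \<partial>lborel) = - (\<integral>y. g l y * ?\<phi> y \<partial>lborel)"
    by (simp only: test_hbump_derivative[OF s(1) r])
  have eq: "g l y * ?\<phi> y = ?h y * (bumpN ((1 / (s * r)) *\<^sub>R (y - ?p)) / (s * r) ^ CARD('n))" for y
    using s by simp
  have arg: "?p + (s * r) *\<^sub>R z = x + s *\<^sub>R (c - x + r *\<^sub>R z)" for z
    by (simp add: scaleR_add_right)
  have h: "?h (x + s *\<^sub>R (c - x + r *\<^sub>R z)) * bumpN z =
      g l (x + s *\<^sub>R (c - x + r *\<^sub>R z)) * (c - x + r *\<^sub>R z) $ l * bumpN z" for z
    using s by simp
  have "(\<integral>z. ?h (?p + (s * r) *\<^sub>R z) * bumpN z \<partial>lborel) = (\<integral>y. g l y * ?\<phi> y \<partial>lborel)"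
    unfolding eq by (rule integral_affine_bump[OF _ sr]) measurable
  with 1 show "(\<integral>y. u y * hbump_d x c r s y l \<partial>lborel) =
      - (\<integral>z. g l (x + s *\<^sub>R (c - x + r *\<^sub>R z)) * (c - x + r *\<^sub>R z) $ l * bumpN z \<partial>lborel)"
    unfolding arg h by simp
  have gq: "integrable lborel (\<lambda>y. indicator (hcube c r) y * g l y)"
    using g_int[OF _ \<Omega>] by (simp add: hcube_def)
  have "(\<integral>\<^sup>+z. ennreal \<bar>?h (?p + (s * r) *\<^sub>R z)\<bar> * ennreal (bumpN z) \<partial>lborel) =
      (\<integral>\<^sup>+y. ennreal \<bar>?h y\<bar> * ennreal (bumpN ((1 / (s * r)) *\<^sub>R (y - ?p)) / (s * r) ^ CARD('n)) \<partial>lborel)"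
    by (rule nn_integral_affine_bump[OF _ sr]) measurable
  \<comment> \<open>Two points of the cube differ by at most \<open>2 * r\<close> in each
    coordinate, and the bump is at most 1 and vanishes outside the cube.\<close>
  also have "\<dots> \<le> (\<integral>\<^sup>+y. ennreal (2 * r / s / (s * r) ^ CARD('n)) * ennreal \<bar>indicator (hcube c r) y * g l y\<bar> \<partial>lborel)"
  proof (rule nn_integral_mono)
    fix y
    show "ennreal \<bar>?h y\<bar> * ennreal (bumpN ((1 / (s * r)) *\<^sub>R (y - ?p)) / (s * r) ^ CARD('n))
      \<le> ennreal (2 * r / s / (s * r) ^ CARD('n)) * ennreal \<bar>indicator (hcube c r) y * g l y\<bar>"
    proof (cases "y \<in> hcube c r")
      case True
      have "\<bar>y $ l - c $ l\<bar> \<le> r" "\<bar>x $ l - c $ l\<bar> \<le> r"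
        using True x by (simp_all add: mem_hcube)
      then have "\<bar>y $ l - x $ l\<bar> \<le> 2 * r" by linarith
      then have "\<bar>y $ l - x $ l\<bar> / s \<le> 2 * r / s" using s by (simp add: divide_right_mono)
      then have "(\<bar>g l y\<bar> * (\<bar>y $ l - x $ l\<bar> / s)) * (bumpN ((1 / (s * r)) *\<^sub>R (y - ?p)) / (s * r) ^ CARD('n))
          \<le> (\<bar>g l y\<bar> * (2 * r / s)) * (1 / (s * r) ^ CARD('n))"
        using sr r s by (intro mult_mono[OF mult_left_mono divide_right_mono[OF bumpN_le]])
          (auto simp: bumpN_nonneg)
      then show ?thesis
        using True s r sr
        by (subst (1 2) ennreal_mult[symmetric]) (auto simp: bumpN_nonneg abs_mult mult_ac intro!: ennreal_leI)
    next
      case False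
      then have "hbump x c r s y = 0"
        by (rule hbump_outside[OF x s r])
      then have "bumpN ((1 / (s * r)) *\<^sub>R (y - ?p)) = 0"
        using s r by (auto simp: hbump_def)
      then show ?thesis by simp
    qed
  qed
  also have "\<dots> = ennreal (2 * r / s / (s * r) ^ CARD('n)) * (\<integral>\<^sup>+y. ennreal \<bar>indicator (hcube c r) y * g l y\<bar> \<partial>lborel)"
    by (intro nn_integral_cmult) (auto simp: hcube_def)
  also have "\<dots> < \<infinity>"
    using gq by (auto simp: integrable_iff_bounded ennreal_mult_less_top)
  finally have "(\<integral>\<^sup>+z. ennreal \<bar>?h (?p + (s * r) *\<^sub>R z)\<bar> * ennreal (bumpN z) \<partial>lborel) < \<infinity>" .
  then have "(\<integral>\<^sup>+z. ennreal (norm (?h (?p + (s * r) *\<^sub>R z) * bumpN z)) \<partial>lborel) < \<infinity>"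
    by (simp add: abs_mult bumpN_nonneg ennreal_mult[symmetric])
  then have "integrable lborel (\<lambda>z. ?h (?p + (s * r) *\<^sub>R z) * bumpN z)"
    by (simp add: integrable_iff_bounded)
  then show "integrable lborel (\<lambda>z. g l (x + s *\<^sub>R (c - x + r *\<^sub>R z)) * (c - x + r *\<^sub>R z) $ l * bumpN z)"
    unfolding arg h .
qed

lemma ennreal_FTC_bound:
  fixes f D :: "real \<Rightarrow> real"
  assumes "a \<le> b" and f: "\<And>s. s \<in> {a..b} \<Longrightarrow> (f has_real_derivative D s) (at s within {a..b})"
    and D: "continuous_on {a..b} D"
  shows "ennreal \<bar>f b - f a\<bar> \<le> (\<integral>\<^sup>+s. indicator {a..b} s * ennreal \<bar>D s\<bar> \<partial>lborel)"
proof -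
  have "(f has_vector_derivative D s) (at s within {a..b})" if "s \<in> {a..b}" for s
    using f[OF that] by (simp only: has_real_derivative_iff_has_vector_derivative)
  from fundamental_theorem_of_calculus[OF assms(1) this]
  have FTC: "(D has_integral (f b - f a)) {a..b}" .
  have int: "(\<lambda>s. \<bar>D s\<bar>) integrable_on {a..b}"
    by (intro integrable_continuous_interval continuous_intros D)
  have "norm (integral {a..b} D) \<le> integral {a..b} (\<lambda>s. \<bar>D s\<bar>)"
    by (rule integral_norm_bound_integral[OF has_integral_integrable[OF FTC] int]) simp
  then have le: "\<bar>f b - f a\<bar> \<le> integral {a..b} (\<lambda>s. \<bar>D s\<bar>)"
    by (simp add: integral_unique[OF FTC])
  have "(\<integral>\<^sup>+s. indicator {a..b} s * \<bar>D s\<bar> \<partial>lborel) = ennreal (integral {a..b} (\<lambda>s. \<bar>D s\<bar>))"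
    by (intro nn_integral_has_integral_lebesgue integrable_integral int) auto
  moreover have "(\<integral>\<^sup>+s. indicator {a..b} s * \<bar>D s\<bar> \<partial>lborel) = (\<integral>\<^sup>+s. indicator {a..b} s * ennreal \<bar>D s\<bar> \<partial>lborel)"
    by (intro nn_integral_cong) (auto simp: indicator_def)
  ultimately show ?thesis using le by (simp add: ennreal_leI)
qed


text \<open>The domain of integration is the fixed cube, which contains the supports for all
  \<open>s\<close>, so differentiation under the integral sign applies for \<open>s\<close> bounded
  away from 0.\<close>

lemma (in weak_gradient) homothety_derivative:
  assumes x: "x \<in> hcube c r" and e: "0 < e" and r: "r > 0" and s: "s \<in> {e..1}"
  defines "f \<equiv> \<lambda>s. integral (hcube c r) (\<lambda>y. u y * hbump x c r s y)"
    and "d \<equiv> \<lambda>s. integral (hcube c r) (\<lambda>y. u y * - (\<Sum>l\<in>UNIV. hbump_d x c r s y l))"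
  shows "(f has_real_derivative d s) (at s within {e..1})" and "continuous_on {e..1} d"
proof -
  have cu: "continuous_on ({e..1} \<times> hcube c r) (\<lambda>p. u (snd p))"
    by (rule continuous_on_compose2[OF u_cont]) (auto intro!: continuous_intros)
  have cd: "continuous_on ({e..1} \<times> hcube c r) (\<lambda>p. hbump_d x c r (fst p) (snd p) l)" for l
    using continuous_on_subset[OF continuous_hbump(2)[OF r e, of x c l], of "{e..1} \<times> hcube c r"]
    by (simp add: case_prod_unfold subset_iff)
  have cont: "continuous_on ({e..1} \<times> hcube c r) (\<lambda>(s, y). u y * - (\<Sum>l\<in>UNIV. hbump_d x c r s y l))"
    unfolding case_prod_unfold by (intro continuous_on_mult continuous_on_minus continuous_on_sum cu cd)
  show "(f has_real_derivative d s) (at s within {e..1})"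
    unfolding f_def d_def hcube_def
  proof (rule leibniz_rule_field_derivative[where U = "{e..1}"])
    fix s y assume "s \<in> {e..1}"
    then have "s > 0" using e by simp
    from DERIV_cmult[OF hbump_has_derivative[OF this r, of x c y], of "u y"]
    show "((\<lambda>s. u y * hbump x c r s y) has_field_derivative u y * - (\<Sum>l\<in>UNIV. hbump_d x c r s y l)) (at s within {e..1})"
      by (rule has_field_derivative_at_within)
  next
    fix s assume "s \<in> {e..1}"
    then have "s > 0" using e by simp
    then show "(\<lambda>y. u y * hbump x c r s y) integrable_on cbox (\<chi> i. c $ i - r) (\<chi> i. c $ i + r)"
      by (intro integrable_continuous continuous_on_mult continuous_hbump_y[OF r] continuous_on_subset[OF u_cont]) auto
  qed (use cont s in \<open>auto simp: hcube_def\<close>)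
  show "continuous_on {e..1} d"
    unfolding d_def hcube_def
    by (rule integral_continuous_on_param) (use cont in \<open>simp add: hcube_def\<close>)
qed

text \<open>Written in the variable \<open>z\<close> of the fixed bump, the average has no
  singularity at \<open>s = 0\<close>, where only the value at \<open>x\<close> remains.\<close>

lemma (in weak_gradient) homothety_limit:
  fixes x c :: "real^'n"
  assumes r: "r > 0"
  defines "f \<equiv> \<lambda>s. \<integral>z. u (x + s *\<^sub>R (c - x + r *\<^sub>R z)) * bumpN z \<partial>lborel"
  shows "continuous_on {0..1} f" and "f 0 = u x * bump_mass TYPE('n)"
proof -
  let ?B = "cbox (\<chi> i. - 1 / 2) (\<chi> i. 1 / 2) :: (real^'n) set"
  have c1: "continuous_on UNIV (\<lambda>z. u (x + s *\<^sub>R (c - x + r *\<^sub>R z)) * bumpN z)" for s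
    by (intro continuous_on_mult continuous_bumpN continuous_on_compose2[OF u_cont] continuous_intros) auto
  have f: "f s = integral ?B (\<lambda>z. u (x + s *\<^sub>R (c - x + r *\<^sub>R z)) * bumpN z)" for s
    unfolding f_def by (rule lborel_cont_integral(2)[OF c1, symmetric]) (simp add: bumpN_outside)
  have cb: "continuous_on ({0..1} \<times> ?B) (\<lambda>p. bumpN (snd p))"
    by (rule continuous_on_compose2[OF continuous_bumpN[of UNIV]]) (auto intro!: continuous_intros)
  have cu: "continuous_on ({0..1} \<times> ?B) (\<lambda>p. u (x + fst p *\<^sub>R (c - x + r *\<^sub>R snd p)))"
    by (rule continuous_on_compose2[OF u_cont]) (auto intro!: continuous_intros)
  show "continuous_on {0..1} f"
    unfolding f
    by (rule integral_continuous_on_param) (unfold case_prod_unfold, intro continuous_on_mult cb cu)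
  show "f 0 = u x * bump_mass TYPE('n)"
    by (simp add: f_def bump_mass_def)
qed

lemma integral_diff_mult:
  fixes f v w :: "'a \<Rightarrow> real"
  assumes "integrable M (\<lambda>z. f z * v z * w z)" "integrable M (\<lambda>z. v z * w z)"
  shows "integrable M (\<lambda>z. (f z - q) * v z * w z)"
    and "(\<integral>z. (f z - q) * v z * w z \<partial>M) = (\<integral>z. f z * v z * w z \<partial>M) - q * (\<integral>z. v z * w z \<partial>M)"
proof -
  have eq: "(\<lambda>z. (f z - q) * v z * w z) = (\<lambda>z. f z * v z * w z - q * (v z * w z))"
    by (auto simp: fun_eq_iff algebra_simps)
  show "integrable M (\<lambda>z. (f z - q) * v z * w z)"
    and "(\<integral>z. (f z - q) * v z * w z \<partial>M) = (\<integral>z. f z * v z * w z \<partial>M) - q * (\<integral>z. v z * w z \<partial>M)"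
    unfolding eq using assms by simp_all
qed

text \<open>Differentiating along the homothety contracting the bump to \<open>x\<close> represents
  \<open>u x\<close> through its weak gradient; an affine function is subtracted exactly.\<close>

lemma (in weak_gradient) representation_bound:
  assumes r: "r > 0" and \<Omega>: "hcube c r \<subseteq> \<Omega>"
  obtains a where "\<And>x. x \<in> hcube c r \<Longrightarrow> ennreal (bump_mass TYPE('n) * \<bar>u x - b \<bullet> x - a\<bar>) \<le>
    (\<integral>\<^sup>+s. indicator {0<..1} s * (\<Sum>l\<in>UNIV. \<integral>\<^sup>+z. ennreal (\<bar>g l (x + s *\<^sub>R (c - x + r *\<^sub>R z)) - b $ l\<bar> *
        \<bar>(c - x + r *\<^sub>R z) $ l\<bar> * bumpN z) \<partial>lborel) \<partial>lborel)"
proof -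
  define m where "m = bump_mass TYPE('n)"
  have m: "m > 0" unfolding m_def by (rule bump_mass_pos)
  define A where "A = (\<integral>z. u (c + r *\<^sub>R z) * bumpN z \<partial>lborel)"
  define k where "k l = (\<integral>z. z $ l * bumpN (z :: real^'n) \<partial>lborel)" for l
  \<comment> \<open>\<open>S\<close> is the integral of
    \<open>b \<bullet> (c + r *\<^sub>R z)\<close> against the bump. The number \<open>a\<close>
    below is thus the bump average of \<open>u\<close> minus its affine part around
    \<open>c\<close>. It does not involve \<open>x\<close>, since for \<open>s = 1\<close> the
    contracted bump is the original one.\<close>
  define S where "S = (\<Sum>l\<in>UNIV. b $ l * (c $ l * m + r * k l))"
  define a where "a = (A - S) / m"
  have ma: "m * a = A - S" using m by (simp add: a_def)
  show thesis
  proof (rule that[of a])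
    fix x assume x: "x \<in> hcube c r"
    let ?q = "\<lambda>z. c - x + r *\<^sub>R z"
    let ?G = "\<lambda>l s z. (g l (x + s *\<^sub>R ?q z) - b $ l) * (?q z) $ l * bumpN z"
    let ?N = "\<lambda>s. \<Sum>l\<in>UNIV. \<integral>\<^sup>+z. ennreal (\<bar>g l (x + s *\<^sub>R ?q z) - b $ l\<bar> * \<bar>(?q z) $ l\<bar> * bumpN z) \<partial>lborel"
    let ?T = "\<integral>\<^sup>+s. indicator {0<..1} s * ?N s \<partial>lborel"
    define n where "n l = (\<integral>z. (?q z) $ l * bumpN z \<partial>lborel)" for l
    have int_q: "integrable lborel (\<lambda>z. (?q z) $ l * bumpN z)" for l
      by (intro integrable_bumpN_mult continuous_intros)
    have n: "n l = (c $ l - x $ l) * m + r * k l" for l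
    proof -
      have "n l = (\<integral>z. (c $ l - x $ l) * bumpN z + r * (z $ l * bumpN z) \<partial>lborel)"
        unfolding n_def by (rule Bochner_Integration.integral_cong) (auto simp: algebra_simps)
      also have "\<dots> = (c $ l - x $ l) * m + r * k l"
        unfolding k_def m_def bump_mass_def
        by (subst Bochner_Integration.integral_add)
          (auto intro!: integrable_bumpN integrable_bumpN_mult continuous_intros)
      finally show ?thesis .
    qed
    define F where "F s = (\<integral>z. u (x + s *\<^sub>R ?q z) * bumpN z \<partial>lborel)" for s
    define f where "f s = integral (hcube c r) (\<lambda>y. u y * hbump x c r s y)" for s
    define d where "d s = integral (hcube c r) (\<lambda>y. u y * - (\<Sum>l\<in>UNIV. hbump_d x c r s y l))" for s
    have Ff: "F s = f s" if s: "0 < s" "s \<le> 1" for s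
    proof -
      have sr: "s * r > 0" using s r by simp
      have [measurable]: "u \<in> borel_measurable borel"
        using u_cont by (rule borel_measurable_continuous_onI)
      have "F s = (\<integral>z. u ((x + s *\<^sub>R (c - x)) + (s * r) *\<^sub>R z) * bumpN z \<partial>lborel)"
        unfolding F_def by (simp add: scaleR_add_right add.assoc)
      also have "\<dots> = (\<integral>y. u y * hbump x c r s y \<partial>lborel)"
        unfolding hbump_def by (rule integral_affine_bump[OF _ sr]) measurable
      also have "\<dots> = f s"
        unfolding f_def hcube_def
        by (rule lborel_cont_integral(2)[symmetric])
          (use hbump_outside(1)[OF x s r] in \<open>auto intro!: continuous_on_mult u_cont continuous_hbump_y r s simp: hcube_def\<close>)
      finally show ?thesis .
    qed
    have d: "d s = (\<Sum>l\<in>UNIV. \<integral>z. g l (x + s *\<^sub>R ?q z) * (?q z) $ l * bumpN z \<partial>lborel)" if s: "0 < s" "s \<le> 1" for s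
    proof -
      have cont: "continuous_on UNIV (\<lambda>y. u y * hbump_d x c r s y l)" for l
        by (intro continuous_on_mult u_cont continuous_hbump_y r s)
      have int: "integrable lborel (\<lambda>y. u y * hbump_d x c r s y l)"
        and eq: "integral (hcube c r) (\<lambda>y. u y * hbump_d x c r s y l) = (\<integral>y. u y * hbump_d x c r s y l \<partial>lborel)" for l
        using lborel_cont_integral[OF cont[of l], of "\<chi> i. c $ i - r" "\<chi> i. c $ i + r"] hbump_outside(2)[OF x s r]
        by (auto simp: hcube_def)
      have "d s = integral (hcube c r) (\<lambda>y. \<Sum>l\<in>UNIV. - (u y * hbump_d x c r s y l))"
        unfolding d_def by (simp add: sum_distrib_left sum_negf)
      also have "\<dots> = (\<Sum>l\<in>UNIV. integral (hcube c r) (\<lambda>y. - (u y * hbump_d x c r s y l)))"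
        unfolding hcube_def
        by (intro integral_sum finite integrable_continuous continuous_on_minus continuous_on_subset[OF cont]) auto
      also have "\<dots> = (\<Sum>l\<in>UNIV. - (\<integral>y. u y * hbump_d x c r s y l \<partial>lborel))"
        by (simp add: eq)
      also have "\<dots> = (\<Sum>l\<in>UNIV. \<integral>z. g l (x + s *\<^sub>R ?q z) * (?q z) $ l * bumpN z \<partial>lborel)"
        by (simp only: weak_hbump(1)[OF x s r \<Omega>] minus_minus)
      finally show ?thesis .
    qed
    \<comment> \<open>The bump integral of the linear function \<open>b \<bullet> _\<close> along
      the homothety is affine in \<open>s\<close>, with slope the subtracted sum.\<close>
    define f' where "f' s = f s - s * (\<Sum>l\<in>UNIV. b $ l * n l)" for s
    define d' where "d' s = d s - (\<Sum>l\<in>UNIV. b $ l * n l)" for s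
    have d'_le: "ennreal \<bar>d' s\<bar> \<le> ?N s" if s: "0 < s" "s \<le> 1" for s
    proof -
      note ig = weak_hbump(2)[OF x s r \<Omega>]
      note split = integral_diff_mult[where f = "\<lambda>z. g l (x + s *\<^sub>R ?q z)" and v = "\<lambda>z. (?q z) $ l"
          and w = bumpN and q = "b $ l" and M = lborel for l]
      have iG: "integrable lborel (?G l s)" for l
        by (rule split(1)[OF ig int_q])
      have "(\<integral>z. ?G l s z \<partial>lborel) = (\<integral>z. g l (x + s *\<^sub>R ?q z) * (?q z) $ l * bumpN z \<partial>lborel) - b $ l * n l" for l
        unfolding n_def by (rule split(2)[OF ig int_q])
      then have "d' s = (\<Sum>l\<in>UNIV. \<integral>z. ?G l s z \<partial>lborel)"
        unfolding d'_def d[OF s] by (simp only: sum_subtractf)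
      then have "ennreal \<bar>d' s\<bar> \<le> (\<Sum>l\<in>UNIV. ennreal \<bar>\<integral>z. ?G l s z \<partial>lborel\<bar>)"
        using sum_abs[of "\<lambda>l. \<integral>z. ?G l s z \<partial>lborel" UNIV] by (simp add: ennreal_leI)
      also have "\<dots> \<le> (\<Sum>l\<in>UNIV. \<integral>\<^sup>+z. ennreal (norm (?G l s z)) \<partial>lborel)"
        unfolding real_norm_def[symmetric] by (intro sum_mono integral_norm_bound_ennreal iG)
      also have "\<dots> = ?N s"
        by (simp add: abs_mult bumpN_nonneg)
      finally show ?thesis .
    qed
    have bound: "ennreal \<bar>f' 1 - f' e\<bar> \<le> ?T" if e: "0 < e" "e \<le> 1" for e
    proof -
      note hd = homothety_derivative[OF x e(1) r, folded f_def d_def]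
      have "ennreal \<bar>f' 1 - f' e\<bar> \<le> (\<integral>\<^sup>+s. indicator {e..1} s * ennreal \<bar>d' s\<bar> \<partial>lborel)"
      proof (rule ennreal_FTC_bound[OF e(2)])
        show "(f' has_real_derivative d' s) (at s within {e..1})" if "s \<in> {e..1}" for s
          unfolding f'_def d'_def using hd(1)[OF that] by (auto intro!: derivative_eq_intros)
        show "continuous_on {e..1} d'"
          unfolding d'_def using hd(2)[of 1] e by (auto intro!: continuous_intros)
      qed
      also have "\<dots> \<le> ?T"
        using e d'_le by (intro nn_integral_mono) (auto simp: indicator_def)
      finally show ?thesis .
    qed
    note lim = homothety_limit[OF r, of x c, folded F_def]
    \<comment> \<open>\<open>F'\<close> agrees with \<open>f'\<close> for positive \<open>s\<close>
      and is continuous at 0, so the bound on \<open>[e, 1]\<close> passes to the limit.\<close>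
    define F' where "F' s = F s - s * (\<Sum>l\<in>UNIV. b $ l * n l)" for s
    have "(F' \<longlongrightarrow> F' 0) (at_right 0)"
    proof -
      have "continuous_on {0..1} F'"
        unfolding F'_def by (intro continuous_intros lim(1))
      then have "(F' \<longlongrightarrow> F' 0) (at 0 within {0..1})"
        by (simp add: continuous_on_def)
      then show ?thesis
        by (simp add: at_within_Icc_at_right)
    qed
    then have "((\<lambda>e. ennreal \<bar>F' 1 - F' e\<bar>) \<longlongrightarrow> ennreal \<bar>F' 1 - F' 0\<bar>) (at_right 0)"
      by (intro tendsto_intros)
    moreover have "eventually (\<lambda>e. ennreal \<bar>F' 1 - F' e\<bar> \<le> ?T) (at_right 0)"
      unfolding eventually_at_right_field
    proof (intro exI[of _ 1] conjI allI impI)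
      fix e :: real assume e: "0 < e" "e < 1"
      then have "F' e = f' e" "F' 1 = f' 1"
        using Ff[of e] Ff[of 1] by (auto simp: F'_def f'_def)
      then show "ennreal \<bar>F' 1 - F' e\<bar> \<le> ?T"
        using bound[of e] e by simp
    qed simp
    ultimately have "ennreal \<bar>F' 1 - F' 0\<bar> \<le> ?T"
      by (rule tendsto_upperbound) simp
    moreover have "\<bar>F' 1 - F' 0\<bar> = m * \<bar>u x - b \<bullet> x - a\<bar>"
    proof -
      have "F 1 = A" unfolding F_def A_def by (simp add: algebra_simps)
      then have "F' 1 - F' 0 = A - (\<Sum>l\<in>UNIV. b $ l * n l) - u x * m"
        unfolding F'_def lim(2) m_def by simp
      also have "(\<Sum>l\<in>UNIV. b $ l * n l) = S - m * (b \<bullet> x)"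
        unfolding n S_def inner_vec_def sum_distrib_left sum_subtractf[symmetric]
        by (intro sum.cong) (auto simp: algebra_simps)
      also have "A - (S - m * (b \<bullet> x)) - u x * m = - (m * (u x - b \<bullet> x - a))"
        using ma by (simp add: right_diff_distrib mult.commute)
      finally show ?thesis using m by (simp add: abs_mult)
    qed
    ultimately show "ennreal (bump_mass TYPE('n) * \<bar>u x - b \<bullet> x - a\<bar>) \<le> ?T"
      unfolding m_def by simp
  qed
qed

section \<open>Riesz potentials and the weight\<close>

text \<open>The weight \<open>W\<close> of the overview for \<open>m = N - 1\<close>, the exponent
  of the Riesz kernel. Its derivative at the level \<sigma> is the kernel at distance
  \<open>R \<sigma>\<close>, where that level is cut.\<close>

definition layer_weight :: "nat \<Rightarrow> (real \<Rightarrow> real) \<Rightarrow> real \<Rightarrow> ennreal" where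
  "layer_weight m R a = (\<integral>\<^sup>+\<sigma>. indicator {0<..<a} \<sigma> * ennreal (1 / R \<sigma> ^ m) \<partial>lborel)"

lemma nn_integral_power_tail:
  fixes a :: real
  assumes a: "a > 0" and n: "n > 0"
  shows "(\<integral>\<^sup>+s. indicator {a..} s * ennreal (1 / s ^ Suc n) \<partial>lborel) = ennreal (1 / (n * a ^ n))"
proof -
  have "(\<integral>\<^sup>+s. ennreal (1 / s ^ Suc n) * indicator {a..} s \<partial>lborel) = ennreal (0 - (- (1 / (n * a ^ n))))"
  proof (rule nn_integral_FTC_atLeast[where F = "\<lambda>s::real. - (1 / (real n * s ^ n))" and T = 0])
    show "((\<lambda>s::real. - (1 / (real n * s ^ n))) has_real_derivative 1 / s ^ Suc n) (at s)" if "a \<le> s" for s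
    proof -
      have s: "s > 0" using that a by simp
      have "((\<lambda>s. s ^ n) has_real_derivative n * s ^ (n - 1)) (at s)"
        using DERIV_pow[of n s UNIV] by simp
      from DERIV_divide[OF DERIV_const[of "- (1 / n)"] this]
      have "((\<lambda>s. - (1 / n) / s ^ n) has_real_derivative (1 / n * (n * s ^ (n - 1))) / (s ^ n * s ^ n)) (at s)"
        using s by simp
      moreover have "(1 / n * (n * s ^ (n - 1))) / (s ^ n * s ^ n) = 1 / s ^ Suc n"
        using s n power_Suc[of s "n - 1"] by (simp add: field_simps)
      ultimately show ?thesis by simp
    qed
    have "((\<lambda>s::real. inverse (s ^ n)) \<longlongrightarrow> 0) at_top"
      using n by (intro tendsto_inverse_0_at_top filterlim_pow_at_top filterlim_ident)
    from tendsto_mult_right_zero[OF this, of "- (1 / real n)"]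
    show "((\<lambda>s::real. - (1 / (real n * s ^ n))) \<longlongrightarrow> 0) at_top"
      by (simp add: divide_inverse)
    show "0 \<le> 1 / s ^ Suc n" if "a \<le> s" for s
      using that a by simp
  qed measurable
  then show ?thesis
    unfolding mult.commute[of "indicator {a..} _"] by (simp only: diff_0 minus_minus)
qed

text \<open>Averaging over \<open>s\<close> turns the contracted bumps into the Riesz kernel. A bump
  reaches \<open>y\<close> only if \<open>s\<close> is at least a multiple of
  \<open>norm (y - x) / r\<close>, and the remaining tail of \<open>1 / s ^ (n + 1)\<close> is
  integrated explicitly. The powers of \<open>r\<close> cancel, so the constant is scale
  invariant.\<close>

lemma hbump_kernel_bound:
  fixes x c y :: "real^'n"
  assumes x: "x \<in> hcube c r" and r: "r > 0"
  defines "n \<equiv> CARD('n)"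
  shows "(\<integral>\<^sup>+s. indicator {0<..1} s * ennreal (norm (y - x) / s * hbump x c r s y) \<partial>lborel)
    \<le> indicator (hcube c r) y * ennreal ((2 * n) ^ n / n / norm (y - x) ^ (n - 1))"
proof (cases "y \<in> hcube c r \<and> y \<noteq> x")
  case False
  have vanish: "norm (y - x) / s * hbump x c r s y = 0" if s: "0 < s" "s \<le> 1" for s
  proof (cases "y = x")
    case False
    with \<open>\<not> (y \<in> hcube c r \<and> y \<noteq> x)\<close> have "y \<notin> hcube c r" by simp
    from hbump_outside(1)[OF x s r this] show ?thesis by simp
  qed simp
  have "(\<integral>\<^sup>+s. indicator {0<..1} s * ennreal (norm (y - x) / s * hbump x c r s y) \<partial>lborel)
      = (\<integral>\<^sup>+s. 0 \<partial>(lborel :: real measure))"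
  proof (intro nn_integral_cong)
    fix s :: real
    show "indicator {0<..1} s * ennreal (norm (y - x) / s * hbump x c r s y) = 0"
      by (cases "s \<in> {0<..1}") (simp_all add: vanish del: times_divide_eq_left)
  qed
  then show ?thesis by simp
next
  case True
  have n: "n > 0" by (simp add: n_def)
  define d where "d = norm (y - x)"
  have d: "d > 0" using True by (simp add: d_def)
  \<comment> \<open>At parameter \<open>s\<close> the bump lies within \<open>2 * s * r\<close> of
    \<open>x\<close> in each coordinate; the factor \<open>n\<close> passes from this to the
    Euclidean norm through the sum of the coordinates.\<close>
  define a where "a = d / (2 * n * r)"
  have a: "a > 0" using d r n by (simp add: a_def)
  have hb: "norm (y - x) / s * hbump x c r s y \<le> d / r ^ n * (1 / s ^ Suc n)" if s: "0 < s" for s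
  proof -
    have "hbump x c r s y \<le> 1 / (s * r) ^ n"
      unfolding hbump_def n_def by (rule divide_right_mono[OF bumpN_le]) (use s r in simp)
    then have "d / s * hbump x c r s y \<le> d / s * (1 / (s * r) ^ n)"
      by (rule mult_left_mono) (use s d in simp)
    also have "d / s * (1 / (s * r) ^ n) = d / r ^ n * (1 / s ^ Suc n)"
      by (simp add: power_mult_distrib)
    finally show ?thesis unfolding d_def .
  qed
  have hz: "hbump x c r s y = 0" if s: "0 < s" and sa: "s < a" for s
  proof (rule ccontr)
    assume "hbump x c r s y \<noteq> 0"
    from hbump_nonzeroD[OF this s r]
    have y: "x $ i + s * (c $ i - x $ i) - s * r / 2 \<le> y $ i \<and> y $ i \<le> x $ i + s * (c $ i - x $ i) + s * r / 2" for i
      by (simp add: mem_box_cart)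
    have sr: "s * r > 0" using s r by simp
    have "\<bar>(y - x) $ i\<bar> \<le> 2 * s * r" for i
    proof -
      have "\<bar>s * (c $ i - x $ i)\<bar> \<le> s * r"
        using x s unfolding mem_hcube abs_mult by (simp add: abs_minus_commute)
      then have "\<bar>y $ i - x $ i\<bar> \<le> 2 * (s * r)"
        using y[of i] sr unfolding abs_le_iff by linarith
      then show ?thesis by simp
    qed
    then have "(\<Sum>i\<in>UNIV. \<bar>(y - x) $ i\<bar>) \<le> (\<Sum>i\<in>(UNIV :: 'n set). 2 * s * r)"
      by (intro sum_mono)
    then have "d \<le> n * (2 * s * r)"
      using norm_le_l1_cart[of "y - x"] by (simp add: d_def n_def)
    also have "\<dots> < d" using sa r n by (simp add: a_def field_simps)
    finally show False by simp
  qed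
  have "(\<integral>\<^sup>+s. indicator {0<..1} s * ennreal (norm (y - x) / s * hbump x c r s y) \<partial>lborel)
      \<le> (\<integral>\<^sup>+s. ennreal (d / r ^ n) * (indicator {a..} s * ennreal (1 / s ^ Suc n)) \<partial>lborel)"
  proof (rule nn_integral_mono)
    fix s :: real
    consider "s \<le> 0" | "0 < s" "s < a" | "0 < s" "a \<le> s" by linarith
    then show "indicator {0<..1} s * ennreal (norm (y - x) / s * hbump x c r s y)
      \<le> ennreal (d / r ^ n) * (indicator {a..} s * ennreal (1 / s ^ Suc n))"
    proof cases
      case 3
      have "ennreal (d / r ^ n) * ennreal (1 / s ^ Suc n) = ennreal (d / r ^ n * (1 / s ^ Suc n))"
        using d r 3 by (intro ennreal_mult[symmetric]) auto
      then show ?thesis using 3 hb[OF 3(1)] by (auto simp: indicator_def ennreal_leI simp del: power_Suc)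
    qed (auto simp: hz)
  qed
  also have "\<dots> = ennreal (d / r ^ n) * ennreal (1 / (n * a ^ n))"
    unfolding nn_integral_power_tail[OF a n, symmetric] by (rule nn_integral_cmult) measurable
  also have "\<dots> = ennreal (d / r ^ n * (1 / (n * a ^ n)))"
    using d r n a by (intro ennreal_mult[symmetric]) auto
  also have "d / r ^ n * (1 / (n * a ^ n)) = (2 * n) ^ n / n / d ^ (n - 1)"
  proof -
    have "d ^ n = d * d ^ (n - 1)" using n power_Suc[of d "n - 1"] by simp
    then show ?thesis
      using d r n by (simp add: a_def power_divide power_mult_distrib field_simps)
  qed
  finally show ?thesis using True by (simp add: d_def)
qed

text \<open>The value \<open>a\<close> is taken for \<open>s\<close> up to
  \<open>\<rho> / a\<close>, so the product is at most \<rho> whatever \<open>a\<close> is. It is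
  applied with \<open>a\<close> the length of a ray, which makes the contribution close to
  \<open>x\<close> independent of the direction.\<close>

lemma nn_integral_small_multiples:
  fixes a \<rho> :: real
  assumes "0 \<le> a" "0 \<le> \<rho>"
  shows "(\<integral>\<^sup>+s. indicator {0<..1} s * (if s * a < \<rho> then ennreal a else 0) \<partial>lborel) \<le> ennreal \<rho>"
proof (cases "a = 0")
  case False
  then have a: "a > 0" using assms by simp
  have "(\<integral>\<^sup>+s. indicator {0<..1} s * (if s * a < \<rho> then ennreal a else 0) \<partial>lborel)
      \<le> (\<integral>\<^sup>+s. ennreal a * indicator {0..\<rho> / a} s \<partial>lborel)"
    using a by (intro nn_integral_mono) (auto simp: indicator_def field_simps)
  also have "\<dots> = ennreal a * ennreal (\<rho> / a)"
    using a assms by (subst nn_integral_cmult_indicator) auto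
  also have "\<dots> = ennreal \<rho>"
    using a assms by (subst ennreal_mult[symmetric]) auto
  finally show ?thesis .
qed (auto simp: if_distrib cong: if_cong)

lemma ennreal_layer: "0 \<le> a \<Longrightarrow> ennreal a = (\<integral>\<^sup>+\<sigma>. indicator {0<..<a} \<sigma> \<partial>lborel)"
  by simp

lemma nn_integral_bumpN: "(\<integral>\<^sup>+z. ennreal (bumpN (z :: real^'n)) \<partial>lborel) = ennreal (bump_mass TYPE('n))"
  unfolding bump_mass_def
  by (rule nn_integral_eq_integral[OF integrable_bumpN]) (simp add: bumpN_nonneg)

text \<open>The Riesz potential of \<open>G\<close> is split, at each level \<open>\<sigma>\<close> of \<open>G\<close>, at the distance \<open>R \<sigma> / \<tau>\<close> from \<open>x\<close>.
  This replaces the duality between \<open>L\<^sup>N\<^sup>,\<^sup>1\<close> and weak \<open>L\<^sup>N\<^sup>'\<close>.\<close>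

theorem riesz_potential_split:
  fixes G :: "real^'n \<Rightarrow> real" and x c :: "real^'n"
  assumes [measurable]: "G \<in> borel_measurable borel" "R \<in> borel_measurable borel"
    and G: "\<And>y. 0 \<le> G y" and R: "\<And>\<sigma>. 0 < R \<sigma>" and r: "r > 0" and \<tau>: "\<tau> > 0"
    and x: "x \<in> hcube c r"
    and M: "(\<integral>\<^sup>+\<sigma>. indicator {0<..} \<sigma> * ennreal (R \<sigma>) \<partial>lborel) \<le> ennreal M" "0 \<le> M"
  defines "n \<equiv> CARD('n)"
  shows "(\<integral>\<^sup>+s. indicator {0<..1} s * (\<integral>\<^sup>+z. ennreal (G (x + s *\<^sub>R (c - x + r *\<^sub>R z)) *
        norm (c - x + r *\<^sub>R z) * bumpN z) \<partial>lborel) \<partial>lborel)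
    \<le> ennreal ((2 * n) ^ n / n * \<tau> ^ (n - 1)) * (\<integral>\<^sup>+y. indicator (hcube c r) y * layer_weight (n - 1) R (G y) \<partial>lborel)
      + ennreal (bump_mass TYPE('n) * M / \<tau>)"
proof -
  let ?q = "\<lambda>z. c - x + r *\<^sub>R z"
  \<comment> \<open>The levels of \<open>G y\<close> for which \<open>y\<close> lies outside the
    radius of the cut. They are estimated under the name \<open>near\<close>.\<close>
  define H where "H y = (\<integral>\<^sup>+\<sigma>. indicator {0<..<G y} \<sigma> * (if R \<sigma> / \<tau> \<le> norm (y - x) then 1 else 0) \<partial>lborel)" for y
  \<comment> \<open>The complementary part, inside the radius of the cut, estimated under the name
    \<open>far\<close>. The restriction of \<sigma> to levels below \<open>G\<close> is dropped, so
    that its bound depends on \<open>R\<close> alone.\<close>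
  define T where "T s z \<sigma> = indicator {0<..1} s * (if s * norm (?q z) < R \<sigma> / \<tau> then ennreal (norm (?q z)) else 0)
     * (indicator {0<..} \<sigma> * ennreal (bumpN z))" for s :: real and z :: "real^'n" and \<sigma> :: real
  have ind: "indicator {0<..<G y} \<sigma> = (if 0 < \<sigma> \<and> \<sigma> < G y then 1 else 0 :: ennreal)" for y \<sigma>
    by (simp add: indicator_def)
  have [measurable]: "H \<in> borel_measurable borel"
    unfolding H_def ind by measurable
  have Rm: "(\<lambda>\<sigma>. indicator {0<..} \<sigma> * ennreal (R \<sigma>)) \<in> borel_measurable lborel"
    by measurable
  have split: "indicator {0<..1} s * (\<integral>\<^sup>+z. ennreal (G (x + s *\<^sub>R ?q z) * norm (?q z) * bumpN z) \<partial>lborel)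
     \<le> indicator {0<..1} s * (\<integral>\<^sup>+z. H (x + s *\<^sub>R ?q z) * ennreal (norm (?q z)) * ennreal (bumpN z) \<partial>lborel)
       + (\<integral>\<^sup>+z. \<integral>\<^sup>+\<sigma>. T s z \<sigma> \<partial>lborel \<partial>lborel)" for s
  proof (cases "s \<in> {0<..1}")
    case True
    then have s: "s > 0" by simp
    have "ennreal (G (x + s *\<^sub>R ?q z) * norm (?q z) * bumpN z) \<le>
        H (x + s *\<^sub>R ?q z) * ennreal (norm (?q z)) * ennreal (bumpN z) + (\<integral>\<^sup>+\<sigma>. T s z \<sigma> \<partial>lborel)" for z
    proof -
      let ?y = "x + s *\<^sub>R ?q z"
      let ?S = "\<integral>\<^sup>+\<sigma>. indicator {0<..} \<sigma> * (if s * norm (?q z) < R \<sigma> / \<tau> then 1 else 0) \<partial>lborel"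
      have nrm: "norm (?y - x) = s * norm (?q z)" using s by simp
      have "ennreal (G ?y) = (\<integral>\<^sup>+\<sigma>. indicator {0<..<G ?y} \<sigma> \<partial>lborel)"
        by (rule ennreal_layer[OF G])
      also have "\<dots> \<le> (\<integral>\<^sup>+\<sigma>. indicator {0<..<G ?y} \<sigma> * (if R \<sigma> / \<tau> \<le> norm (?y - x) then 1 else 0)
          + indicator {0<..} \<sigma> * (if s * norm (?q z) < R \<sigma> / \<tau> then 1 else 0) \<partial>lborel)"
        unfolding nrm by (intro nn_integral_mono) (auto simp: indicator_def)
      also have "\<dots> = H ?y + ?S"
        unfolding H_def by (rule nn_integral_add) measurable
      finally have le: "ennreal (G ?y) \<le> H ?y + ?S" .
      have "ennreal (G ?y * norm (?q z) * bumpN z) = ennreal (G ?y) * (ennreal (norm (?q z)) * ennreal (bumpN z))"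
        by (simp add: ennreal_mult G bumpN_nonneg mult.assoc)
      also have "\<dots> \<le> (H ?y + ?S) * (ennreal (norm (?q z)) * ennreal (bumpN z))"
        by (rule mult_right_mono[OF le]) simp
      also have "\<dots> = H ?y * ennreal (norm (?q z)) * ennreal (bumpN z) + ?S * (ennreal (norm (?q z)) * ennreal (bumpN z))"
        by (simp add: distrib_right mult.assoc)
      also have "?S * (ennreal (norm (?q z)) * ennreal (bumpN z)) = (\<integral>\<^sup>+\<sigma>. T s z \<sigma> \<partial>lborel)"
        unfolding T_def using True
        by (subst nn_integral_multc[symmetric]) (auto intro!: nn_integral_cong simp: indicator_def)
      finally show ?thesis .
    qed
    then have "(\<integral>\<^sup>+z. ennreal (G (x + s *\<^sub>R ?q z) * norm (?q z) * bumpN z) \<partial>lborel) \<le>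
        (\<integral>\<^sup>+z. H (x + s *\<^sub>R ?q z) * ennreal (norm (?q z)) * ennreal (bumpN z) + (\<integral>\<^sup>+\<sigma>. T s z \<sigma> \<partial>lborel) \<partial>lborel)"
      by (rule nn_integral_mono)
    also have "\<dots> = (\<integral>\<^sup>+z. H (x + s *\<^sub>R ?q z) * ennreal (norm (?q z)) * ennreal (bumpN z) \<partial>lborel)
        + (\<integral>\<^sup>+z. \<integral>\<^sup>+\<sigma>. T s z \<sigma> \<partial>lborel \<partial>lborel)"
      unfolding T_def by (rule nn_integral_add) measurable
    finally show ?thesis using True by simp
  qed simp
  \<comment> \<open>Exchanging the order puts the integral over \<open>s\<close> innermost; at each
    level it is at most \<open>R \<sigma> / \<tau>\<close>.\<close>
  have "(\<integral>\<^sup>+s. \<integral>\<^sup>+z. \<integral>\<^sup>+\<sigma>. T s z \<sigma> \<partial>lborel \<partial>lborel \<partial>lborel) = (\<integral>\<^sup>+z. \<integral>\<^sup>+s. \<integral>\<^sup>+\<sigma>. T s z \<sigma> \<partial>lborel \<partial>lborel \<partial>lborel)"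
    unfolding T_def by (rule lborel_pair.Fubini'[symmetric]) measurable
  also have "\<dots> = (\<integral>\<^sup>+z. \<integral>\<^sup>+\<sigma>. \<integral>\<^sup>+s. T s z \<sigma> \<partial>lborel \<partial>lborel \<partial>lborel)"
    unfolding T_def by (rule nn_integral_cong, rule lborel_pair.Fubini'[symmetric]) measurable
  also have "\<dots> \<le> (\<integral>\<^sup>+z. (\<integral>\<^sup>+\<sigma>. indicator {0<..} \<sigma> * ennreal (R \<sigma>) \<partial>lborel) * ennreal (1 / \<tau>) * ennreal (bumpN (z :: real^'n)) \<partial>lborel)"
  proof (rule nn_integral_mono)
    fix z :: "real^'n"
    have "(\<integral>\<^sup>+\<sigma>. \<integral>\<^sup>+s. T s z \<sigma> \<partial>lborel \<partial>lborel) \<le> (\<integral>\<^sup>+\<sigma>. (indicator {0<..} \<sigma> * ennreal (R \<sigma>)) * (ennreal (1 / \<tau>) * ennreal (bumpN z)) \<partial>lborel)"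
    proof (rule nn_integral_mono)
      fix \<sigma>
      have "(\<integral>\<^sup>+s. T s z \<sigma> \<partial>lborel) =
          (\<integral>\<^sup>+s. indicator {0<..1} s * (if s * norm (?q z) < R \<sigma> / \<tau> then ennreal (norm (?q z)) else 0) \<partial>lborel)
            * (indicator {0<..} \<sigma> * ennreal (bumpN z))"
        unfolding T_def by (rule nn_integral_multc) measurable
      also have "\<dots> \<le> ennreal (R \<sigma> / \<tau>) * (indicator {0<..} \<sigma> * ennreal (bumpN z))"
        using \<tau> R[of \<sigma>] by (intro mult_right_mono nn_integral_small_multiples) auto
      also have "ennreal (R \<sigma> / \<tau>) = ennreal (R \<sigma>) * ennreal (1 / \<tau>)"
        using \<tau> R[of \<sigma>] by (subst ennreal_mult[symmetric]) auto
      finally show "(\<integral>\<^sup>+s. T s z \<sigma> \<partial>lborel) \<le> (indicator {0<..} \<sigma> * ennreal (R \<sigma>)) * (ennreal (1 / \<tau>) * ennreal (bumpN z))"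
        by (simp add: mult_ac)
    qed
    also have "\<dots> = (\<integral>\<^sup>+\<sigma>. indicator {0<..} \<sigma> * ennreal (R \<sigma>) \<partial>lborel) * (ennreal (1 / \<tau>) * ennreal (bumpN z))"
      by (rule nn_integral_multc[OF Rm])
    finally show "(\<integral>\<^sup>+\<sigma>. \<integral>\<^sup>+s. T s z \<sigma> \<partial>lborel \<partial>lborel) \<le>
        (\<integral>\<^sup>+\<sigma>. indicator {0<..} \<sigma> * ennreal (R \<sigma>) \<partial>lborel) * ennreal (1 / \<tau>) * ennreal (bumpN z)"
      by (simp add: mult.assoc)
  qed
  also have "\<dots> = (\<integral>\<^sup>+\<sigma>. indicator {0<..} \<sigma> * ennreal (R \<sigma>) \<partial>lborel) * ennreal (1 / \<tau>) * ennreal (bump_mass TYPE('n))"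
    unfolding nn_integral_bumpN[symmetric] by (rule nn_integral_cmult) measurable
  also have "\<dots> \<le> ennreal M * ennreal (1 / \<tau>) * ennreal (bump_mass TYPE('n))"
    by (rule mult_right_mono[OF mult_right_mono[OF M(1)]]) simp_all
  also have "\<dots> = ennreal (bump_mass TYPE('n) * M / \<tau>)"
    using M \<tau> bump_mass_pos[where 'n = 'n] by (simp add: ennreal_mult[symmetric] mult_ac)
  finally have far: "(\<integral>\<^sup>+s. \<integral>\<^sup>+z. \<integral>\<^sup>+\<sigma>. T s z \<sigma> \<partial>lborel \<partial>lborel \<partial>lborel) \<le> ennreal (bump_mass TYPE('n) * M / \<tau>)" .
  have meas_hb [measurable]: "(\<lambda>p. hbump x c r (fst p) (snd p)) \<in> borel_measurable (lborel \<Otimes>\<^sub>M lborel)"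
    unfolding hbump_def by measurable
  have "(\<integral>\<^sup>+s. indicator {0<..1} s * (\<integral>\<^sup>+z. H (x + s *\<^sub>R ?q z) * ennreal (norm (?q z)) * ennreal (bumpN z) \<partial>lborel) \<partial>lborel)
      = (\<integral>\<^sup>+s. \<integral>\<^sup>+y. H y * (indicator {0<..1} s * ennreal (norm (y - x) / s * hbump x c r s y)) \<partial>lborel \<partial>lborel)"
  proof (rule nn_integral_cong)
    fix s :: real
    show "indicator {0<..1} s * (\<integral>\<^sup>+z. H (x + s *\<^sub>R ?q z) * ennreal (norm (?q z)) * ennreal (bumpN z) \<partial>lborel)
      = (\<integral>\<^sup>+y. H y * (indicator {0<..1} s * ennreal (norm (y - x) / s * hbump x c r s y)) \<partial>lborel)"
    proof (cases "s \<in> {0<..1}")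
      case True
      then have s: "s > 0" by simp
      then have sr: "s * r > 0" using r by simp
      have arg: "(x + s *\<^sub>R (c - x)) + (s * r) *\<^sub>R z = x + s *\<^sub>R ?q z" for z
        by (simp add: scaleR_add_right)
      have hm: "(\<lambda>y. H y * ennreal (norm (y - x) / s)) \<in> borel_measurable borel"
        by measurable
      have nq: "norm (x + s *\<^sub>R ?q z - x) / s = norm (?q z)" for z
        using s by simp
      have "(\<integral>\<^sup>+z. H (x + s *\<^sub>R ?q z) * ennreal (norm (x + s *\<^sub>R ?q z - x) / s) * ennreal (bumpN z) \<partial>lborel)
        = (\<integral>\<^sup>+y. H y * ennreal (norm (y - x) / s) * ennreal (hbump x c r s y) \<partial>lborel)"
        using nn_integral_affine_bump[OF hm sr, of "x + s *\<^sub>R (c - x)"] unfolding arg hbump_def .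
      then have eq: "(\<integral>\<^sup>+z. H (x + s *\<^sub>R ?q z) * ennreal (norm (?q z)) * ennreal (bumpN z) \<partial>lborel)
        = (\<integral>\<^sup>+y. H y * ennreal (norm (y - x) / s) * ennreal (hbump x c r s y) \<partial>lborel)"
        unfolding nq .
      have eq2: "ennreal (norm (y - x) / s) * ennreal (hbump x c r s y) = ennreal (norm (y - x) / s * hbump x c r s y)" for y
        using s r by (intro ennreal_mult[symmetric]) (auto simp: hbump_def bumpN_nonneg)
      have "(\<integral>\<^sup>+z. H (x + s *\<^sub>R ?q z) * (ennreal (norm (?q z)) * ennreal (bumpN z)) \<partial>lborel)
        = (\<integral>\<^sup>+y. H y * ennreal (norm (y - x) / s * hbump x c r s y) \<partial>lborel)"
        using eq unfolding mult.assoc eq2 .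
      with True show ?thesis
        by (simp add: mult.assoc del: times_divide_eq_left)
    qed simp
  qed
  also have "\<dots> = (\<integral>\<^sup>+y. \<integral>\<^sup>+s. H y * (indicator {0<..1} s * ennreal (norm (y - x) / s * hbump x c r s y)) \<partial>lborel \<partial>lborel)"
    unfolding hbump_def by (rule lborel_pair.Fubini'[symmetric]) measurable
  also have "\<dots> \<le> (\<integral>\<^sup>+y. ennreal ((2 * n) ^ n / n * \<tau> ^ (n - 1)) * (indicator (hcube c r) y * layer_weight (n - 1) R (G y)) \<partial>lborel)"
  proof (rule nn_integral_mono)
    fix y :: "real^'n"
    let ?C = "real ((2 * n) ^ n) / n"
    have "(\<integral>\<^sup>+s. H y * (indicator {0<..1} s * ennreal (norm (y - x) / s * hbump x c r s y)) \<partial>lborel)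
        = H y * (\<integral>\<^sup>+s. indicator {0<..1} s * ennreal (norm (y - x) / s * hbump x c r s y) \<partial>lborel)"
      unfolding hbump_def by (rule nn_integral_cmult) measurable
    also have "\<dots> \<le> H y * (indicator (hcube c r) y * ennreal (?C / norm (y - x) ^ (n - 1)))"
      using hbump_kernel_bound[OF x r, of y] unfolding n_def by (intro mult_left_mono) auto
    also have "\<dots> = indicator (hcube c r) y * (\<integral>\<^sup>+\<sigma>. indicator {0<..<G y} \<sigma> *
        (if R \<sigma> / \<tau> \<le> norm (y - x) then 1 else 0) * ennreal (?C / norm (y - x) ^ (n - 1)) \<partial>lborel)"
      unfolding H_def by (subst nn_integral_multc) (auto simp: mult_ac)
    also have "\<dots> \<le> indicator (hcube c r) y * (\<integral>\<^sup>+\<sigma>. ennreal (?C * \<tau> ^ (n - 1)) *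
        (indicator {0<..<G y} \<sigma> * ennreal (1 / R \<sigma> ^ (n - 1))) \<partial>lborel)"
    proof (intro mult_left_mono nn_integral_mono)
      fix \<sigma>
      show "indicator {0<..<G y} \<sigma> * (if R \<sigma> / \<tau> \<le> norm (y - x) then 1 else 0) * ennreal (?C / norm (y - x) ^ (n - 1))
        \<le> ennreal (?C * \<tau> ^ (n - 1)) * (indicator {0<..<G y} \<sigma> * ennreal (1 / R \<sigma> ^ (n - 1)))"
      proof (cases "R \<sigma> / \<tau> \<le> norm (y - x) \<and> \<sigma> \<in> {0<..<G y}")
        case True
        \<comment> \<open>Outside the cut the kernel is at most its value at distance
          \<open>R \<sigma> / \<tau>\<close>. The factor \<open>1 / R \<sigma> ^ (n - 1)\<close>
          that appears is the integrand of the weight.\<close>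
        have "?C / norm (y - x) ^ (n - 1) \<le> ?C / (R \<sigma> / \<tau>) ^ (n - 1)"
        proof (intro divide_left_mono power_mono mult_pos_pos zero_less_power)
          show "0 < R \<sigma> / \<tau>" using R[of \<sigma>] \<tau> by simp
          then show "0 \<le> R \<sigma> / \<tau>" "0 < norm (y - x)" using True by linarith+
        qed (use True in auto)
        also have "\<dots> = ?C * \<tau> ^ (n - 1) * (1 / R \<sigma> ^ (n - 1))"
          by (simp add: power_divide)
        finally have "ennreal (?C / norm (y - x) ^ (n - 1)) \<le> ennreal (?C * \<tau> ^ (n - 1) * (1 / R \<sigma> ^ (n - 1)))"
          by (rule ennreal_leI)
        also have "\<dots> = ennreal (?C * \<tau> ^ (n - 1)) * ennreal (1 / R \<sigma> ^ (n - 1))"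
          using \<tau> R[of \<sigma>] by (intro ennreal_mult) auto
        finally show ?thesis using True by simp
      qed auto
    qed simp
    also have "\<dots> = ennreal (?C * \<tau> ^ (n - 1)) * (indicator (hcube c r) y * layer_weight (n - 1) R (G y))"
      unfolding layer_weight_def by (subst nn_integral_cmult) (auto simp: mult_ac)
    finally show "(\<integral>\<^sup>+s. H y * (indicator {0<..1} s * ennreal (norm (y - x) / s * hbump x c r s y)) \<partial>lborel)
        \<le> ennreal ((2 * n) ^ n / n * \<tau> ^ (n - 1)) * (indicator (hcube c r) y * layer_weight (n - 1) R (G y))"
      by simp
  qed
  also have "\<dots> = ennreal ((2 * n) ^ n / n * \<tau> ^ (n - 1)) * (\<integral>\<^sup>+y. indicator (hcube c r) y * layer_weight (n - 1) R (G y) \<partial>lborel)"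
    unfolding layer_weight_def ind hcube_def by (rule nn_integral_cmult) measurable
  finally have near: "(\<integral>\<^sup>+s. indicator {0<..1} s * (\<integral>\<^sup>+z. H (x + s *\<^sub>R ?q z) * ennreal (norm (?q z)) * ennreal (bumpN z) \<partial>lborel) \<partial>lborel)
     \<le> ennreal ((2 * n) ^ n / n * \<tau> ^ (n - 1)) * (\<integral>\<^sup>+y. indicator (hcube c r) y * layer_weight (n - 1) R (G y) \<partial>lborel)" .
  have "(\<integral>\<^sup>+s. indicator {0<..1} s * (\<integral>\<^sup>+z. ennreal (G (x + s *\<^sub>R ?q z) * norm (?q z) * bumpN z) \<partial>lborel) \<partial>lborel)
    \<le> (\<integral>\<^sup>+s. indicator {0<..1} s * (\<integral>\<^sup>+z. H (x + s *\<^sub>R ?q z) * ennreal (norm (?q z)) * ennreal (bumpN z) \<partial>lborel)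
       + (\<integral>\<^sup>+z. \<integral>\<^sup>+\<sigma>. T s z \<sigma> \<partial>lborel \<partial>lborel) \<partial>lborel)"
    by (intro nn_integral_mono split)
  also have "\<dots> = (\<integral>\<^sup>+s. indicator {0<..1} s * (\<integral>\<^sup>+z. H (x + s *\<^sub>R ?q z) * ennreal (norm (?q z)) * ennreal (bumpN z) \<partial>lborel) \<partial>lborel)
       + (\<integral>\<^sup>+s. \<integral>\<^sup>+z. \<integral>\<^sup>+\<sigma>. T s z \<sigma> \<partial>lborel \<partial>lborel \<partial>lborel)"
    unfolding T_def by (rule nn_integral_add) measurable
  also have "\<dots> \<le> ennreal ((2 * n) ^ n / n * \<tau> ^ (n - 1)) * (\<integral>\<^sup>+y. indicator (hcube c r) y * layer_weight (n - 1) R (G y) \<partial>lborel)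
      + ennreal (bump_mass TYPE('n) * M / \<tau>)"
    by (rule add_mono[OF near far])
  finally show ?thesis by (simp only: of_nat_power of_nat_mult of_nat_numeral)
qed

lemma layer_weight_mono: "a \<le> b \<Longrightarrow> layer_weight m R a \<le> layer_weight m R b"
  unfolding layer_weight_def
  by (intro nn_integral_mono) (auto simp: indicator_def)

lemma layer_weight_measurable [measurable]:
  assumes [measurable]: "R \<in> borel_measurable borel"
  shows "layer_weight m R \<in> borel_measurable borel"
proof -
  have ind: "indicator {0<..<a} \<sigma> = (if 0 < \<sigma> \<and> \<sigma> < a then 1 else 0 :: ennreal)" for a \<sigma> :: real
    by (simp add: indicator_def)
  show ?thesis
    unfolding layer_weight_def[abs_def] ind by measurable
qed

text \<open>The exponential lower bound on \<open>R\<close> makes the weight finite everywhere and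
  small near 0; the latter is what differentiability uses when \<open>b\<close> is close to the
  gradient.\<close>

lemma layer_weight_le:
  assumes R: "\<And>\<sigma>. exp (- \<sigma>) \<le> R \<sigma>" and a: "0 \<le> a"
  shows "layer_weight m R a \<le> ennreal (a * exp a ^ m)"
proof -
  have "layer_weight m R a \<le> (\<integral>\<^sup>+\<sigma>. ennreal (exp a ^ m) * indicator {0<..<a} \<sigma> \<partial>lborel)"
    unfolding layer_weight_def
  proof (rule nn_integral_mono)
    fix \<sigma> :: real
    show "indicator {0<..<a} \<sigma> * ennreal (1 / R \<sigma> ^ m) \<le> ennreal (exp a ^ m) * indicator {0<..<a} \<sigma>"
    proof (cases "\<sigma> \<in> {0<..<a}")
      case True
      then have "exp (- a) \<le> exp (- \<sigma>)" by simp
      then have "exp (- a) \<le> R \<sigma>" using R[of \<sigma>] by linarith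
      then have "exp (- a) ^ m \<le> R \<sigma> ^ m" by (intro power_mono) auto
      then have "1 / R \<sigma> ^ m \<le> 1 / exp (- a) ^ m"
      proof (rule divide_left_mono)
        have "R \<sigma> > 0" using R[of \<sigma>] exp_gt_zero[of "- \<sigma>"] by linarith
        then show "0 < R \<sigma> ^ m * exp (- a) ^ m" by simp
      qed simp
      also have "\<dots> = exp a ^ m" by (simp add: exp_minus power_inverse field_simps)
      finally show ?thesis using True by (simp add: ennreal_leI)
    qed simp
  qed
  also have "\<dots> = ennreal (exp a ^ m) * ennreal a"
    using a by (subst nn_integral_cmult_indicator) auto
  also have "\<dots> = ennreal (a * exp a ^ m)"
    using a by (subst ennreal_mult[symmetric]) (auto simp: mult.commute)
  finally show ?thesis .
qed

text \<open>A substitute for subadditivity: the difference is at most twice the larger of the two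
  absolute values. This is the origin of the factor 2 in the argument of the weight in the
  integrability statements.\<close>

lemma layer_weight_diff_le:
  assumes R: "\<And>\<sigma>. exp (- \<sigma>) \<le> R \<sigma>"
  shows "layer_weight m R \<bar>p - q\<bar> \<le> layer_weight m R (2 * \<bar>p\<bar>) + ennreal (2 * \<bar>q\<bar> * exp (2 * \<bar>q\<bar>) ^ m)"
proof (cases "\<bar>q\<bar> \<le> \<bar>p\<bar>")
  case True
  then have "layer_weight m R \<bar>p - q\<bar> \<le> layer_weight m R (2 * \<bar>p\<bar>)"
    by (intro layer_weight_mono) linarith
  then show ?thesis by (rule order_trans) simp
next
  case False
  then have "layer_weight m R \<bar>p - q\<bar> \<le> layer_weight m R (2 * \<bar>q\<bar>)"
    by (intro layer_weight_mono) linarith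
  also have "\<dots> \<le> ennreal (2 * \<bar>q\<bar> * exp (2 * \<bar>q\<bar>) ^ m)"
    by (rule layer_weight_le[OF R]) simp
  finally show ?thesis by (rule order_trans) simp
qed

text \<open>The first summand comes from the part outside the cut, the second from the part inside,
  and both contain a factor 2 from comparing two points with the same constant \<open>a\<close>.
  Their sum serves as a common bound.\<close>

definition osc_const :: "'n::finite itself \<Rightarrow> real" where
  "osc_const _ = 2 * ((2 * real CARD('n)) ^ CARD('n) / CARD('n)) / bump_mass TYPE('n) + 2 * CARD('n)"

lemma osc_const_pos: "osc_const TYPE('n::finite) > 0"
  unfolding osc_const_def using bump_mass_pos[where 'n = 'n] by (intro add_nonneg_pos) auto

text \<open>The constant \<open>a\<close> of the representation depends on the cube only, so the
  deviations at \<open>x\<close> and \<open>y\<close> can be added. The components of the gradient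
  are handled one at a time.\<close>

lemma (in weak_gradient) oscillation_bound:
  defines "n \<equiv> CARD('n)"
  assumes Rm [measurable]: "R \<in> borel_measurable borel" and R: "\<And>\<sigma>. 0 < R \<sigma>"
    and M: "(\<integral>\<^sup>+\<sigma>. indicator {0<..} \<sigma> * ennreal (R \<sigma>) \<partial>lborel) \<le> ennreal M" "0 \<le> M"
    and r: "r > 0" and \<tau>: "\<tau> > 0" and \<Omega>: "hcube c r \<subseteq> \<Omega>" and xy: "x \<in> hcube c r" "y \<in> hcube c r"
    and T: "(\<integral>\<^sup>+z. indicator (hcube c r) z * (\<Sum>l\<in>UNIV. layer_weight (n - 1) R \<bar>g l z - b $ l\<bar>) \<partial>lborel) \<le> ennreal T" "0 \<le> T"
  shows "\<bar>(u x - b \<bullet> x) - (u y - b \<bullet> y)\<bar> \<le> osc_const TYPE('n) * (\<tau> ^ (n - 1) * T + M / \<tau>)"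
proof -
  let ?m = "bump_mass TYPE('n)"
  let ?C = "(2 * real n) ^ n / n"
  have m: "?m > 0" by (rule bump_mass_pos)
  have n: "n > 0" by (simp add: n_def)
  have hc [measurable]: "hcube c r \<in> sets borel" by (simp add: hcube_def)
  obtain a where a: "\<And>x. x \<in> hcube c r \<Longrightarrow> ennreal (?m * \<bar>u x - b \<bullet> x - a\<bar>) \<le>
    (\<integral>\<^sup>+s. indicator {0<..1} s * (\<Sum>l\<in>UNIV. \<integral>\<^sup>+z. ennreal (\<bar>g l (x + s *\<^sub>R (c - x + r *\<^sub>R z)) - b $ l\<bar> *
        \<bar>(c - x + r *\<^sub>R z) $ l\<bar> * bumpN z) \<partial>lborel) \<partial>lborel)"
    by (rule representation_bound[OF r \<Omega>, of b]) (rule that)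
  have dev: "\<bar>u x - b \<bullet> x - a\<bar> \<le> (?C * \<tau> ^ (n - 1) * T + n * (?m * M / \<tau>)) / ?m" if x: "x \<in> hcube c r" for x
  proof -
    let ?q = "\<lambda>z. c - x + r *\<^sub>R z"
    let ?I = "\<lambda>l. \<integral>\<^sup>+s. indicator {0<..1} s * (\<integral>\<^sup>+z. ennreal (\<bar>g l (x + s *\<^sub>R ?q z) - b $ l\<bar> * norm (?q z) * bumpN z) \<partial>lborel) \<partial>lborel"
    let ?W = "\<lambda>l. \<integral>\<^sup>+z. indicator (hcube c r) z * layer_weight (n - 1) R \<bar>g l z - b $ l\<bar> \<partial>lborel"
    have "ennreal (?m * \<bar>u x - b \<bullet> x - a\<bar>) \<le>
      (\<integral>\<^sup>+s. indicator {0<..1} s * (\<Sum>l\<in>UNIV. \<integral>\<^sup>+z. ennreal (\<bar>g l (x + s *\<^sub>R ?q z) - b $ l\<bar> *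
        \<bar>(?q z) $ l\<bar> * bumpN z) \<partial>lborel) \<partial>lborel)"
      by (rule a[OF x])
    also have "\<dots> \<le> (\<integral>\<^sup>+s. (\<Sum>l\<in>UNIV. indicator {0<..1} s * (\<integral>\<^sup>+z. ennreal (\<bar>g l (x + s *\<^sub>R ?q z) - b $ l\<bar> *
        norm (?q z) * bumpN z) \<partial>lborel)) \<partial>lborel)"
      unfolding sum_distrib_left[symmetric]
      by (intro nn_integral_mono mult_left_mono sum_mono ennreal_leI mult_right_mono bumpN_nonneg component_le_norm_cart) simp_all
    also have "\<dots> = (\<Sum>l\<in>UNIV. ?I l)"
      by (rule nn_integral_sum) measurable
    also have "\<dots> \<le> (\<Sum>l\<in>UNIV. ennreal (?C * \<tau> ^ (n - 1)) * ?W l + ennreal (?m * M / \<tau>))"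
    proof (rule sum_mono)
      fix l :: 'n
      have gm: "(\<lambda>y. \<bar>g l y - b $ l\<bar>) \<in> borel_measurable borel" by measurable
      show "?I l \<le> ennreal (?C * \<tau> ^ (n - 1)) * ?W l + ennreal (?m * M / \<tau>)"
        using riesz_potential_split[OF gm Rm abs_ge_zero R r \<tau> x M] unfolding n_def by simp
    qed
    also have "\<dots> = ennreal (?C * \<tau> ^ (n - 1)) * (\<Sum>l\<in>UNIV. ?W l) + of_nat n * ennreal (?m * M / \<tau>)"
      by (simp add: sum.distrib sum_distrib_left n_def)
    also have "(\<Sum>l\<in>UNIV. ?W l) = (\<integral>\<^sup>+z. indicator (hcube c r) z * (\<Sum>l\<in>UNIV. layer_weight (n - 1) R \<bar>g l z - b $ l\<bar>) \<partial>lborel)"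
      unfolding sum_distrib_left by (rule nn_integral_sum[symmetric]) measurable
    also have "ennreal (?C * \<tau> ^ (n - 1)) * \<dots> + of_nat n * ennreal (?m * M / \<tau>) \<le>
        ennreal (?C * \<tau> ^ (n - 1)) * ennreal T + of_nat n * ennreal (?m * M / \<tau>)"
      by (intro add_right_mono mult_left_mono T) simp
    also have "\<dots> = ennreal (?C * \<tau> ^ (n - 1) * T + n * (?m * M / \<tau>))"
    proof -
      have 1: "0 \<le> ?C * \<tau> ^ (n - 1)" using \<tau> by simp
      have 2: "0 \<le> ?m * M / \<tau>" using \<tau> m M by simp
      have "of_nat n * ennreal (?m * M / \<tau>) = ennreal (n * (?m * M / \<tau>))"
        by (simp only: ennreal_of_nat_eq_real_of_nat ennreal_mult[OF of_nat_0_le_iff 2])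
      moreover have "ennreal (?C * \<tau> ^ (n - 1)) * ennreal T = ennreal (?C * \<tau> ^ (n - 1) * T)"
        by (rule ennreal_mult[OF 1 T(2), symmetric])
      ultimately show ?thesis
        using mult_nonneg_nonneg[OF 1 T(2)] mult_nonneg_nonneg[OF of_nat_0_le_iff[of n] 2] by (simp only: ennreal_plus)
    qed
    finally have "?m * \<bar>u x - b \<bullet> x - a\<bar> \<le> ?C * \<tau> ^ (n - 1) * T + n * (?m * M / \<tau>)"
      by (subst (asm) ennreal_le_iff) (use \<tau> m M T in auto)
    then show ?thesis
      using m by (simp add: pos_le_divide_eq mult.commute)
  qed
  have "\<bar>(u x - b \<bullet> x) - (u y - b \<bullet> y)\<bar> \<le> 2 * ((?C * \<tau> ^ (n - 1) * T + n * (?m * M / \<tau>)) / ?m)"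
    using dev[OF xy(1)] dev[OF xy(2)] by linarith
  also have "\<dots> = 2 * ?C / ?m * (\<tau> ^ (n - 1) * T) + 2 * n * (M / \<tau>)"
    using m by (simp add: add_divide_distrib)
  also have "\<dots> \<le> osc_const TYPE('n) * (\<tau> ^ (n - 1) * T) + osc_const TYPE('n) * (M / \<tau>)"
    using m \<tau> M T by (intro add_mono mult_right_mono) (auto simp: osc_const_def n_def)
  finally show ?thesis by (simp add: distrib_left)
qed

text \<open>The choice \<open>\<tau> ^ n = M / T\<close> makes the two terms of the preceding bound
  equal, and their common value is a constant times the \<open>n\<close>-th root of
  \<open>T\<close>.\<close>

theorem (in weak_gradient) oscillation_root:
  defines "n \<equiv> CARD('n)"
  assumes Rm [measurable]: "R \<in> borel_measurable borel" and R: "\<And>\<sigma>. 0 < R \<sigma>"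
    and M: "(\<integral>\<^sup>+\<sigma>. indicator {0<..} \<sigma> * ennreal (R \<sigma>) \<partial>lborel) \<le> ennreal M" "0 < M"
    and r: "r > 0" and \<Omega>: "hcube c r \<subseteq> \<Omega>" and xy: "x \<in> hcube c r" "y \<in> hcube c r"
    and T: "(\<integral>\<^sup>+z. indicator (hcube c r) z * (\<Sum>l\<in>UNIV. layer_weight (n - 1) R \<bar>g l z - b $ l\<bar>) \<partial>lborel) \<le> ennreal T" "0 < T"
  shows "\<bar>(u x - b \<bullet> x) - (u y - b \<bullet> y)\<bar> \<le> 2 * osc_const TYPE('n) * root n (M ^ (n - 1)) * root n T"
proof -
  have n: "n > 0" by (simp add: n_def)
  define \<tau> where "\<tau> = root n (M / T)"
  have \<tau>: "\<tau> > 0" using n M T by (simp add: \<tau>_def)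
  have \<tau>n: "\<tau> ^ n = M / T" using n M T by (simp add: \<tau>_def)
  have "M / \<tau> = \<tau> ^ (n - 1) * T"
    using \<tau>n \<tau> T n power_Suc[of \<tau> "n - 1"] by (simp add: field_simps)
  moreover have "\<tau> ^ (n - 1) * T = root n (M ^ (n - 1)) * root n T"
  proof (rule power_eq_imp_eq_base[of _ n])
    have "(\<tau> ^ (n - 1) * T) ^ n = (\<tau> ^ n) ^ (n - 1) * T ^ n"
      by (simp add: power_mult_distrib power_mult[symmetric] mult.commute)
    also have "\<dots> = M ^ (n - 1) * T"
      using T n power_Suc[of T "n - 1"] by (simp add: \<tau>n power_divide)
    finally show "(\<tau> ^ (n - 1) * T) ^ n = (root n (M ^ (n - 1)) * root n T) ^ n"
      using n M T by (simp add: power_mult_distrib)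
  qed (use n M T \<tau> in auto)
  ultimately have "\<tau> ^ (n - 1) * T + M / \<tau> = 2 * (root n (M ^ (n - 1)) * root n T)"
    by simp
  moreover have "\<bar>(u x - b \<bullet> x) - (u y - b \<bullet> y)\<bar> \<le> osc_const TYPE('n) * (\<tau> ^ (n - 1) * T + M / \<tau>)"
    using oscillation_bound[OF Rm R M(1) less_imp_le[OF M(2)] r \<tau> \<Omega> xy T(1)[unfolded n_def] less_imp_le[OF T(2)]]
    unfolding n_def .
  ultimately show ?thesis by (simp add: mult.assoc mult.left_commute)
qed

lemma nn_integral_exp_minus: "(\<integral>\<^sup>+\<sigma>. indicator {0<..} \<sigma> * ennreal (exp (- \<sigma>)) \<partial>lborel) \<le> ennreal 1"
proof -
  have "(\<integral>\<^sup>+\<sigma>. indicator {0<..} \<sigma> * ennreal (exp (- \<sigma>)) \<partial>lborel) \<le> (\<integral>\<^sup>+\<sigma>. ennreal (exp (- \<sigma>)) * indicator {0..} \<sigma> \<partial>lborel)"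
    by (intro nn_integral_mono) (auto simp: indicator_def)
  also have "\<dots> = ennreal (0 - (- exp (- 0)))"
  proof (rule nn_integral_FTC_atLeast[where F = "\<lambda>x. - exp (- x)"])
    show "((\<lambda>x. - exp (- x)) has_real_derivative exp (- x)) (at x)" for x :: real
      by (auto intro!: derivative_eq_intros)
    have "((\<lambda>x::real. exp (- x)) \<longlongrightarrow> 0) at_top"
      by (rule filterlim_compose[OF exp_at_bot filterlim_uminus_at_bot_at_top])
    from tendsto_minus[OF this] show "((\<lambda>x::real. - exp (- x)) \<longlongrightarrow> 0) at_top" by simp
  qed (auto intro!: borel_measurable_exp)
  finally show ?thesis by simp
qed

section \<open>The weight supplied by the Lorentz condition\<close>

text \<open>For \<open>R \<sigma>\<close> at least \<open>\<lambda>(\<sigma> / 2)\<close> to the power \<open>1 / N\<close>, with \<open>\<lambda>\<close> the distribution function of \<open>G\<close>,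
  the quotient of \<open>\<lambda>(\<sigma> / 2)\<close> by \<open>R \<sigma>\<close> to the power \<open>N - 1\<close> is at most \<open>R \<sigma>\<close>. The summand \<open>exp (- \<sigma>)\<close> keeps
  \<open>R\<close> positive.\<close>

lemma lorentz_weight:
  fixes G :: "'p \<Rightarrow> real^'n \<Rightarrow> real"
  defines "n \<equiv> CARD('n)"
  assumes P: "finite P" and Gm: "\<And>p. p \<in> P \<Longrightarrow> G p \<in> borel_measurable borel"
    and \<Omega>: "\<Omega> \<in> sets borel" "emeasure lborel \<Omega> < \<infinity>"
    and lor: "\<And>p. p \<in> P \<Longrightarrow> (\<integral>\<^sup>+s. indicator {0<..} s *
       ennreal (measure lborel {x\<in>\<Omega>. s \<le> \<bar>G p x\<bar>} powr (1 / n)) \<partial>lborel) < \<infinity>"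
  obtains R M where "R \<in> borel_measurable borel" "\<And>\<sigma>. exp (- \<sigma>) \<le> R \<sigma>" "0 < M"
    "(\<integral>\<^sup>+\<sigma>. indicator {0<..} \<sigma> * ennreal (R \<sigma>) \<partial>lborel) \<le> ennreal M"
    "\<And>p. p \<in> P \<Longrightarrow> (\<integral>\<^sup>+y. indicator \<Omega> y * layer_weight (n - 1) R (2 * \<bar>G p y\<bar>) \<partial>lborel) \<le> ennreal M"
proof -
  have n: "n > 0" by (simp add: n_def)
  note [measurable] = \<Omega>(1)
  define lam where "lam p s = measure lborel {x\<in>\<Omega>. s \<le> \<bar>G p x\<bar>}" for p s
  have sets: "{x\<in>\<Omega>. s \<le> \<bar>G p x\<bar>} \<in> sets borel" if "p \<in> P" for p s
  proof -
    note [measurable] = Gm[OF that]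
    have "{x\<in>\<Omega>. s \<le> \<bar>G p x\<bar>} = \<Omega> \<inter> {x. s \<le> \<bar>G p x\<bar>}" by auto
    then show ?thesis by simp
  qed
  have fin: "emeasure lborel A < \<infinity>" if "A \<subseteq> \<Omega>" for A
    using emeasure_mono[OF that, of lborel] \<Omega> by (auto intro: le_less_trans)
  have em: "emeasure lborel {x\<in>\<Omega>. s \<le> \<bar>G p x\<bar>} = ennreal (lam p s)" for p s
    unfolding lam_def by (rule emeasure_eq_ennreal_measure) (use fin[of "{x\<in>\<Omega>. s \<le> \<bar>G p x\<bar>}"] in auto)
  have anti: "lam p t \<le> lam p s" if "s \<le> t" "p \<in> P" for p s t
  proof -
    have "ennreal (lam p t) \<le> ennreal (lam p s)"
      unfolding em[symmetric] using that sets by (intro emeasure_mono) auto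
    then show ?thesis by (simp add: lam_def)
  qed
  have lam_m: "lam p \<in> borel_measurable borel" if "p \<in> P" for p
  proof -
    have "(\<lambda>s. - lam p s) \<in> borel_measurable borel"
      by (rule borel_measurable_mono) (auto simp: mono_def anti that)
    from borel_measurable_uminus[OF this] show ?thesis by simp
  qed
  \<comment> \<open>The argument \<open>\<sigma> / 2\<close> matches the weight at
    \<open>2 * \<bar>G p y\<bar>\<close>: a level \<sigma> below this number means that
    \<open>\<bar>G p y\<bar>\<close> exceeds \<open>\<sigma> / 2\<close>. Summing over
    \<open>P\<close> gives one function for all members.\<close>
  define R where "R \<sigma> = (\<Sum>p\<in>P. lam p (\<sigma> / 2) powr (1 / n)) + exp (- \<sigma>)" for \<sigma>
  have lam_m2 [measurable]: "(\<lambda>\<sigma>. lam p (\<sigma> / 2) powr (1 / n)) \<in> borel_measurable borel" if "p \<in> P" for p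
    using measurable_compose[OF _ lam_m[OF that], of "\<lambda>\<sigma>. \<sigma> / 2" borel] by simp
  have Rm: "R \<in> borel_measurable borel"
    unfolding R_def[abs_def] by (intro borel_measurable_add borel_measurable_sum lam_m2) auto
  have Re: "exp (- \<sigma>) \<le> R \<sigma>" for \<sigma>
    unfolding R_def by (simp add: sum_nonneg)
  have R0: "R \<sigma> > 0" for \<sigma> using Re[of \<sigma>] exp_gt_zero[of "- \<sigma>"] by linarith
  have lam_R: "lam p (\<sigma> / 2) \<le> R \<sigma> ^ n" if p: "p \<in> P" for p \<sigma>
  proof -
    have "lam p (\<sigma> / 2) powr (1 / n) \<le> (\<Sum>p\<in>P. lam p (\<sigma> / 2) powr (1 / n))"
      using p P by (intro member_le_sum) auto
    also have "\<dots> \<le> R \<sigma>" by (simp add: R_def)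
    finally have "(lam p (\<sigma> / 2) powr (1 / n)) ^ n \<le> R \<sigma> ^ n"
      by (intro power_mono) auto
    moreover have "(lam p (\<sigma> / 2) powr (1 / n)) ^ n = lam p (\<sigma> / 2)"
    proof (cases "lam p (\<sigma> / 2) = 0")
      case False
      then have "lam p (\<sigma> / 2) > 0" by (simp add: lam_def less_le)
      then show ?thesis using n by (simp add: powr_realpow[symmetric] powr_powr)
    qed (use n in simp)
    ultimately show ?thesis by simp
  qed
  let ?J = "\<integral>\<^sup>+\<sigma>. indicator {0<..} \<sigma> * ennreal (R \<sigma>) \<partial>lborel"
  have part_m: "(\<lambda>\<sigma>. indicator {0<..} \<sigma> * ennreal (lam p (\<sigma> / 2) powr (1 / n))) \<in> borel_measurable lborel" if "p \<in> P" for p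
    using lam_m2[OF that] by measurable
  have part: "(\<integral>\<^sup>+\<sigma>. indicator {0<..} \<sigma> * ennreal (lam p (\<sigma> / 2) powr (1 / n)) \<partial>lborel) < \<infinity>" if p: "p \<in> P" for p
  proof -
    let ?f = "\<lambda>s. indicator {0<..} s * ennreal (lam p s powr (1 / n))"
    have fm: "?f \<in> borel_measurable borel" using lam_m[OF p] by measurable
    have "(\<integral>\<^sup>+s. ?f s \<partial>lborel) = ennreal (1 / 2) * (\<integral>\<^sup>+\<sigma>. ?f (0 + 1 / 2 * \<sigma>) \<partial>lborel)"
      using nn_integral_real_affine[OF fm, of "1 / 2" 0] by simp
    then have "ennreal (1 / 2) * (\<integral>\<^sup>+\<sigma>. ?f (0 + 1 / 2 * \<sigma>) \<partial>lborel) < \<infinity>"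
      using lor[OF p] unfolding lam_def by simp
    then have "(\<integral>\<^sup>+\<sigma>. ?f (0 + 1 / 2 * \<sigma>) \<partial>lborel) < \<infinity>"
      by (auto simp: ennreal_mult_less_top)
    also have "(\<integral>\<^sup>+\<sigma>. ?f (0 + 1 / 2 * \<sigma>) \<partial>lborel) = (\<integral>\<^sup>+\<sigma>. indicator {0<..} \<sigma> * ennreal (lam p (\<sigma> / 2) powr (1 / n)) \<partial>lborel)"
      by (intro nn_integral_cong) (auto simp: indicator_def)
    finally show ?thesis .
  qed
  have "?J = (\<integral>\<^sup>+\<sigma>. (\<Sum>p\<in>P. indicator {0<..} \<sigma> * ennreal (lam p (\<sigma> / 2) powr (1 / n))) + indicator {0<..} \<sigma> * ennreal (exp (- \<sigma>)) \<partial>lborel)"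
  proof (rule nn_integral_cong)
    fix \<sigma> :: real
    let ?S = "\<Sum>p\<in>P. lam p (\<sigma> / 2) powr (1 / n)"
    have 1: "ennreal (R \<sigma>) = ennreal ?S + ennreal (exp (- \<sigma>))"
      unfolding R_def by (rule ennreal_plus) (simp_all add: sum_nonneg)
    have 2: "ennreal ?S = (\<Sum>p\<in>P. ennreal (lam p (\<sigma> / 2) powr (1 / n)))"
      by (rule sum_ennreal[symmetric]) simp
    show "indicator {0<..} \<sigma> * ennreal (R \<sigma>) =
        (\<Sum>p\<in>P. indicator {0<..} \<sigma> * ennreal (lam p (\<sigma> / 2) powr (1 / n))) + indicator {0<..} \<sigma> * ennreal (exp (- \<sigma>))"
      unfolding 1 2 by (simp only: distrib_left sum_distrib_left)
  qed
  also have "\<dots> = (\<integral>\<^sup>+\<sigma>. (\<Sum>p\<in>P. indicator {0<..} \<sigma> * ennreal (lam p (\<sigma> / 2) powr (1 / n))) \<partial>lborel)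
      + (\<integral>\<^sup>+\<sigma>. indicator {0<..} \<sigma> * ennreal (exp (- \<sigma>)) \<partial>lborel)"
    by (rule nn_integral_add) (auto intro!: borel_measurable_sum part_m)
  also have "(\<integral>\<^sup>+\<sigma>. (\<Sum>p\<in>P. indicator {0<..} \<sigma> * ennreal (lam p (\<sigma> / 2) powr (1 / n))) \<partial>lborel)
      = (\<Sum>p\<in>P. \<integral>\<^sup>+\<sigma>. indicator {0<..} \<sigma> * ennreal (lam p (\<sigma> / 2) powr (1 / n)) \<partial>lborel)"
    by (rule nn_integral_sum) (rule part_m)
  also have "\<dots> + (\<integral>\<^sup>+\<sigma>. indicator {0<..} \<sigma> * ennreal (exp (- \<sigma>)) \<partial>lborel) < \<infinity>"
    using part le_less_trans[OF nn_integral_exp_minus] by (auto simp: P)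
  finally have J: "?J < \<infinity>" .
  \<comment> \<open>The integral \<open>?J\<close> of \<open>R\<close> also bounds the integral of
    the weight, so one constant serves both conclusions; the summand 1 makes it visibly
    positive.\<close>
  define M where "M = enn2real ?J + 1"
  have M: "0 < M" "?J \<le> ennreal M"
  proof -
    show "0 < M" by (simp add: M_def add_nonneg_pos)
    have "?J = ennreal (enn2real ?J)" using J by (simp add: ennreal_enn2real)
    also have "\<dots> \<le> ennreal M" by (rule ennreal_leI) (simp add: M_def)
    finally show "?J \<le> ennreal M" .
  qed
  have "(\<integral>\<^sup>+y. indicator \<Omega> y * layer_weight (n - 1) R (2 * \<bar>G p y\<bar>) \<partial>lborel) \<le> ?J" if p: "p \<in> P" for p
  proof -
    note [measurable] = Gm[OF p] Rm
    have ind: "indicator {0<..<a} \<sigma> = (if 0 < \<sigma> \<and> \<sigma> < a then 1 else 0 :: ennreal)" for a \<sigma> :: real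
      by (simp add: indicator_def)
    have "(\<integral>\<^sup>+y. indicator \<Omega> y * layer_weight (n - 1) R (2 * \<bar>G p y\<bar>) \<partial>lborel)
      = (\<integral>\<^sup>+y. \<integral>\<^sup>+\<sigma>. indicator \<Omega> y * ((if 0 < \<sigma> \<and> \<sigma> < 2 * \<bar>G p y\<bar> then 1 else 0) * ennreal (1 / R \<sigma> ^ (n - 1))) \<partial>lborel \<partial>lborel)"
      unfolding layer_weight_def ind by (intro nn_integral_cong nn_integral_cmult[symmetric]) measurable
    also have "\<dots> = (\<integral>\<^sup>+\<sigma>. \<integral>\<^sup>+y. indicator \<Omega> y * ((if 0 < \<sigma> \<and> \<sigma> < 2 * \<bar>G p y\<bar> then 1 else 0) * ennreal (1 / R \<sigma> ^ (n - 1))) \<partial>lborel \<partial>lborel)"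
      by (rule lborel_pair.Fubini') measurable
    also have "\<dots> \<le> (\<integral>\<^sup>+\<sigma>. indicator {0<..} \<sigma> * ennreal (R \<sigma>) \<partial>lborel)"
    proof (rule nn_integral_mono)
      fix \<sigma> :: real
      show "(\<integral>\<^sup>+y. indicator \<Omega> y * ((if 0 < \<sigma> \<and> \<sigma> < 2 * \<bar>G p y\<bar> then 1 else 0) * ennreal (1 / R \<sigma> ^ (n - 1))) \<partial>lborel)
          \<le> indicator {0<..} \<sigma> * ennreal (R \<sigma>)"
      proof (cases "\<sigma> > 0")
        case True
        have "(\<integral>\<^sup>+y. indicator \<Omega> y * ((if 0 < \<sigma> \<and> \<sigma> < 2 * \<bar>G p y\<bar> then 1 else 0) * ennreal (1 / R \<sigma> ^ (n - 1))) \<partial>lborel)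
            \<le> (\<integral>\<^sup>+y. ennreal (1 / R \<sigma> ^ (n - 1)) * indicator {x\<in>\<Omega>. \<sigma> / 2 \<le> \<bar>G p x\<bar>} y \<partial>lborel)"
          by (intro nn_integral_mono) (auto simp: indicator_def)
        also have "\<dots> = ennreal (1 / R \<sigma> ^ (n - 1)) * ennreal (lam p (\<sigma> / 2))"
          unfolding em[symmetric] by (rule nn_integral_cmult_indicator) (simp only: sets_lborel sets[OF p])
        also have "\<dots> \<le> ennreal (1 / R \<sigma> ^ (n - 1)) * ennreal (R \<sigma> ^ n)"
          by (intro mult_left_mono ennreal_leI lam_R p) simp
        also have "\<dots> = ennreal (1 / R \<sigma> ^ (n - 1) * R \<sigma> ^ n)"
          using R0[of \<sigma>] by (intro ennreal_mult[symmetric]) auto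
        also have "1 / R \<sigma> ^ (n - 1) * R \<sigma> ^ n = R \<sigma>"
          using R0[of \<sigma>] n power_Suc[of "R \<sigma>" "n - 1"] by simp
        finally show ?thesis using True by simp
      qed simp
    qed
    finally show ?thesis .
  qed
  then have "(\<integral>\<^sup>+y. indicator \<Omega> y * layer_weight (n - 1) R (2 * \<bar>G p y\<bar>) \<partial>lborel) \<le> ennreal M" if "p \<in> P" for p
    using order_trans[OF _ M(2)] that by simp
  then show thesis using that[OF Rm Re M] by simp
qed

section \<open>Differentiability almost everywhere and Lusin's condition\<close>

lemma hcube_borel [measurable]: "hcube c r \<in> sets borel"
  by (simp add: hcube_def)

lemma emeasure_hcube:
  fixes c :: "real^'n"
  assumes "r \<ge> 0"
  shows "emeasure lborel (hcube c r) = ennreal ((2 * r) ^ CARD('n))"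
proof -
  have "c \<in> hcube c r" using assms by (simp add: mem_hcube)
  then have ne: "hcube c r \<noteq> {}" by blast
  have "measure lborel (hcube c r) = (\<Prod>i\<in>(UNIV :: 'n set). 2 * r)"
    using ne unfolding hcube_def by (subst content_cbox_cart) auto
  then have "measure lborel (hcube c r) = (2 * r) ^ CARD('n)" by simp
  moreover have "emeasure lborel (hcube c r) = ennreal (measure lborel (hcube c r))"
    by (rule emeasure_eq_ennreal_measure) (simp add: hcube_def emeasure_lborel_cbox_eq)
  ultimately show ?thesis by simp
qed

lemma cball_subset_hcube: "cball c r \<subseteq> hcube c r"
proof
  fix y assume "y \<in> cball c r"
  then have "norm (y - c) \<le> r" by (simp add: dist_norm norm_minus_commute)
  then have "\<bar>(y - c) $ i\<bar> \<le> r" for i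
    using component_le_norm_cart[of "y - c" i] by linarith
  then show "y \<in> hcube c r" by (simp add: mem_hcube)
qed

lemma hcube_subset_cball:
  fixes c :: "real^'n" and r :: real
  shows "hcube c r \<subseteq> cball c (CARD('n) * r)"
proof
  fix y assume "y \<in> hcube c r"
  then have "(\<Sum>i\<in>UNIV. \<bar>(y - c) $ i\<bar>) \<le> (\<Sum>i\<in>(UNIV :: 'n set). r)"
    by (intro sum_mono) (simp add: mem_hcube)
  then have "norm (y - c) \<le> CARD('n) * r"
    using norm_le_l1_cart[of "y - c"] by simp
  then show "y \<in> cball c (CARD('n) * r)"
    by (simp add: dist_norm norm_minus_commute)
qed

text \<open>Passing from the weight at \<open>2 * \<bar>g l y\<bar>\<close> to the one at
  \<open>\<bar>g l y - b $ l\<bar>\<close> costs a constant depending on \<open>b\<close>, which is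
  integrable because \<Omega> has finite measure.\<close>

lemma (in weak_gradient) weight_integrable:
  assumes [measurable]: "R \<in> borel_measurable borel" "\<Omega> \<in> sets borel" and fin: "emeasure lborel \<Omega> < \<infinity>"
    and R: "\<And>\<sigma>. exp (- \<sigma>) \<le> R \<sigma>"
    and W: "\<And>l. (\<integral>\<^sup>+y. indicator \<Omega> y * layer_weight m R (2 * \<bar>g l y\<bar>) \<partial>lborel) \<le> ennreal M"
  shows "(\<integral>\<^sup>+y. indicator \<Omega> y * (\<Sum>l\<in>UNIV. layer_weight m R \<bar>g l y - b $ l\<bar>) \<partial>lborel) < \<infinity>"
proof -
  let ?c = "\<lambda>l. ennreal (2 * \<bar>b $ l\<bar> * exp (2 * \<bar>b $ l\<bar>) ^ m)"
  have one: "(\<integral>\<^sup>+y. indicator \<Omega> y * layer_weight m R \<bar>g l y - b $ l\<bar> \<partial>lborel) < \<infinity>" for l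
  proof -
    have "(\<integral>\<^sup>+y. indicator \<Omega> y * layer_weight m R \<bar>g l y - b $ l\<bar> \<partial>lborel) \<le>
      (\<integral>\<^sup>+y. indicator \<Omega> y * layer_weight m R (2 * \<bar>g l y\<bar>) + ?c l * indicator \<Omega> y \<partial>lborel)"
    proof (rule nn_integral_mono)
      fix y
      show "indicator \<Omega> y * layer_weight m R \<bar>g l y - b $ l\<bar> \<le>
          indicator \<Omega> y * layer_weight m R (2 * \<bar>g l y\<bar>) + ?c l * indicator \<Omega> y"
        using layer_weight_diff_le[OF R, of m "g l y" "b $ l"] by (cases "y \<in> \<Omega>") simp_all
    qed
    also have "\<dots> = (\<integral>\<^sup>+y. indicator \<Omega> y * layer_weight m R (2 * \<bar>g l y\<bar>) \<partial>lborel) + (\<integral>\<^sup>+y. ?c l * indicator \<Omega> y \<partial>lborel)"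
      by (rule nn_integral_add) measurable
    also have "(\<integral>\<^sup>+y. ?c l * indicator \<Omega> y \<partial>lborel) = ?c l * emeasure lborel \<Omega>"
      by (rule nn_integral_cmult_indicator) simp
    also have "(\<integral>\<^sup>+y. indicator \<Omega> y * layer_weight m R (2 * \<bar>g l y\<bar>) \<partial>lborel) + ?c l * emeasure lborel \<Omega> < \<infinity>"
      using le_less_trans[OF W[of l] ennreal_less_top] fin by (simp add: ennreal_mult_less_top)
    finally show ?thesis .
  qed
  have "(\<integral>\<^sup>+y. indicator \<Omega> y * (\<Sum>l\<in>UNIV. layer_weight m R \<bar>g l y - b $ l\<bar>) \<partial>lborel) =
      (\<Sum>l\<in>UNIV. \<integral>\<^sup>+y. indicator \<Omega> y * layer_weight m R \<bar>g l y - b $ l\<bar> \<partial>lborel)"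
    unfolding sum_distrib_left by (rule nn_integral_sum) measurable
  also have "\<dots> < \<infinity>" using one by simp
  finally show ?thesis .
qed

text \<open>Off a null set the averages of the weight are controlled for every \<open>b\<close> of a
  countable dense set. A \<open>b\<close> close to the gradient makes the weight at \<open>x\<close>
  small, hence also its averages on small balls, and the oscillation bound then compares
  \<open>u\<close> with the affine function of slope \<open>b\<close>.\<close>

theorem (in weak_gradient) AE_differentiable:
  defines "n \<equiv> CARD('n)"
  assumes Rm [measurable]: "R \<in> borel_measurable borel" and \<Omega>: "open \<Omega>" "emeasure lborel \<Omega> < \<infinity>"
    and R: "\<And>\<sigma>. exp (- \<sigma>) \<le> R \<sigma>"
    and M: "(\<integral>\<^sup>+\<sigma>. indicator {0<..} \<sigma> * ennreal (R \<sigma>) \<partial>lborel) \<le> ennreal M" "0 < M"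
    and W: "\<And>l. (\<integral>\<^sup>+y. indicator \<Omega> y * layer_weight (n - 1) R (2 * \<bar>g l y\<bar>) \<partial>lborel) \<le> ennreal M"
  shows "AE x in lebesgue. x \<in> \<Omega> \<longrightarrow> u differentiable (at x)"
proof -
  have n: "n > 0" by (simp add: n_def)
  have R0: "0 < R \<sigma>" for \<sigma> using R[of \<sigma>] exp_gt_zero[of "- \<sigma>"] by linarith
  have \<Omega>m [measurable]: "\<Omega> \<in> sets borel" using \<Omega> by simp
  define th where "th b y = indicator \<Omega> y * (\<Sum>l\<in>UNIV. layer_weight (n - 1) R \<bar>g l y - b $ l\<bar>)" for b y
  have th_m: "th b \<in> borel_measurable borel" for b
    unfolding th_def[abs_def] by measurable
  have th_i: "(\<integral>\<^sup>+y. th b y \<partial>lborel) < \<infinity>" for b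
    unfolding th_def by (rule weight_integrable[OF Rm \<Omega>m \<Omega>(2) R W])
  obtain B :: "(real^'n) set" where B: "countable B" "\<And>X. open X \<Longrightarrow> X \<noteq> {} \<Longrightarrow> \<exists>d\<in>B. d \<in> X"
    using countable_dense_setE by blast
  have "AE x in lebesgue. \<forall>b\<in>B. \<forall>\<beta>. th b x < ennreal \<beta> \<longrightarrow>
    (\<exists>\<delta>>0. \<forall>r. 0 < r \<and> r < \<delta> \<longrightarrow>
       emeasure (density lborel (th b)) (cball x r) \<le> ennreal \<beta> * emeasure lborel (cball x r))"
    unfolding AE_ball_countable[OF B(1)] by (intro ballI AE_eventually_ball_average_le th_m th_i)
  then show ?thesis
  proof (rule AE_mp, intro AE_I2 impI)
    fix x
    assume leb: "\<forall>b\<in>B. \<forall>\<beta>. th b x < ennreal \<beta> \<longrightarrow>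
      (\<exists>\<delta>>0. \<forall>r. 0 < r \<and> r < \<delta> \<longrightarrow>
       emeasure (density lborel (th b)) (cball x r) \<le> ennreal \<beta> * emeasure lborel (cball x r))"
      and x: "x \<in> \<Omega>"
    define \<gamma> where "\<gamma> = (\<chi> l. g l x)"
    define C where "C = 2 * osc_const TYPE('n) * root n (M ^ (n - 1))"
    have C: "C > 0" unfolding C_def using osc_const_pos[where 'n = 'n] M n by simp
    have "(u has_derivative (\<lambda>v. \<gamma> \<bullet> v)) (at x)"
      unfolding has_derivative_at_alt
    proof (intro conjI allI impI)
      show "bounded_linear (\<lambda>v. \<gamma> \<bullet> v)" by (rule bounded_linear_inner_right)
      fix e :: real assume e: "e > 0"
      \<comment> \<open>With this value, \<open>C\<close> times the root of \<open>T\<close> below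
        is exactly \<open>e / 2 * r\<close>; the other half of the error comes from replacing
        \<open>b\<close> by \<gamma>.\<close>
      define \<beta> where "\<beta> = (e / (4 * n * C)) ^ n"
      have \<beta>: "\<beta> > 0" unfolding \<beta>_def using e C n by simp
      \<comment> \<open>The three bounds keep \<open>exp \<eta>\<close> below \<open>exp 1\<close>,
        control the error of replacing \<gamma> by \<open>b\<close>, and make each of the
        \<open>n\<close> weights at most \<open>\<beta> / (2 * n)\<close>, so that their sum stays
        strictly below \<beta>.\<close>
      define \<eta> where "\<eta> = min (min 1 (e / 2)) (\<beta> / (2 * n * exp 1 ^ (n - 1)))"
      have \<eta>: "\<eta> > 0" "\<eta> \<le> 1" "\<eta> \<le> e / 2" "\<eta> \<le> \<beta> / (2 * n * exp 1 ^ (n - 1))"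
        unfolding \<eta>_def using e \<beta> n by auto
      obtain b where b: "b \<in> B" "b \<in> ball \<gamma> \<eta>"
        using B(2)[of "ball \<gamma> \<eta>"] \<eta> by auto
      have gb: "\<bar>g l x - b $ l\<bar> \<le> \<eta>" for l
        using component_le_norm_cart[of "\<gamma> - b" l] b(2) by (simp add: \<gamma>_def dist_norm)
      have "th b x \<le> (\<Sum>l\<in>(UNIV :: 'n set). ennreal (\<beta> / (2 * n)))"
        unfolding th_def using x
      proof (simp only: indicator_simps mult_1, intro sum_mono)
        fix l :: 'n
        have "layer_weight (n - 1) R \<bar>g l x - b $ l\<bar> \<le> layer_weight (n - 1) R \<eta>"
          by (rule layer_weight_mono[OF gb])
        also have "\<dots> \<le> ennreal (\<eta> * exp \<eta> ^ (n - 1))"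
          using \<eta>(1) by (intro layer_weight_le[OF R]) simp
        also have "\<dots> \<le> ennreal (\<beta> / (2 * n))"
        proof (rule ennreal_leI)
          have "\<eta> * exp \<eta> ^ (n - 1) \<le> \<beta> / (2 * n * exp 1 ^ (n - 1)) * exp 1 ^ (n - 1)"
            using \<eta> \<beta> n by (intro mult_mono power_mono) auto
          also have "\<dots> = \<beta> / (2 * n)" by simp
          finally show "\<eta> * exp \<eta> ^ (n - 1) \<le> \<beta> / (2 * n)" .
        qed
        finally show "layer_weight (n - 1) R \<bar>g l x - b $ l\<bar> \<le> ennreal (\<beta> / (2 * n))" .
      qed
      also have "\<dots> = ennreal (n * (\<beta> / (2 * n)))"
      proof -
        have "0 \<le> \<beta> / (2 * n)" using \<beta> by simp
        then show ?thesis
          by (simp only: sum_constant n_def ennreal_of_nat_eq_real_of_nat ennreal_mult[OF of_nat_0_le_iff])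
      qed
      also have "\<dots> < ennreal \<beta>"
        using \<beta> n by (intro ennreal_lessI) auto
      finally obtain \<delta> where \<delta>: "\<delta> > 0" "\<And>r. 0 < r \<Longrightarrow> r < \<delta> \<Longrightarrow>
         emeasure (density lborel (th b)) (cball x r) \<le> ennreal \<beta> * emeasure lborel (cball x r)"
        using leb b(1) by meson
      obtain \<kappa> where \<kappa>: "\<kappa> > 0" "cball x \<kappa> \<subseteq> \<Omega>" using \<Omega>(1) x open_contains_cball by blast
      have main: "norm (u y - u x - \<gamma> \<bullet> (y - x)) \<le> e * norm (y - x)" if y: "norm (y - x) < min \<delta> \<kappa> / n" for y
      proof (cases "y = x")
        case False
        define r where "r = norm (y - x)"
        have r: "r > 0" using False by (simp add: r_def)
        have nr: "n * r < \<delta>" "n * r < \<kappa>" "n * r > 0"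
          using y n r by (auto simp: r_def pos_less_divide_eq mult.commute)
        \<comment> \<open>Averages are controlled on balls, but oscillation on cubes: the ball of
          radius \<open>n * r\<close> contains the cube and lies itself in a cube of explicit
          volume.\<close>
        have sub: "hcube x r \<subseteq> cball x (n * r)" unfolding n_def by (rule hcube_subset_cball)
        have "cball x (n * r) \<subseteq> \<Omega>"
          using order_trans[OF subset_cball \<kappa>(2)] nr by simp
        then have sub\<Omega>: "hcube x r \<subseteq> \<Omega>" using sub by (rule order_trans[rotated])
        define T where "T = \<beta> * (2 * (n * r)) ^ n"
        have T: "T > 0" unfolding T_def using \<beta> nr by simp
        have "(\<integral>\<^sup>+z. indicator (hcube x r) z * (\<Sum>l\<in>UNIV. layer_weight (n - 1) R \<bar>g l z - b $ l\<bar>) \<partial>lborel)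
           \<le> (\<integral>\<^sup>+z. th b z * indicator (cball x (n * r)) z \<partial>lborel)"
        proof (rule nn_integral_mono)
          fix z
          show "indicator (hcube x r) z * (\<Sum>l\<in>UNIV. layer_weight (n - 1) R \<bar>g l z - b $ l\<bar>)
              \<le> th b z * indicator (cball x (n * r)) z"
          proof (cases "z \<in> hcube x r")
            case True
            from subsetD[OF sub\<Omega> True] subsetD[OF sub True] have "z \<in> \<Omega>" "z \<in> cball x (n * r)" .
            then show ?thesis using True by (simp add: th_def)
          qed simp
        qed
        also have "\<dots> = emeasure (density lborel (th b)) (cball x (n * r))"
          using th_m by (subst emeasure_density) auto
        also have "\<dots> \<le> ennreal \<beta> * emeasure lborel (cball x (n * r))"
          by (rule \<delta>(2)[OF nr(3,1)])
        also have "\<dots> \<le> ennreal \<beta> * emeasure lborel (hcube x (n * r))"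
          by (intro mult_left_mono emeasure_mono cball_subset_hcube) auto
        also have "\<dots> = ennreal \<beta> * ennreal ((2 * (n * r)) ^ n)"
          using nr(3) unfolding n_def by (subst emeasure_hcube) auto
        also have "\<dots> = ennreal T"
          unfolding T_def using \<beta> nr by (intro ennreal_mult[symmetric]) auto
        finally have "(\<integral>\<^sup>+z. indicator (hcube x r) z * (\<Sum>l\<in>UNIV. layer_weight (n - 1) R \<bar>g l z - b $ l\<bar>) \<partial>lborel) \<le> ennreal T" .
        moreover have "x \<in> hcube x r" using r by (simp add: mem_hcube)
        moreover have "y \<in> hcube x r"
          using component_le_norm_cart[of "y - x"] by (simp add: mem_hcube r_def)
        ultimately have "\<bar>(u x - b \<bullet> x) - (u y - b \<bullet> y)\<bar> \<le> C * root n T"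
          using oscillation_root[OF Rm R0 M r sub\<Omega> _ _ _ T, of x y b] unfolding C_def n_def by blast
        also have "C * root n T = e / 2 * r"
        proof -
          have "root n T = root n \<beta> * (2 * (n * r))"
            unfolding T_def using n nr by (simp add: real_root_mult real_root_power_cancel)
          also have "root n \<beta> = e / (4 * n * C)"
            unfolding \<beta>_def using n e C by (simp add: real_root_power_cancel)
          finally show ?thesis using n C by (simp add: field_simps)
        qed
        finally have 1: "\<bar>(u x - b \<bullet> x) - (u y - b \<bullet> y)\<bar> \<le> e / 2 * r" .
        have "\<bar>(b - \<gamma>) \<bullet> (y - x)\<bar> \<le> norm (b - \<gamma>) * r"
          unfolding r_def by (rule Cauchy_Schwarz_ineq2)
        also have "\<dots> \<le> e / 2 * r"
          using b(2) \<eta>(3) r by (intro mult_right_mono) (auto simp: dist_norm norm_minus_commute)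
        finally have 2: "\<bar>(b - \<gamma>) \<bullet> (y - x)\<bar> \<le> e / 2 * r" .
        have "u y - u x - \<gamma> \<bullet> (y - x) = - ((u x - b \<bullet> x) - (u y - b \<bullet> y)) + (b - \<gamma>) \<bullet> (y - x)"
          by (simp add: inner_diff_left inner_diff_right)
        then have "\<bar>u y - u x - \<gamma> \<bullet> (y - x)\<bar> \<le> e / 2 * r + e / 2 * r"
          using 1 2 by linarith
        then show ?thesis by (simp add: r_def)
      qed simp
      then show "\<exists>d>0. \<forall>y. norm (y - x) < d \<longrightarrow> norm (u y - u x - \<gamma> \<bullet> (y - x)) \<le> e * norm (y - x)"
        using \<delta>(1) \<kappa>(1) n by (intro exI[of _ "min \<delta> \<kappa> / n"]) simp
    qed
    then show "u differentiable (at x)" by (rule differentiableI)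
  qed
qed

text \<open>A map whose oscillation on cubes is controlled by an integrable density as in the
  Rado--Reichelderfer condition satisfies Lusin's condition (N).\<close>

theorem lusin_N:
  fixes F :: "real^'n \<Rightarrow> real^'n" and \<Theta> :: "real^'n \<Rightarrow> ennreal"
  defines "n \<equiv> CARD('n)"
  assumes Tm [measurable]: "\<Theta> \<in> borel_measurable borel" and fin: "(\<integral>\<^sup>+x. \<Theta> x \<partial>lborel) < \<infinity>"
    and one: "\<And>y. y \<in> \<Omega> \<Longrightarrow> 1 \<le> \<Theta> y" and \<Omega>: "open \<Omega>" and C: "C > 0"
    and osc: "\<And>c r x y T. 0 < r \<Longrightarrow> hcube c r \<subseteq> \<Omega> \<Longrightarrow> x \<in> hcube c r \<Longrightarrow> y \<in> hcube c r \<Longrightarrow> 0 < T \<Longrightarrow>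
      (\<integral>\<^sup>+z. indicator (hcube c r) z * \<Theta> z \<partial>lborel) \<le> ennreal T \<Longrightarrow> norm (F x - F y) \<le> C * root n T"
    and A: "A \<subseteq> \<Omega>" "A \<subseteq> hcube 0 \<rho>" "\<rho> > 0" "negligible A"
  shows "negligible (F ` A)"
  unfolding negligible_outer_le
proof (intro allI impI)
  fix e :: real assume "e > 0"
  have n: "n > 0" by (simp add: n_def)
  let ?M = "density lborel \<Theta>"
  \<comment> \<open>A cube whose density has mass \<open>T\<close> is mapped into a cube of half
    side \<open>C * root n T\<close>, of volume \<open>(2 * C) ^ n * T\<close>.\<close>
  define \<epsilon> where "\<epsilon> = e / (2 * C) ^ n"
  have \<epsilon>: "\<epsilon> > 0" unfolding \<epsilon>_def using \<open>e > 0\<close> C by simp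
  have finM: "emeasure ?M X < \<infinity>" for X
    using le_less_trans[OF emeasure_space[of ?M X]] fin by (simp add: emeasure_density)
  obtain B where B: "B \<in> null_sets lborel" "A \<subseteq> B"
    using A(4) by (auto simp: negligible_iff_null_sets null_sets_completion_iff2)
  have Bb: "B \<in> sets borel" using B(1) by auto
  have "AE x in lborel. x \<notin> B" using B(1) by (rule AE_not_in)
  then have "AE x in lborel. \<Theta> x * indicator B x = 0"
    by (rule AE_mp) (simp add: indicator_def)
  from nn_integral_cong_AE[OF this] have MB: "emeasure ?M B = 0"
    using Bb by (subst emeasure_density) simp_all
  obtain V where V: "open V" "B \<subseteq> V" "emeasure ?M V < emeasure ?M B + ennreal \<epsilon>"
    using outer_regular_open[OF Tm fin Bb \<epsilon>] .
  define V' where "V' = V \<inter> \<Omega>"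
  have V': "open V'" "A \<subseteq> V'" using V \<Omega> A(1) B(2) by (auto simp: V'_def)
  have V'm [measurable]: "V' \<in> sets borel" using V' by simp
  have MV': "emeasure ?M V' \<le> ennreal \<epsilon>"
  proof -
    have "emeasure ?M V' \<le> emeasure ?M V"
      using V(1) by (intro emeasure_mono) (auto simp: V'_def)
    also have "\<dots> \<le> ennreal \<epsilon>" using V(3) MB by simp
    finally show ?thesis .
  qed
  \<comment> \<open>Every cube of the covering is subordinate to a tag in \<open>A\<close>, which
    lies in \<open>V'\<close>, so each cube stays inside \<open>V'\<close>. The unit ball is a
    filler for the points that never occur as tags.\<close>
  have gauge: "gauge (\<lambda>x. if x \<in> V' then V' else ball x 1)"
    using V'(1) by (auto simp: gauge_def)
  let ?a = "(\<chi> i. 0 - \<rho>) :: real^'n" and ?b = "(\<chi> i. 0 + \<rho>) :: real^'n"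
  have ne: "box ?a ?b \<noteq> {}" using A(3) by (simp add: interval_ne_empty_cart)
  have sub: "A \<subseteq> cbox ?a ?b" using A(2) by (simp add: hcube_def)
  obtain D where D: "countable D"
    "\<And>K. K \<in> D \<Longrightarrow> interior K \<noteq> {} \<and> (\<exists>c d. K = cbox c d)"
    "pairwise (\<lambda>A B. interior A \<inter> interior B = {}) D"
    "\<And>K. K \<in> D \<Longrightarrow> \<exists>x \<in> A \<inter> K. K \<subseteq> (if x \<in> V' then V' else ball x 1)"
    "\<And>u v. cbox u v \<in> D \<Longrightarrow> \<exists>n. \<forall>i \<in> Basis. v \<bullet> i - u \<bullet> i = (?b \<bullet> i - ?a \<bullet> i) / 2^n"
    "A \<subseteq> \<Union>D"
    by (rule covering_lemma[OF sub ne gauge]) (rule that)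
  \<comment> \<open>The sides are those of the enclosing box divided by one power of 2 for all
    coordinates; the box being a cube, so are the pieces.\<close>
  have cubes: "\<exists>c r. r > 0 \<and> K = hcube c r" if K: "K \<in> D" for K
  proof -
    obtain u v where uv: "K = cbox u v" using D(2)[OF K] by blast
    then obtain k where k: "\<forall>i \<in> Basis. v \<bullet> i - u \<bullet> i = (?b \<bullet> i - ?a \<bullet> i) / 2^k"
      using D(5) K by blast
    define r where "r = \<rho> / 2 ^ k"
    have len: "v $ i - u $ i = 2 * r" for i
      using bspec[OF k, of "axis i 1"] by (simp add: inner_axis r_def axis_in_Basis_iff)
    have "K = hcube (\<chi> i. u $ i + r) r"
    proof -
      have "v = (\<chi> i. u $ i + r + r)" "u = (\<chi> i. u $ i + r - r)"
        using len by (auto simp: vec_eq_iff) (metis add.commute add_diff_cancel_left' diff_add_cancel mult_2)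
      then show ?thesis unfolding uv hcube_def by simp
    qed
    moreover have "r > 0" using A(3) by (simp add: r_def)
    ultimately show ?thesis by blast
  qed
  then obtain cc rr where cr: "\<And>K. K \<in> D \<Longrightarrow> rr K > 0 \<and> K = hcube (cc K) (rr K)"
    by metis
  have KV: "K \<subseteq> V'" if K: "K \<in> D" for K
  proof -
    obtain x where x: "x \<in> A \<inter> K" "K \<subseteq> (if x \<in> V' then V' else ball x 1)"
      using D(4)[OF K] by blast
    then have "x \<in> V'" using V'(2) by blast
    then show ?thesis using x(2) by simp
  qed
  have Km: "K \<in> sets borel" if "K \<in> D" for K
    using cr[OF that] hcube_borel by metis
  define T where "T K = measure ?M K" for K
  have emT: "emeasure ?M K = ennreal (T K)" for K
    unfolding T_def by (rule emeasure_eq_ennreal_measure) (use finM[of K] in simp)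
  \<comment> \<open>The oscillation hypothesis requires a positive \<open>T\<close>; the lower bound
    1 on \<Theta> supplies it.\<close>
  have Tpos: "T K > 0" if K: "K \<in> D" for K
  proof -
    have "0 < ennreal ((2 * rr K) ^ CARD('n))" using cr[OF K] by simp
    also have "\<dots> = emeasure lborel (hcube (cc K) (rr K))"
      using cr[OF K] by (subst emeasure_hcube) auto
    also have "\<dots> = emeasure lborel K" using cr[OF K] by metis
    also have "\<dots> = (\<integral>\<^sup>+x. indicator K x \<partial>lborel)" using Km[OF K] by simp
    also have "\<dots> \<le> (\<integral>\<^sup>+x. \<Theta> x * indicator K x \<partial>lborel)"
    proof (rule nn_integral_mono)
      fix x
      show "indicator K x \<le> \<Theta> x * indicator K x"
      proof (cases "x \<in> K")
        case True
        then have "x \<in> \<Omega>" using KV[OF K] by (auto simp: V'_def)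
        then show ?thesis using one True by simp
      qed simp
    qed
    also have "\<dots> = ennreal (T K)"
      unfolding emT[symmetric] using Km[OF K] by (subst emeasure_density) auto
    finally show ?thesis by simp
  qed
  define y where "y K = F (cc K)" for K
  define s where "s K = C * root n (T K)" for K
  have img: "F ` K \<subseteq> hcube (y K) (s K)" if K: "K \<in> D" for K
  proof
    fix z assume "z \<in> F ` K"
    then obtain x where x: "x \<in> K" "z = F x" by blast
    have Kh: "K = hcube (cc K) (rr K)" and r: "rr K > 0" using cr[OF K] by auto
    have "hcube (cc K) (rr K) \<subseteq> \<Omega>" using KV[OF K] Kh by (auto simp: V'_def)
    moreover have "cc K \<in> hcube (cc K) (rr K)" using r by (simp add: mem_hcube)
    moreover have "x \<in> hcube (cc K) (rr K)" using x(1) Kh by simp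
    moreover have "(\<integral>\<^sup>+z. indicator (hcube (cc K) (rr K)) z * \<Theta> z \<partial>lborel) \<le> ennreal (T K)"
      unfolding emT[symmetric] Kh[symmetric] using Km[OF K]
      by (subst emeasure_density) (auto simp: mult.commute)
    ultimately have "norm (F x - F (cc K)) \<le> C * root n (T K)"
      using osc[OF r _ _ _ Tpos[OF K]] by simp
    then have "\<bar>(F x - F (cc K)) $ i\<bar> \<le> s K" for i
      using component_le_norm_cart[of "F x - F (cc K)" i] by (simp add: s_def)
    then show "z \<in> hcube (y K) (s K)" by (simp add: mem_hcube x(2) y_def)
  qed
  let ?S = "\<Union>K\<in>D. hcube (y K) (s K)"
  have meas_s: "measure lebesgue (hcube (y K) (s K)) = (2 * C) ^ n * T K" if K: "K \<in> D" for K
  proof -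
    have s0: "s K \<ge> 0" using Tpos[OF K] C n by (simp add: s_def)
    have "measure lebesgue (hcube (y K) (s K)) = (2 * s K) ^ n"
      using emeasure_hcube[OF s0, of "y K"] s0 by (simp add: measure_def n_def)
    also have "\<dots> = (2 * C) ^ n * root n (T K) ^ n"
      by (simp add: s_def power_mult_distrib)
    finally show ?thesis using Tpos[OF K] n by simp
  qed
  have lm: "hcube (y K) (s K) \<in> lmeasurable" for K
    by (simp add: hcube_def)
  have bound: "measure lebesgue (\<Union>K\<in>I. hcube (y K) (s K)) \<le> e" if I: "I \<subseteq> D" "finite I" for I
  proof -
    have "measure lebesgue (\<Union>K\<in>I. hcube (y K) (s K)) \<le> (\<Sum>K\<in>I. measure lebesgue (hcube (y K) (s K)))"
      by (rule measure_UNION_le[OF I(2)]) (use lm in auto)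
    also have "\<dots> = (\<Sum>K\<in>I. (2 * C) ^ n * T K)"
      by (rule sum.cong[OF refl]) (rule meas_s[OF subsetD[OF I(1)]])
    also have "\<dots> = (2 * C) ^ n * (\<Sum>K\<in>I. T K)" by (simp add: sum_distrib_left)
    also have "(\<Sum>K\<in>I. T K) \<le> \<epsilon>"
    proof -
      \<comment> \<open>The cubes are disjoint only in their interiors. Faces are null for the
        density, so the masses add up as those of disjoint open sets inside
        \<open>V'\<close>.\<close>
      have int: "emeasure ?M K = emeasure ?M (interior K)" if "K \<in> I" for K
      proof -
        have K: "K \<in> D" using that I by blast
        obtain u v where uv: "K = cbox u v" using D(2)[OF K] by blast
        have "negligible (cbox u v - box u v)" by (rule negligible_frontier_interval)
        moreover have "cbox u v - box u v \<in> sets borel" by simp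
        ultimately have "cbox u v - box u v \<in> null_sets lborel"
          by (simp add: negligible_iff_null_sets null_sets_def)
        then have "AE x in lborel. x \<notin> cbox u v - box u v" by (rule AE_not_in)
        then have "AE x in lborel. \<Theta> x * indicator (cbox u v) x = \<Theta> x * indicator (box u v) x"
          by (rule AE_mp) (use box_subset_cbox[of u v] in \<open>auto simp: indicator_def\<close>)
        then have "(\<integral>\<^sup>+x. \<Theta> x * indicator (cbox u v) x \<partial>lborel) = (\<integral>\<^sup>+x. \<Theta> x * indicator (box u v) x \<partial>lborel)"
          by (rule nn_integral_cong_AE)
        then show ?thesis by (simp add: uv emeasure_density interior_cbox)
      qed
      have "ennreal (\<Sum>K\<in>I. T K) = (\<Sum>K\<in>I. emeasure ?M (interior K))"
        using int by (simp add: sum_ennreal[symmetric] T_def emT[symmetric, unfolded T_def])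
      also have "\<dots> = emeasure ?M (\<Union>K\<in>I. interior K)"
      proof (rule sum_emeasure)
        show "interior ` I \<subseteq> sets ?M" by auto
        show "disjoint_family_on interior I"
          using D(3) I(1) by (auto simp: disjoint_family_on_def pairwise_def)
      qed (rule I(2))
      also have "\<dots> \<le> emeasure ?M V'"
      proof (rule emeasure_mono)
        have "interior K \<subseteq> V'" if "K \<in> I" for K
          using order_trans[OF interior_subset KV] that I(1) by blast
        then show "(\<Union>K\<in>I. interior K) \<subseteq> V'" by (rule UN_least)
      qed simp
      also have "\<dots> \<le> ennreal \<epsilon>" by (rule MV')
      finally show ?thesis using \<epsilon> by (simp add: ennreal_le_iff)
    qed
    then have "(2 * C) ^ n * (\<Sum>K\<in>I. T K) \<le> (2 * C) ^ n * \<epsilon>"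
      using C by (intro mult_left_mono) auto
    also have "(2 * C) ^ n * \<epsilon> = e" using C by (simp add: \<epsilon>_def)
    finally show ?thesis .
  qed
  have "F ` A \<subseteq> ?S"
  proof
    fix z assume "z \<in> F ` A"
    then obtain x K where "x \<in> K" "K \<in> D" "z = F x" using D(6) by blast
    then show "z \<in> ?S" using img[of K] by blast
  qed
  moreover have "?S \<in> lmeasurable"
    by (rule fmeasurable_UN_bound[OF D(1) lm bound])
  moreover have "measure lebesgue ?S \<le> e"
    by (rule measure_UN_bound[OF D(1) lm bound])
  ultimately show "\<exists>S. F ` A \<subseteq> S \<and> S \<in> lmeasurable \<and> measure lebesgue S \<le> e" by blast
qed

section \<open>Area formula on injective pieces\<close>

text \<open>At a point with invertible derivative, \<open>F\<close> expands distances from that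
  point by a fixed factor on some ball. Quantifying factor and radius by \<open>m\<close> gives sets
  that are closed by continuity of \<open>F\<close>; small portions of them are domains of
  injectivity, and each is exhausted by compact sets up to a null set.\<close>

lemma injective_pieces:
  fixes F :: "real^'n \<Rightarrow> real^'n"
  assumes F: "continuous_on UNIV F" and S: "S \<in> sets lebesgue"
    and der: "\<And>y. y \<in> S \<Longrightarrow> (F has_derivative F' y) (at y)"
    and nz: "\<And>y. y \<in> S \<Longrightarrow> det (matrix (F' y)) \<noteq> 0"
  shows "\<exists>K :: nat \<Rightarrow> (real^'n) set. (\<forall>i. compact (K i) \<and> inj_on F (K i) \<and> K i \<subseteq> S) \<and> negligible (S - (\<Union>i. K i))"
proof -
  define P where "P m = {y. \<forall>z. dist z y < 1 / real (Suc m) \<longrightarrow> norm (z - y) / real (Suc m) \<le> norm (F z - F y)}" for m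
  have cl: "closed (P m)" for m
    unfolding closed_sequential_limits
  proof (intro allI impI, elim conjE)
    fix x l assume x: "\<forall>n. x n \<in> P m" and l: "x \<longlonglongrightarrow> l"
    show "l \<in> P m"
      unfolding P_def
    proof (intro CollectI allI impI)
      fix z assume z: "dist z l < 1 / real (Suc m)"
      have "(\<lambda>n. dist z (x n)) \<longlonglongrightarrow> dist z l"
        by (intro tendsto_intros l)
      then have "eventually (\<lambda>n. dist z (x n) < 1 / real (Suc m)) sequentially"
        by (rule order_tendstoD(2)[OF _ z])
      then have ev: "eventually (\<lambda>n. norm (z - x n) / real (Suc m) \<le> norm (F z - F (x n))) sequentially"
        by (rule eventually_mono) (use x in \<open>simp add: P_def\<close>)
      have Fl: "(\<lambda>n. F (x n)) \<longlonglongrightarrow> F l"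
        using F l by (simp add: continuous_on_eq_continuous_at isCont_tendsto_compose)
      have 1: "(\<lambda>n. norm (z - x n) / real (Suc m)) \<longlonglongrightarrow> norm (z - l) / real (Suc m)"
        by (intro tendsto_intros l) simp
      have 2: "(\<lambda>n. norm (F z - F (x n))) \<longlonglongrightarrow> norm (F z - F l)"
        by (intro tendsto_intros Fl)
      show "norm (z - l) / real (Suc m) \<le> norm (F z - F l)"
        by (rule tendsto_le[OF _ 2 1 ev]) simp
    qed
  qed
  have cover: "\<exists>m. y \<in> P m" if y: "y \<in> S" for y
  proof -
    have lin: "linear (F' y)" using der[OF y] has_derivative_linear by blast
    have "inj (F' y)" using nz[OF y] det_nz_iff_inj[OF lin] by simp
    then obtain B where B: "B > 0" "\<And>v. B * norm v \<le> norm (F' y v)"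
      using linear_inj_bounded_below_pos[OF lin] by blast
    have "B / 2 > 0" using B by simp
    then obtain d where d: "d > 0" "\<And>z. norm (z - y) < d \<Longrightarrow> norm (F z - F y - F' y (z - y)) \<le> B / 2 * norm (z - y)"
      using der[OF y] unfolding has_derivative_at_alt by meson
    obtain m where m: "inverse (real (Suc m)) < min d (B / 2)"
      using reals_Archimedean[of "min d (B / 2)"] d(1) B(1) by auto
    have "norm (z - y) / real (Suc m) \<le> norm (F z - F y)" if z: "dist z y < 1 / real (Suc m)" for z
    proof -
      have "norm (z - y) < d" using z m by (simp add: dist_norm inverse_eq_divide del: of_nat_Suc)
      then have "norm (F z - F y - F' y (z - y)) \<le> B / 2 * norm (z - y)" by (rule d(2))
      moreover have "norm (F' y (z - y)) \<le> norm (F z - F y) + norm (F z - F y - F' y (z - y))"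
        using norm_triangle_ineq4[of "F z - F y" "F z - F y - F' y (z - y)"] by simp
      ultimately have "B / 2 * norm (z - y) \<le> norm (F z - F y)"
        using B(2)[of "z - y"] by linarith
      moreover have "inverse (real (Suc m)) * norm (z - y) \<le> B / 2 * norm (z - y)"
        by (rule mult_right_mono[OF _ norm_ge_zero]) (use m in linarith)
      ultimately show ?thesis unfolding divide_inverse_commute[of "norm (z - y)"] by linarith
    qed
    then have "y \<in> P m" unfolding P_def by blast
    then show ?thesis ..
  qed
  obtain Q :: "(real^'n) set" where Q: "countable Q" "\<And>X. open X \<Longrightarrow> X \<noteq> {} \<Longrightarrow> \<exists>d\<in>Q. d \<in> X"
    using countable_dense_setE by blast
  \<comment> \<open>The radius is a quarter of the range of the expansion inequality, so any two
    points of a piece are within that range.\<close>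
  define T where "T i = S \<inter> P (fst i) \<inter> cball (snd i) (1 / (4 * real (Suc (fst i))))" for i
  let ?I = "(UNIV :: nat set) \<times> Q"
  have Tl: "T i \<in> sets lebesgue" for i
    unfolding T_def using S cl by (intro sets.Int) auto
  have Tinj: "inj_on F (T i)" for i
  proof (rule inj_onI)
    fix y z assume yz: "y \<in> T i" "z \<in> T i" "F y = F z"
    let ?e = "1 / (4 * real (Suc (fst i)))"
    have "dist y (snd i) \<le> ?e" "dist z (snd i) \<le> ?e"
      using yz(1,2) by (simp_all add: T_def dist_commute del: of_nat_Suc)
    then have "dist z y \<le> ?e + ?e"
      using dist_triangle2[of z y "snd i"] by linarith
    also have "\<dots> < 1 / real (Suc (fst i))" by (simp add: field_simps)
    finally have "norm (z - y) / real (Suc (fst i)) \<le> norm (F z - F y)"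
      using yz(1) by (simp add: T_def P_def del: of_nat_Suc)
    then show "y = z" using yz(3) by (simp add: divide_le_0_iff del: of_nat_Suc)
  qed
  have Tcov: "S \<subseteq> (\<Union>i\<in>?I. T i)"
  proof
    fix y assume y: "y \<in> S"
    obtain m where m: "y \<in> P m" using cover[OF y] ..
    obtain q where q: "q \<in> Q" "q \<in> ball y (1 / (4 * real (Suc m)))"
      using Q(2)[of "ball y (1 / (4 * real (Suc m)))"] by auto
    then have "y \<in> T (m, q)" using y m by (simp add: T_def dist_commute less_imp_le del: of_nat_Suc)
    then show "y \<in> (\<Union>i\<in>?I. T i)" using q(1) by blast
  qed
  have "\<exists>G :: nat \<Rightarrow> (real^'n) set. (\<forall>j. compact (G j)) \<and> (\<Union>j. G j) \<subseteq> T i \<and> negligible (T i - (\<Union>j. G j))" for i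
  proof -
    obtain C N where CN: "fsigma C" "N \<in> null_sets lebesgue" "C \<union> N = T i" "disjnt C N"
      using lebesgue_set_almost_fsigma[OF Tl] .
    then obtain G :: "nat \<Rightarrow> (real^'n) set" where G: "range G \<subseteq> Collect compact" "C = \<Union>(range G)"
      using fsigma_Union_compact by metis
    have "T i - (\<Union>j. G j) \<subseteq> N" using CN G by blast
    moreover have "negligible N" using CN(2) by (simp add: negligible_iff_null_sets)
    ultimately have "negligible (T i - (\<Union>j. G j))" by (rule negligible_subset[rotated])
    moreover have "(\<Union>j. G j) \<subseteq> T i" using CN G by blast
    moreover have "compact (G j)" for j using G(1) by blast
    ultimately show ?thesis by (intro exI[of _ G] conjI allI)
  qed
  then have "\<forall>i. \<exists>G :: nat \<Rightarrow> (real^'n) set. (\<forall>j. compact (G j)) \<and> (\<Union>j. G j) \<subseteq> T i \<and> negligible (T i - (\<Union>j. G j))" ..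
  from choice[OF this] obtain G :: "nat \<times> (real^'n) \<Rightarrow> nat \<Rightarrow> (real^'n) set"
    where G': "\<forall>i. (\<forall>j. compact (G i j)) \<and> (\<Union>j. G i j) \<subseteq> T i \<and> negligible (T i - (\<Union>j. G i j))" ..
  have G: "compact (G i j)" "(\<Union>j. G i j) \<subseteq> T i" "negligible (T i - (\<Union>j. G i j))" for i j
    using spec[OF G', of i] by simp_all
  let ?J = "?I \<times> (UNIV :: nat set)"
  have Jc: "countable ?J" using Q(1) by simp
  have "Q \<noteq> {}" using Q(2)[of UNIV] by auto
  then have Jne: "?J \<noteq> {}" by simp
  define e where "e = from_nat_into ?J"
  have e: "range e = ?J" unfolding e_def by (rule range_from_nat_into[OF Jne Jc])
  define K where "K k = G (fst (e k)) (snd (e k))" for k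
  show ?thesis
  proof (intro exI[of _ K] conjI allI)
    show "compact (K k)" for k unfolding K_def by (rule G(1))
    have KT: "K k \<subseteq> T (fst (e k))" for k unfolding K_def by (rule order_trans[OF UN_upper G(2)]) simp
    show "inj_on F (K k)" for k by (rule inj_on_subset[OF Tinj KT])
    show "K k \<subseteq> S" for k
    proof -
      have "T i \<subseteq> S" for i by (simp add: T_def Int_assoc)
      then show ?thesis by (rule order_trans[OF KT])
    qed
    have "S - (\<Union>k. K k) \<subseteq> (\<Union>i\<in>?I. T i - (\<Union>j. G i j))"
    proof
      fix y assume y: "y \<in> S - (\<Union>k. K k)"
      then have "y \<in> (\<Union>i\<in>?I. T i)" using subsetD[OF Tcov] by simp
      then obtain i where i: "i \<in> ?I" "y \<in> T i" by (rule UN_E)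
      have nG: "y \<notin> G i j" for j
      proof
        assume yG: "y \<in> G i j"
        have "(i, j) \<in> range e" unfolding e using i(1) by simp
        then obtain k where "(i, j) = e k" by (rule rangeE)
        then have "e k = (i, j)" by simp
        then have "y \<in> K k" using yG by (simp add: K_def)
        then show False using y by simp
      qed
      show "y \<in> (\<Union>i\<in>?I. T i - (\<Union>j. G i j))"
        by (rule UN_I[OF i(1)]) (simp add: i(2) nG)
    qed
    moreover have "negligible (\<Union>i\<in>?I. T i - (\<Union>j. G i j))"
    proof (rule negligible_countable_Union)
      show "countable ((\<lambda>i. T i - (\<Union>j. G i j)) ` ?I)" using Q(1) by simp
      show "negligible X" if "X \<in> (\<lambda>i. T i - (\<Union>j. G i j)) ` ?I" for X
        using that G(3) by (elim imageE) simp
    qed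
    ultimately show "negligible (S - (\<Union>k. K k))" by (rule negligible_subset[rotated])
  qed
qed

section \<open>Local inverses, area formula and the kernel on fibres\<close>

text \<open>The inverse of \<open>F\<close> on \<open>K\<close>. The value 0 outside the image makes
  it a total function that can be Borel; it is always multiplied there by a vanishing
  indicator.\<close>

definition section_on :: "('a \<Rightarrow> 'b) \<Rightarrow> 'a set \<Rightarrow> 'b \<Rightarrow> 'a::zero" where
  "section_on F K x = (if x \<in> F ` K then inv_into K F x else 0)"

lemma section_on_eq: "inj_on F K \<Longrightarrow> y \<in> K \<Longrightarrow> section_on F K (F y) = y"
  by (simp add: section_on_def)

lemma section_on_mem: "x \<in> F ` K \<Longrightarrow> section_on F K x \<in> K \<and> F (section_on F K x) = x"
  by (simp add: section_on_def inv_into_into f_inv_into_f)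

text \<open>Compactness makes the inverse of the injective continuous map continuous on the compact
  image, and the extension by a constant preserves measurability.\<close>

lemma section_on_borel:
  fixes F :: "'a::euclidean_space \<Rightarrow> 'b::euclidean_space"
  assumes F: "continuous_on UNIV F" and K: "compact K" "inj_on F K"
  shows "section_on F K \<in> borel_measurable borel" "F ` K \<in> sets borel"
proof -
  have cF: "continuous_on K F" using F continuous_on_subset by blast
  have "compact (F ` K)" by (rule compact_continuous_image[OF cF K(1)])
  then show m: "F ` K \<in> sets borel" by (simp add: borel_compact)
  have "continuous_on (F ` K) (inv_into K F)"
    by (rule continuous_on_inv[OF cF K(1)]) (use K(2) in simp)
  from borel_measurable_continuous_on_if[OF m this continuous_on_const[of _ 0]]
  show "section_on F K \<in> borel_measurable borel"
    unfolding section_on_def[abs_def] .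
qed

text \<open>The measure with density \<open>J\<close> on \<open>K\<close> is pushed forward by
  \<open>F\<close> to Lebesgue measure on the image, as the change of variables shows on each Borel
  set. Integrals of general functions then follow from the transformation rule for
  push-forwards.\<close>

lemma area_formula_piece:
  fixes F :: "real^'n \<Rightarrow> real^'n" and f :: "real^'n \<Rightarrow> ennreal"
  assumes F: "continuous_on UNIV F" and K: "compact K" "inj_on F K"
    and der: "\<And>y. y \<in> K \<Longrightarrow> (F has_derivative F' y) (at y)"
    and fm: "f \<in> borel_measurable borel"
  defines "J \<equiv> \<lambda>y. \<bar>det (matrix (F' y))\<bar>"
  shows "(\<lambda>y. indicator K y * ennreal (J y)) \<in> borel_measurable lebesgue"
    and "(\<integral>\<^sup>+y. indicator K y * ennreal (J y) * f y \<partial>lebesgue) =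
      (\<integral>\<^sup>+x. indicator (F ` K) x * f (section_on F K x) \<partial>lborel)"
proof -
  have Fm [measurable]: "F \<in> borel_measurable borel" using F by (rule borel_measurable_continuous_onI)
  have FL: "F \<in> lebesgue \<rightarrow>\<^sub>M borel" using Fm by (simp add: measurable_completion)
  have Kb: "K \<in> sets borel" using K(1) by (simp add: borel_compact)
  have Kl: "K \<in> sets lebesgue" using Kb by simp
  note sb = section_on_borel[OF F K]
  let ?j = "\<lambda>y. indicator K y * ennreal (J y)"
  have "(\<lambda>y. det (matrix (F' y))) \<in> borel_measurable (lebesgue_on K)"
    by (rule borel_measurable_det_Jacobian_finite[OF Kl has_derivative_at_withinI[OF der]])
  then have "(\<lambda>y. if y \<in> K then det (matrix (F' y)) else 0) \<in> borel_measurable lebesgue"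
    by (rule borel_measurable_if_I[OF _ Kl])
  then have "(\<lambda>y. ennreal \<bar>if y \<in> K then det (matrix (F' y)) else 0\<bar>) \<in> borel_measurable lebesgue"
    by measurable
  moreover have "(\<lambda>y. ennreal \<bar>if y \<in> K then det (matrix (F' y)) else 0\<bar>) = ?j"
    by (auto simp: J_def indicator_def)
  ultimately show jm: "?j \<in> borel_measurable lebesgue" by simp
  let ?\<nu> = "distr (density lebesgue ?j) borel F"
  have FD: "F \<in> density lebesgue ?j \<rightarrow>\<^sub>M borel" using FL by simp
  have \<nu>: "?\<nu> = density lborel (indicator (F ` K))"
  proof (rule measure_eqI)
    fix B assume "B \<in> sets ?\<nu>"
    then have B: "B \<in> sets borel" by simp
    let ?S = "K \<inter> F -` B"
    have vB: "F -` B \<in> sets borel" using measurable_sets[OF Fm B] by simp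
    have img: "F ` ?S = F ` K \<inter> B" by blast
    have fin: "emeasure lborel (F ` K \<inter> B) < \<infinity>"
    proof -
      have "compact (F ` K)" using F K(1) by (intro compact_continuous_image) (auto intro: continuous_on_subset)
      then have "emeasure lborel (F ` K) < \<infinity>" by (rule emeasure_compact_finite)
      then show ?thesis
        using emeasure_mono[of "F ` K \<inter> B" "F ` K" lborel] sb(2) by (auto intro: le_less_trans)
    qed
    have "emeasure ?\<nu> B = (\<integral>\<^sup>+y. ?j y * indicator (F -` B) y \<partial>lebesgue)"
      using B vB jm by (subst emeasure_distr[OF FD B], subst emeasure_density) auto
    also have "\<dots> = (\<integral>\<^sup>+y. indicator ?S y * ennreal \<bar>det (matrix (F' y))\<bar> \<partial>lebesgue)"
      by (intro nn_integral_cong) (auto simp: indicator_def J_def)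
    also have "\<dots> = emeasure lebesgue (F ` ?S)"
    proof (rule emeasure_differentiable_image[symmetric])
      show "?S \<in> sets lebesgue" using Kb vB by simp
      show "(F has_derivative F' y) (at y within ?S)" if "y \<in> ?S" for y
        using that der has_derivative_at_withinI by blast
      show "inj_on F ?S" using K(2) inj_on_subset by blast
      show "F ` ?S \<in> lmeasurable"
        unfolding img using sb(2) B fin by (auto simp: fmeasurable_def)
    qed
    also have "\<dots> = emeasure lborel (F ` K \<inter> B)"
      unfolding img using sb(2) B by simp
    also have "\<dots> = emeasure (density lborel (indicator (F ` K))) B"
      using sb(2) B by (subst emeasure_density) (auto simp: indicator_inter_arith[symmetric])
    finally show "emeasure ?\<nu> B = emeasure (density lborel (indicator (F ` K))) B" .
  qed simp
  have fsm: "(\<lambda>x. f (section_on F K x)) \<in> borel_measurable borel"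
    using measurable_compose[OF sb(1) fm] .
  have "(\<integral>\<^sup>+y. ?j y * f y \<partial>lebesgue) = (\<integral>\<^sup>+y. ?j y * f (section_on F K (F y)) \<partial>lebesgue)"
    by (intro nn_integral_cong) (auto simp: indicator_def section_on_eq[OF K(2)])
  also have "\<dots> = (\<integral>\<^sup>+y. f (section_on F K (F y)) \<partial>density lebesgue ?j)"
    by (rule nn_integral_density[symmetric, OF jm]) (rule measurable_compose[OF FL fsm])
  also have "\<dots> = (\<integral>\<^sup>+x. f (section_on F K x) \<partial>?\<nu>)"
    by (rule nn_integral_distr[symmetric, OF FD]) (use fsm in simp)
  also have "\<dots> = (\<integral>\<^sup>+x. indicator (F ` K) x * f (section_on F K x) \<partial>lborel)"
    unfolding \<nu> by (rule nn_integral_density) (use sb fsm in auto)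
  finally show "(\<integral>\<^sup>+y. indicator K y * ennreal (J y) * f y \<partial>lebesgue) =
      (\<integral>\<^sup>+x. indicator (F ` K) x * f (section_on F K x) \<partial>lborel)" .
qed

lemma infsum_ennreal_nat: "(\<Sum>\<^sub>\<infinity>i\<in>(UNIV :: nat set). f i) = (\<integral>\<^sup>+i. (f i :: ennreal) \<partial>count_space UNIV)"
proof -
  have "f summable_on UNIV" by (rule nonneg_summable_on_complete) simp
  from has_sum_imp_sums[OF has_sum_infsum[OF this]] show ?thesis
    by (simp add: nn_integral_count_space_nat sums_unique)
qed

lemma Jacobian_measurable:
  fixes F :: "real^'n \<Rightarrow> real^'n"
  assumes E: "negligible E" and der: "\<And>y. y \<notin> E \<Longrightarrow> (F has_derivative F' y) (at y)"
  shows "(\<lambda>y. if y \<in> - E then det (matrix (F' y)) else 0) \<in> borel_measurable lebesgue"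
proof -
  have El: "- E \<in> sets lebesgue"
    using sets.compl_sets[OF negligible_imp_sets[OF E]] by (simp add: Compl_eq_Diff_UNIV)
  have "(\<lambda>y. det (matrix (F' y))) \<in> borel_measurable (lebesgue_on (- E))"
    by (rule borel_measurable_det_Jacobian_finite[OF El has_derivative_at_withinI[OF der]]) simp
  then show ?thesis by (rule borel_measurable_if_I[OF _ El])
qed

lemma critical_values_negligible:
  fixes F :: "real^'n \<Rightarrow> real^'n"
  assumes E: "negligible E" and der: "\<And>y. y \<notin> E \<Longrightarrow> (F has_derivative F' y) (at y)"
    and N: "\<And>A. negligible A \<Longrightarrow> negligible (F ` A)"
  shows "negligible (F ` ({y. y \<notin> E \<and> \<bar>det (matrix (F' y))\<bar> = 0} \<union> E))"
proof -
  have "negligible (F ` {y. y \<notin> E \<and> \<bar>det (matrix (F' y))\<bar> = 0})"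
    by (rule baby_Sard_finite[OF has_derivative_at_withinI[OF der]]) auto
  then show ?thesis
    using N[OF E] by (simp add: image_Un negligible_Un)
qed

lemma regular_pieces:
  fixes F :: "real^'n \<Rightarrow> real^'n"
  assumes F: "continuous_on UNIV F" and E: "negligible E"
    and der: "\<And>y. y \<notin> E \<Longrightarrow> (F has_derivative F' y) (at y)"
  defines "S \<equiv> {y. y \<notin> E \<and> det (matrix (F' y)) \<noteq> 0}"
  shows "\<exists>K :: nat \<Rightarrow> (real^'n) set. (\<forall>i. compact (K i) \<and> inj_on F (K i) \<and> K i \<subseteq> S) \<and> negligible (S - (\<Union>i. K i))"
proof -
  have "{y \<in> space lebesgue. (if y \<in> - E then det (matrix (F' y)) else 0) \<noteq> 0} \<in> sets lebesgue"
    using Jacobian_measurable[OF E der] by measurable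
  moreover have "{y \<in> space lebesgue. (if y \<in> - E then det (matrix (F' y)) else 0) \<noteq> 0} = S"
    by (auto simp: S_def split: if_splits)
  ultimately have Sl: "S \<in> sets lebesgue" by simp
  have derS: "(F has_derivative F' y) (at y)" and nzS: "det (matrix (F' y)) \<noteq> 0" if "y \<in> S" for y
    using that der by (simp_all add: S_def)
  show ?thesis
    by (rule injective_pieces[OF F Sl]) (rule derS nzS, assumption)+
qed

text \<open>On an injective piece the integral of \<open>J\<close> over the preimage of
  \<open>B\<close> is at most the measure of \<open>B\<close>, hence zero, while \<open>J\<close> is
  positive there. The regular points outside the pieces and the points of \<open>E\<close> form null
  sets.\<close>

lemma AE_preimage_null:
  fixes F :: "real^'n \<Rightarrow> real^'n"
  assumes F: "continuous_on UNIV F" and E: "negligible E"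
    and der: "\<And>y. y \<notin> E \<Longrightarrow> (F has_derivative F' y) (at y)"
    and B: "B \<in> null_sets lborel"
  shows "AE y in lebesgue. F y \<in> B \<longrightarrow> y \<notin> E \<and> \<bar>det (matrix (F' y))\<bar> = 0"
proof -
  let ?S = "{y. y \<notin> E \<and> det (matrix (F' y)) \<noteq> 0}"
  let ?J = "\<lambda>y. \<bar>det (matrix (F' y))\<bar>"
  have Fm: "F \<in> borel_measurable borel" using F by (rule borel_measurable_continuous_onI)
  have Bb: "B \<in> sets borel" using B by auto
  have vB: "F -` B \<in> sets borel" using measurable_sets[OF Fm Bb] by simp
  have "\<exists>K :: nat \<Rightarrow> (real^'n) set. (\<forall>i. compact (K i) \<and> inj_on F (K i) \<and> K i \<subseteq> ?S) \<and> negligible (?S - (\<Union>i. K i))"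
    by (rule regular_pieces[OF F E]) (rule der)
  then obtain K :: "nat \<Rightarrow> (real^'n) set"
    where K': "(\<forall>i. compact (K i) \<and> inj_on F (K i) \<and> K i \<subseteq> ?S) \<and> negligible (?S - (\<Union>i. K i))" ..
  have K: "compact (K i)" "inj_on F (K i)" "K i \<subseteq> ?S" "negligible (?S - (\<Union>i. K i))" for i
    using spec[OF conjunct1[OF K'], of i] conjunct2[OF K'] by simp_all
  have piece: "AE y in lebesgue. y \<in> K i \<longrightarrow> F y \<notin> B" for i
  proof -
    have derK: "(F has_derivative F' y) (at y)" if "y \<in> K i" for y
      using subsetD[OF K(3) that] der by simp
    have im: "(indicator (F -` B) :: _ \<Rightarrow> ennreal) \<in> borel_measurable borel"
      using vB by simp
    note area = area_formula_piece[OF F K(1,2) derK im]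
    have "(\<integral>\<^sup>+y. indicator (K i) y * ennreal (?J y) * indicator (F -` B) y \<partial>lebesgue)
        = (\<integral>\<^sup>+x. indicator (F ` K i) x * indicator (F -` B) (section_on F (K i) x) \<partial>lborel)"
      by (rule area(2))
    also have "\<dots> \<le> (\<integral>\<^sup>+x. indicator B x \<partial>lborel)"
    proof (rule nn_integral_mono)
      fix x
      show "indicator (F ` K i) x * indicator (F -` B) (section_on F (K i) x) \<le> (indicator B x :: ennreal)"
        using section_on_mem[of x F "K i"] by (cases "x \<in> F ` K i") (simp_all add: indicator_def)
    qed
    also have "\<dots> = 0" using null_setsD1[OF B] Bb by simp
    finally have "(\<integral>\<^sup>+y. indicator (K i) y * ennreal (?J y) * indicator (F -` B) y \<partial>lebesgue) = 0" by simp
    moreover have "(\<lambda>y. indicator (F -` B) y :: ennreal) \<in> borel_measurable lebesgue"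
      using im by (intro measurable_completion) simp
    from borel_measurable_times_ennreal[OF area(1) this]
    have "(\<lambda>y. indicator (K i) y * ennreal (?J y) * indicator (F -` B) y) \<in> borel_measurable lebesgue" .
    ultimately have "AE y in lebesgue. indicator (K i) y * ennreal (?J y) * indicator (F -` B) y = 0"
      by (simp add: nn_integral_0_iff_AE)
    then show ?thesis
    proof (rule AE_mp, intro AE_I2 impI)
      fix y assume 0: "indicator (K i) y * ennreal (?J y) * indicator (F -` B) y = (0 :: ennreal)" and y: "y \<in> K i"
      have "det (matrix (F' y)) \<noteq> 0" using subsetD[OF K(3) y] by simp
      then show "F y \<notin> B" using 0 y by (cases "F y \<in> B") simp_all
    qed
  qed
  have "AE y in lebesgue. \<forall>i. y \<in> K i \<longrightarrow> F y \<notin> B"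
    by (subst AE_all_countable) (rule allI, rule piece)
  moreover have "AE y in lebesgue. y \<notin> E"
    using E by (intro AE_not_in) (simp add: negligible_iff_null_sets)
  moreover have "AE y in lebesgue. y \<notin> ?S - (\<Union>i. K i)"
    using K(4) by (intro AE_not_in) (simp add: negligible_iff_null_sets)
  ultimately show ?thesis
  proof eventually_elim
    case (elim y)
    show ?case
    proof
      assume "F y \<in> B"
      then have "y \<notin> (\<Union>i. K i)" using elim(1) by blast
      then have "y \<notin> ?S" using elim(3) by blast
      then show "y \<notin> E \<and> ?J y = 0" using elim(2) by simp
    qed
  qed
qed

text \<open>The kernel at \<open>x\<close> is the image of a weighted counting measure on the indices of the pieces
  meeting the fibre over \<open>x\<close>, which makes its measurability in \<open>x\<close> immediate.\<close>

theorem fibre_kernel: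
  fixes F G :: "real^'n \<Rightarrow> real^'n"
  assumes F: "continuous_on UNIV F" and G: "continuous_on UNIV G" and E: "negligible E"
    and der: "\<And>y. y \<notin> E \<Longrightarrow> (F has_derivative F' y) (at y)"
    and N: "\<And>A. negligible A \<Longrightarrow> negligible (F ` A)"
    and \<rho>m: "\<rho> \<in> borel_measurable lebesgue" and \<rho>0: "\<And>y. 0 \<le> \<rho> y"
  defines "J \<equiv> \<lambda>y. \<bar>det (matrix (F' y))\<bar>"
  assumes \<rho>Z: "AE y in lebesgue. y \<notin> E \<and> J y = 0 \<longrightarrow> \<rho> y = 0"
  obtains k :: "real^'n \<Rightarrow> (real^'n) measure" where "\<And>x. sets (k x) = sets borel"
    "\<And>A. A \<in> sets borel \<Longrightarrow> (\<lambda>x. emeasure (k x) (Pair x -` A)) \<in> borel_measurable borel"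
    "\<And>A. A \<in> sets borel \<Longrightarrow> (\<integral>\<^sup>+y. ennreal (\<rho> y) * indicator A (F y, G y) \<partial>lebesgue) =
       (\<integral>\<^sup>+x. emeasure (k x) (Pair x -` A) \<partial>lborel)"
    "AE x in lebesgue. \<forall>B\<in>sets borel. emeasure (k x) B =
       (\<Sum>\<^sub>\<infinity>y\<in>F -` {x}. ennreal (\<rho> y / J y) * indicator B (G y))"
proof -
  let ?S = "{y. y \<notin> E \<and> det (matrix (F' y)) \<noteq> 0}"
  have Fm [measurable]: "F \<in> borel_measurable borel" using F by (rule borel_measurable_continuous_onI)
  have Gm [measurable]: "G \<in> borel_measurable borel" using G by (rule borel_measurable_continuous_onI)
  have "\<exists>K :: nat \<Rightarrow> (real^'n) set. (\<forall>i. compact (K i) \<and> inj_on F (K i) \<and> K i \<subseteq> ?S) \<and> negligible (?S - (\<Union>i. K i))"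
    by (rule regular_pieces[OF F E]) (rule der)
  then obtain K :: "nat \<Rightarrow> (real^'n) set"
    where K': "(\<forall>i. compact (K i) \<and> inj_on F (K i) \<and> K i \<subseteq> ?S) \<and> negligible (?S - (\<Union>i. K i))" ..
  have K: "compact (K i)" "inj_on F (K i)" "K i \<subseteq> ?S" "negligible (?S - (\<Union>i. K i))" for i
    using spec[OF conjunct1[OF K'], of i] conjunct2[OF K'] by simp_all
  have Kb: "K i \<in> sets borel" for i using K(1) by (simp add: borel_compact)
  \<comment> \<open>The disjoint parts ensure that each point of a fibre is counted once. They need
    not be compact, so the local inverses are still taken on the sets \<open>K i\<close>.\<close>
  define P where "P = disjointed K"
  have Pm [measurable]: "P i \<in> sets borel" for i
    unfolding P_def disjointed_def using Kb by (intro sets.Diff sets.finite_UN) auto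
  have PK: "P i \<subseteq> K i" for i unfolding P_def by (rule disjointed_subset)
  have Pdis: "disjoint_family P" unfolding P_def by (rule disjoint_family_disjointed)
  have PU: "(\<Union>i. P i) = (\<Union>i. K i)" unfolding P_def by (rule UN_disjointed_eq)
  \<comment> \<open>The kernel has to be Borel in \<open>x\<close>, so the Lebesgue measurable
    quotient of \<rho> and the Jacobian is replaced by a Borel function \<open>f\<close>, equal to
    it off \<open>Nf\<close>.\<close>
  let ?g = "\<lambda>y. if y \<in> - E then det (matrix (F' y)) else 0"
  have gm: "?g \<in> borel_measurable lebesgue" by (rule Jacobian_measurable[OF E der])
  have "(\<lambda>y. ennreal (\<rho> y / \<bar>?g y\<bar>)) \<in> borel_measurable (completion lborel)"
    using \<rho>m gm by measurable
  then obtain f where fm [measurable]: "f \<in> borel_measurable borel"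
    and f: "AE y in lborel. ennreal (\<rho> y / \<bar>?g y\<bar>) = f y"
    using completion_ex_borel_measurable[of "\<lambda>y. ennreal (\<rho> y / \<bar>?g y\<bar>)" lborel] by auto
  obtain Nf where Nf': "{y \<in> space lborel. \<not> ennreal (\<rho> y / \<bar>?g y\<bar>) = f y} \<subseteq> Nf"
      "emeasure lborel Nf = 0" "Nf \<in> sets lborel"
    using f by (rule AE_E)
  have Nf: "Nf \<in> null_sets lborel" "{y. ennreal (\<rho> y / \<bar>?g y\<bar>) \<noteq> f y} \<subseteq> Nf"
    using Nf' by (simp_all add: null_sets_def)
  have negNf: "negligible Nf" using Nf(1) by (simp add: negligible_iff_null_sets null_sets_completionI)
  have fS: "f y = ennreal (\<rho> y / J y)" if "y \<in> ?S" "y \<notin> Nf" for y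
  proof -
    have "ennreal (\<rho> y / \<bar>?g y\<bar>) = f y" using Nf(2) that(2) by blast
    then show ?thesis using that(1) by (simp add: J_def)
  qed
  have Jf: "ennreal (J y) * f y = ennreal (\<rho> y)" if "y \<in> ?S" "y \<notin> Nf" for y
    unfolding fS[OF that] using that(1) \<rho>0[of y] by (subst ennreal_mult[symmetric]) (simp_all add: J_def)
  define h where "h i = section_on F (K i)" for i
  have hm [measurable]: "h i \<in> borel_measurable borel" for i
    unfolding h_def by (rule section_on_borel(1)[OF F K(1,2)])
  have FK [measurable]: "F ` K i \<in> sets borel" for i
    by (rule section_on_borel(2)[OF F K(1,2)])
  \<comment> \<open>The mass placed by the piece \<open>i\<close> on the fibre over
    \<open>x\<close>: nonzero only if the preimage of \<open>x\<close> in \<open>K i\<close> belongs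
    to the disjoint part \<open>P i\<close>.\<close>
  define w where "w i x = indicator (F ` K i) x * (indicator (P i) (h i x) * f (h i x))" for i x
  have wm [measurable]: "w i \<in> borel_measurable borel" for i
    unfolding w_def[abs_def] by measurable
  define k where "k x = distr (density (count_space UNIV) (\<lambda>i. w i x)) borel (\<lambda>i. G (h i x))" for x
  have k_em: "emeasure (k x) B = (\<integral>\<^sup>+i. w i x * indicator B (G (h i x)) \<partial>count_space UNIV)"
    if "B \<in> sets borel" for x B
    unfolding k_def using that
    by (subst emeasure_distr) (auto simp: emeasure_density indicator_def intro!: nn_integral_cong)
  have PairA: "Pair x -` A \<in> sets borel" if "A \<in> sets borel" for x :: "real^'n" and A :: "((real^'n) \<times> (real^'n)) set"
  proof -
    have "(\<lambda>b. (x, b)) \<in> borel_measurable (borel :: (real^'n) measure)" by measurable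
    from measurable_sets[OF this that] show ?thesis by simp
  qed
  have k_A: "emeasure (k x) (Pair x -` A) = (\<Sum>i. w i x * indicator A (x, G (h i x)))"
    if "A \<in> sets borel" for x A
    unfolding k_em[OF PairA[OF that]] nn_integral_count_space_nat by (simp add: indicator_def)
  have indm: "(\<lambda>x. indicator A (x, G (h i x)) :: ennreal) \<in> borel_measurable borel"
    if [measurable]: "A \<in> sets borel" for A i
    by measurable
  show thesis
  proof (rule that[of k])
    show "sets (k x) = sets borel" for x by (simp add: k_def)
    show "(\<lambda>x. emeasure (k x) (Pair x -` A)) \<in> borel_measurable borel" if A: "A \<in> sets borel" for A
      unfolding k_A[OF A] by (intro borel_measurable_suminf_order borel_measurable_times_ennreal wm indm A)
    show "(\<integral>\<^sup>+y. ennreal (\<rho> y) * indicator A (F y, G y) \<partial>lebesgue) =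
       (\<integral>\<^sup>+x. emeasure (k x) (Pair x -` A) \<partial>lborel)" if A: "A \<in> sets borel" for A
    proof -
      note [measurable] = A
      define \<phi> where "\<phi> i y = indicator (P i) y * f y * indicator A (F y, G y)" for i y
      have \<phi>m: "\<phi> i \<in> borel_measurable borel" for i
        unfolding \<phi>_def[abs_def] by measurable
      have "(\<integral>\<^sup>+x. emeasure (k x) (Pair x -` A) \<partial>lborel) = (\<Sum>i. \<integral>\<^sup>+x. w i x * indicator A (x, G (h i x)) \<partial>lborel)"
        unfolding k_A[OF A] by (rule nn_integral_suminf) (use indm[OF A] wm in \<open>auto intro!: borel_measurable_times_ennreal\<close>)
      also have "\<dots> = (\<Sum>i. \<integral>\<^sup>+y. indicator (P i) y * (ennreal (\<rho> y) * indicator A (F y, G y)) \<partial>lebesgue)"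
      proof (rule suminf_cong)
        fix i
        have derK: "(F has_derivative F' y) (at y)" if "y \<in> K i" for y
          using subsetD[OF K(3) that] der by simp
        have "(\<integral>\<^sup>+x. w i x * indicator A (x, G (h i x)) \<partial>lborel) = (\<integral>\<^sup>+x. indicator (F ` K i) x * \<phi> i (h i x) \<partial>lborel)"
        proof (rule nn_integral_cong)
          fix x
          show "w i x * indicator A (x, G (h i x)) = indicator (F ` K i) x * \<phi> i (h i x)"
            using section_on_mem[of x F "K i"]
            by (cases "x \<in> F ` K i") (simp_all add: w_def \<phi>_def h_def mult.assoc)
        qed
        also have "\<dots> = (\<integral>\<^sup>+y. indicator (K i) y * ennreal (J y) * \<phi> i y \<partial>lebesgue)"
          unfolding h_def J_def by (rule area_formula_piece(2)[OF F K(1,2) derK \<phi>m, symmetric])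
        also have "\<dots> = (\<integral>\<^sup>+y. indicator (P i) y * (ennreal (\<rho> y) * indicator A (F y, G y)) \<partial>lebesgue)"
        proof (rule nn_integral_cong_AE)
          have "AE y in lebesgue. y \<notin> Nf"
            using negNf by (intro AE_not_in) (simp add: negligible_iff_null_sets)
          then show "AE y in lebesgue. indicator (K i) y * ennreal (J y) * \<phi> i y =
              indicator (P i) y * (ennreal (\<rho> y) * indicator A (F y, G y))"
          proof (rule AE_mp, intro AE_I2 impI)
            fix y assume y: "y \<notin> Nf"
            show "indicator (K i) y * ennreal (J y) * \<phi> i y = indicator (P i) y * (ennreal (\<rho> y) * indicator A (F y, G y))"
            proof (cases "y \<in> P i")
              case True
              then have yK: "y \<in> K i" by (rule subsetD[OF PK])
              then have "y \<in> ?S" by (rule subsetD[OF K(3)])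
              from Jf[OF this y] show ?thesis using True yK by (simp add: \<phi>_def mult.assoc[symmetric])
            qed (simp add: \<phi>_def)
          qed
        qed
        finally show "(\<integral>\<^sup>+x. w i x * indicator A (x, G (h i x)) \<partial>lborel) =
            (\<integral>\<^sup>+y. indicator (P i) y * (ennreal (\<rho> y) * indicator A (F y, G y)) \<partial>lebesgue)" .
      qed
      also have "\<dots> = (\<integral>\<^sup>+y. (\<Sum>i. indicator (P i) y * (ennreal (\<rho> y) * indicator A (F y, G y))) \<partial>lebesgue)"
      proof (rule nn_integral_suminf[symmetric])
        fix i
        have "(\<lambda>y. indicator A (F y, G y) :: ennreal) \<in> borel_measurable lebesgue"
          by (rule measurable_completion) measurable
        moreover have "(indicator (P i) :: _ \<Rightarrow> ennreal) \<in> borel_measurable lebesgue"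
          by (rule borel_measurable_indicator) simp
        moreover have "(\<lambda>y. ennreal (\<rho> y)) \<in> borel_measurable lebesgue"
          using \<rho>m by measurable
        ultimately show "(\<lambda>y. indicator (P i) y * (ennreal (\<rho> y) * indicator A (F y, G y))) \<in> borel_measurable lebesgue"
          by (intro borel_measurable_times_ennreal)
      qed
      also have "\<dots> = (\<integral>\<^sup>+y. indicator (\<Union>i. P i) y * (ennreal (\<rho> y) * indicator A (F y, G y)) \<partial>lebesgue)"
        using suminf_indicator[OF Pdis] by (simp add: ennreal_suminf_multc)
      \<comment> \<open>Almost every point outside the pieces is critical, where \<rho> vanishes by
        hypothesis; no mass is lost by restricting to the pieces.\<close>
      also have "\<dots> = (\<integral>\<^sup>+y. ennreal (\<rho> y) * indicator A (F y, G y) \<partial>lebesgue)"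
      proof (rule nn_integral_cong_AE)
        have 1: "AE y in lebesgue. y \<notin> E"
          using E by (intro AE_not_in) (simp add: negligible_iff_null_sets)
        have 2: "AE y in lebesgue. y \<notin> ?S - (\<Union>i. K i)"
          using K(4) by (intro AE_not_in) (simp add: negligible_iff_null_sets)
        from 1 2 \<rho>Z show "AE y in lebesgue. indicator (\<Union>i. P i) y * (ennreal (\<rho> y) * indicator A (F y, G y)) =
            ennreal (\<rho> y) * indicator A (F y, G y)"
        proof eventually_elim
          case (elim y)
          show ?case
          proof (cases "y \<in> (\<Union>i. P i)")
            case False
            then have "y \<notin> ?S" using elim(2) PU by blast
            then have "J y = 0" using elim(1) by (simp add: J_def)
            then have "\<rho> y = 0" using elim(1,3) by simp
            then show ?thesis by simp
          qed simp
        qed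
      qed
      finally show ?thesis by simp
    qed
    \<comment> \<open>The pointwise formula is claimed for almost every \<open>x\<close>, so
      exceptional sets of points \<open>y\<close> must have null images; condition (N) and the lemma
      on critical values provide this. Off these images every fibre point is regular, covered by a
      piece and outside \<open>Nf\<close>.\<close>
    have "negligible ((?S - (\<Union>i. K i)) \<union> Nf)"
      by (rule negligible_Un[OF K(4) negNf])
    note neg1 = N[OF this]
    have neg2: "negligible (F ` ({y. y \<notin> E \<and> \<bar>det (matrix (F' y))\<bar> = 0} \<union> E))"
      by (rule critical_values_negligible[OF E]) (rule der N, assumption)+
    have "AE x in lebesgue. x \<notin> F ` ((?S - (\<Union>i. K i)) \<union> Nf) \<union> F ` ({y. y \<notin> E \<and> \<bar>det (matrix (F' y))\<bar> = 0} \<union> E)"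
      using negligible_Un[OF neg1 neg2] by (intro AE_not_in) (simp only: negligible_iff_null_sets)
    then show "AE x in lebesgue. \<forall>B\<in>sets borel. emeasure (k x) B =
       (\<Sum>\<^sub>\<infinity>y\<in>F -` {x}. ennreal (\<rho> y / J y) * indicator B (G y))"
    proof (rule AE_mp, intro AE_I2 impI ballI)
      fix x and B :: "(real^'n) set"
      assume x: "x \<notin> F ` ((?S - (\<Union>i. K i)) \<union> Nf) \<union> F ` ({y. y \<notin> E \<and> \<bar>det (matrix (F' y))\<bar> = 0} \<union> E)"
        and B: "B \<in> sets borel"
      have fib: "y \<in> ?S \<and> y \<notin> Nf \<and> y \<in> (\<Union>i. P i)" if y: "y \<in> F -` {x}" for y
      proof -
        have Fy: "F y = x" using y by simp
        have "y \<notin> {y. y \<notin> E \<and> \<bar>det (matrix (F' y))\<bar> = 0} \<union> E" using x Fy by blast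
        then have S: "y \<in> ?S" by auto
        have "y \<notin> (?S - (\<Union>i. K i)) \<union> Nf" using x Fy by blast
        then show ?thesis using S PU by blast
      qed
      \<comment> \<open>The pieces that meet the fibre in their disjoint part. They enumerate the
        fibre without repetition, which turns the sum over pieces into the sum over the
        fibre.\<close>
      define I where "I = {i. x \<in> F ` K i \<and> h i x \<in> P i}"
      have bij: "bij_betw (\<lambda>i. h i x) I (F -` {x})"
      proof (rule bij_betw_imageI)
        show "inj_on (\<lambda>i. h i x) I"
        proof (rule inj_onI)
          fix i j assume ij: "i \<in> I" "j \<in> I" "h i x = h j x"
          then have "h i x \<in> P i \<inter> P j" by (simp add: I_def)
          then show "i = j" using Pdis unfolding disjoint_family_on_def by blast
        qed
        show "(\<lambda>i. h i x) ` I = F -` {x}"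
        proof
          show "(\<lambda>i. h i x) ` I \<subseteq> F -` {x}"
            using section_on_mem[of x F] by (auto simp: I_def h_def)
          show "F -` {x} \<subseteq> (\<lambda>i. h i x) ` I"
          proof
            fix y assume y: "y \<in> F -` {x}"
            then obtain i where i: "y \<in> P i" using fib by blast
            then have yK: "y \<in> K i" by (rule subsetD[OF PK])
            have Fy: "F y = x" using y by simp
            have hy: "h i x = y" unfolding h_def Fy[symmetric] by (rule section_on_eq[OF K(2) yK])
            have "x \<in> F ` K i" using yK Fy by blast
            then have "i \<in> I" using i by (simp add: I_def hy)
            then show "y \<in> (\<lambda>i. h i x) ` I" using hy by blast
          qed
        qed
      qed
      have "(\<Sum>\<^sub>\<infinity>y\<in>F -` {x}. ennreal (\<rho> y / J y) * indicator B (G y))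
        = (\<Sum>\<^sub>\<infinity>i\<in>I. ennreal (\<rho> (h i x) / J (h i x)) * indicator B (G (h i x)))"
        by (rule infsum_reindex_bij_betw[OF bij, symmetric])
      also have "\<dots> = (\<Sum>\<^sub>\<infinity>i\<in>UNIV. w i x * indicator B (G (h i x)))"
      proof (rule infsum_cong_neutral)
        fix i assume "i \<in> UNIV - I"
        then show "w i x * indicator B (G (h i x)) = 0"
          by (auto simp: I_def w_def indicator_def)
      next
        fix i assume "i \<in> I \<inter> UNIV"
        then have i: "i \<in> I" by simp
        then have "h i x \<in> F -` {x}" using bij by (auto simp: bij_betw_def)
        from fib[OF this] have "f (h i x) = ennreal (\<rho> (h i x) / J (h i x))"
          by (intro fS) auto
        then show "ennreal (\<rho> (h i x) / J (h i x)) * indicator B (G (h i x)) = w i x * indicator B (G (h i x))"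
          using i by (simp add: I_def w_def)
      qed simp
      also have "\<dots> = emeasure (k x) B"
        unfolding k_em[OF B] by (rule infsum_ennreal_nat)
      finally show "emeasure (k x) B = (\<Sum>\<^sub>\<infinity>y\<in>F -` {x}. ennreal (\<rho> y / J y) * indicator B (G y))" by simp
    qed
  qed
qed

section \<open>Vector fields with gradient in a Lorentz space\<close>

text \<open>Changing a derivative on a null set alters neither its integrals nor its distribution
  function, so a Borel representative inherits both the weak formulation and the Lorentz
  condition.\<close>

lemma weak_partial_borel:
  fixes f g :: "real^'n \<Rightarrow> real"
  assumes f: "continuous_on UNIV f" and \<Omega>: "open \<Omega>" and wp: "weak_partial \<Omega> f l g" and lor: "lorentz_N1 \<Omega> g"
  shows "\<exists>g'. g' \<in> borel_measurable borel \<and>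
    (\<forall>K. compact K \<longrightarrow> K \<subseteq> \<Omega> \<longrightarrow> integrable lborel (\<lambda>y. indicator K y * g' y)) \<and>
    (\<forall>\<phi>. test_fun \<Omega> \<phi> \<longrightarrow> (\<integral>y. f y * frechet_derivative \<phi> (at y) (axis l 1) \<partial>lborel) = - (\<integral>y. g' y * \<phi> y \<partial>lborel)) \<and>
    (\<integral>\<^sup>+s. indicator {0<..} s * ennreal (measure lborel {x\<in>\<Omega>. s \<le> \<bar>g' x\<bar>} powr (1 / CARD('n))) \<partial>lborel) < \<infinity>"
proof -
  have \<Omega>b [measurable]: "\<Omega> \<in> sets borel" using \<Omega> by simp
  have \<Omega>l: "\<Omega> \<in> sets lebesgue" by simp
  have gm: "g \<in> borel_measurable (lebesgue_on \<Omega>)" using lor by (simp add: lorentz_N1_def)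
  \<comment> \<open>Measurability of \<open>g\<close> is known on \<Omega> only. The extension by 0
    is harmless because test functions vanish outside \<Omega>.\<close>
  define g0 where "g0 x = (if x \<in> \<Omega> then g x else 0)" for x
  have g0m: "g0 \<in> borel_measurable (completion lborel)"
    unfolding g0_def[abs_def] by (rule borel_measurable_if_I[OF gm \<Omega>l])
  have "\<exists>g'\<in>borel_measurable lborel. (AE x in lborel. g0 x = g' x)"
    by (rule completion_ex_borel_measurable_real[OF g0m])
  then obtain g' where g'0: "g' \<in> borel_measurable lborel" and ae0: "AE x in lborel. g0 x = g' x" ..
  have g' [measurable]: "g' \<in> borel_measurable borel" using g'0 by simp
  have ae: "AE x in lebesgue. g0 x = g' x" using ae0 by (rule AE_completion)
  show ?thesis
  proof (rule exI[of _ g'], intro conjI allI impI)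
    show "g' \<in> borel_measurable borel" by (rule g')
  next
    fix K assume K: "compact K" "K \<subseteq> \<Omega>"
    then have "integrable (lebesgue_on K) g" using wp by (simp add: weak_partial_def)
    moreover have Kb [measurable]: "K \<in> sets borel" using K(1) by (simp add: borel_compact)
    ultimately have "integrable lebesgue (\<lambda>y. indicator K y *\<^sub>R g y)"
      using integrable_restrict_space[of K lebesgue g] by simp
    moreover have "(\<lambda>y. indicator K y *\<^sub>R g y) = (\<lambda>y. indicator K y * g0 y)"
      using K(2) by (auto simp: fun_eq_iff g0_def indicator_def)
    ultimately have i: "integrable lebesgue (\<lambda>y. indicator K y * g0 y)" by simp
    have bm: "(\<lambda>y. indicator K y * g' y) \<in> borel_measurable lborel" by measurable
    have "integrable lebesgue (\<lambda>y. indicator K y * g' y)"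
    proof (rule integrable_cong_AE_imp[OF i])
      show "(\<lambda>y. indicator K y * g' y) \<in> borel_measurable lebesgue" using bm by (rule measurable_completion)
      show "AE y in lebesgue. indicator K y * g0 y = indicator K y * g' y"
        using ae by eventually_elim simp
    qed
    then show "integrable lborel (\<lambda>y. indicator K y * g' y)"
      using integrable_completion[OF bm] by simp
  next
    fix \<phi> assume \<phi>: "test_fun \<Omega> \<phi>"
    then have sm: "smooth_fun \<phi>" by (simp add: test_fun_def)
    have "Ck 0 \<phi>" using sm unfolding smooth_fun_def by blast
    then have \<phi>m [measurable]: "\<phi> \<in> borel_measurable borel" by (intro borel_measurable_continuous_onI) simp
    have "Ck (Suc 0) \<phi>" using sm unfolding smooth_fun_def by blast
    then have [measurable]: "(\<lambda>y. frechet_derivative \<phi> (at y) (axis l 1)) \<in> borel_measurable borel"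
      by (intro borel_measurable_continuous_onI) simp
    have [measurable]: "f \<in> borel_measurable borel" using f by (rule borel_measurable_continuous_onI)
    have out: "\<phi> y = 0" if "y \<notin> \<Omega>" for y
    proof (rule ccontr)
      assume "\<phi> y \<noteq> 0"
      then have "y \<in> supp_cl \<phi>" unfolding supp_cl_def by (intro subsetD[OF closure_subset]) simp
      then show False using \<phi> that by (auto simp: test_fun_def)
    qed
    have "(\<integral>y. f y * frechet_derivative \<phi> (at y) (axis l 1) \<partial>lborel)
        = (\<integral>y. f y * frechet_derivative \<phi> (at y) (axis l 1) \<partial>lebesgue)"
      by (rule integral_completion[symmetric]) measurable
    also have "\<dots> = - (\<integral>y. g y * \<phi> y \<partial>lebesgue)"
      using wp \<phi> by (simp add: weak_partial_def)
    also have "(\<integral>y. g y * \<phi> y \<partial>lebesgue) = (\<integral>y. g0 y * \<phi> y \<partial>lebesgue)"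
      by (rule Bochner_Integration.integral_cong) (simp_all add: g0_def out)
    also have "\<dots> = (\<integral>y. g' y * \<phi> y \<partial>lebesgue)"
    proof (rule integral_cong_AE)
      show "(\<lambda>y. g0 y * \<phi> y) \<in> borel_measurable lebesgue"
        using g0m measurable_completion[of \<phi> lborel borel] by (intro borel_measurable_times) simp_all
      show "(\<lambda>y. g' y * \<phi> y) \<in> borel_measurable lebesgue"
        by (rule measurable_completion) measurable
      show "AE y in lebesgue. g0 y * \<phi> y = g' y * \<phi> y"
        using ae by eventually_elim simp
    qed
    also have "\<dots> = (\<integral>y. g' y * \<phi> y \<partial>lborel)"
      by (rule integral_completion) measurable
    finally show "(\<integral>y. f y * frechet_derivative \<phi> (at y) (axis l 1) \<partial>lborel) = - (\<integral>y. g' y * \<phi> y \<partial>lborel)" .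
  next
    have "measure lebesgue {x\<in>\<Omega>. s \<le> \<bar>g x\<bar>} = measure lborel {x\<in>\<Omega>. s \<le> \<bar>g' x\<bar>}" for s
    proof -
      have 1: "{x\<in>\<Omega>. s \<le> \<bar>g' x\<bar>} \<in> sets lborel" by measurable
      have "{x \<in> space lebesgue. s \<le> \<bar>g0 x\<bar>} \<in> sets lebesgue" using g0m by measurable
      then have "{x. s \<le> \<bar>g0 x\<bar>} \<in> sets lebesgue" by simp
      from sets.Int[OF \<Omega>l this] have "\<Omega> \<inter> {x. s \<le> \<bar>g0 x\<bar>} \<in> sets lebesgue" .
      moreover have "\<Omega> \<inter> {x. s \<le> \<bar>g0 x\<bar>} = {x\<in>\<Omega>. s \<le> \<bar>g x\<bar>}" by (auto simp: g0_def)
      ultimately have 2: "{x\<in>\<Omega>. s \<le> \<bar>g x\<bar>} \<in> sets lebesgue" by simp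
      have 3: "AE x in lebesgue. x \<in> {x\<in>\<Omega>. s \<le> \<bar>g x\<bar>} \<longleftrightarrow> x \<in> {x\<in>\<Omega>. s \<le> \<bar>g' x\<bar>}"
        using ae by eventually_elim (simp add: g0_def split: if_splits)
      have 4: "{x\<in>\<Omega>. s \<le> \<bar>g' x\<bar>} \<in> sets lebesgue" using 1 by (rule sets_completionI_sets)
      have "measure lebesgue {x\<in>\<Omega>. s \<le> \<bar>g x\<bar>} = measure lebesgue {x\<in>\<Omega>. s \<le> \<bar>g' x\<bar>}"
        by (rule measure_eq_AE[OF 3 2 4])
      also have "\<dots> = measure lborel {x\<in>\<Omega>. s \<le> \<bar>g' x\<bar>}" by (rule measure_completion[OF 1])
      finally show ?thesis .
    qed
    then show "(\<integral>\<^sup>+s. indicator {0<..} s * ennreal (measure lborel {x\<in>\<Omega>. s \<le> \<bar>g' x\<bar>} powr (1 / CARD('n))) \<partial>lborel) < \<infinity>"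
      using lor by (simp add: lorentz_N1_def)
  qed
qed

text \<open>A single \<open>R\<close> and \<open>M\<close> for all partial derivatives gives every
  component of \<open>U\<close> the oscillation bound with the same constant.\<close>

lemma lorentz_gradient:
  fixes U :: "real^'n \<Rightarrow> real^'n"
  assumes U: "continuous_on UNIV U" and \<Omega>: "open \<Omega>" "bounded \<Omega>"
    and lor: "\<And>k l. \<exists>g. weak_partial \<Omega> (\<lambda>y. U y $ k) l g \<and> lorentz_N1 \<Omega> g"
  obtains R M g where "R \<in> borel_measurable borel" "\<And>\<sigma>. exp (- \<sigma>) \<le> R \<sigma>" "0 < M"
    "(\<integral>\<^sup>+\<sigma>. indicator {0<..} \<sigma> * ennreal (R \<sigma>) \<partial>lborel) \<le> ennreal M"
    "\<And>k. weak_gradient (\<lambda>y. U y $ k) (g k) \<Omega>"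
    "\<And>k l. (\<integral>\<^sup>+y. indicator \<Omega> y * layer_weight (CARD('n) - 1) R (2 * \<bar>g k l y\<bar>) \<partial>lborel) \<le> ennreal M"
proof -
  define Q where "Q = (\<lambda>(k :: 'n, l :: 'n) g'. g' \<in> borel_measurable borel \<and>
    (\<forall>K. compact K \<longrightarrow> K \<subseteq> \<Omega> \<longrightarrow> integrable lborel (\<lambda>y. indicator K y * g' y)) \<and>
    (\<forall>\<phi>. test_fun \<Omega> \<phi> \<longrightarrow> (\<integral>y. U y $ k * frechet_derivative \<phi> (at y) (axis l 1) \<partial>lborel) = - (\<integral>y. g' y * \<phi> y \<partial>lborel)) \<and>
    (\<integral>\<^sup>+s. indicator {0<..} s * ennreal (measure lborel {x\<in>\<Omega>. s \<le> \<bar>g' x\<bar>} powr (1 / CARD('n))) \<partial>lborel) < \<infinity>)"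
  have Uk: "continuous_on UNIV (\<lambda>y. U y $ k)" for k
    using U by (rule continuous_on_component)
  have "\<exists>g'. Q (k, l) g'" for k l
  proof -
    obtain g where "weak_partial \<Omega> (\<lambda>y. U y $ k) l g \<and> lorentz_N1 \<Omega> g" using lor ..
    then show ?thesis
      unfolding Q_def prod.case by (intro weak_partial_borel[OF Uk \<Omega>(1), of k l g]) simp_all
  qed
  then have "\<forall>p. \<exists>g'. Q p g'" by simp
  from choice[OF this] obtain G where G: "\<forall>p. Q p (G p)" ..
  have Gp: "G p \<in> borel_measurable borel"
    "(\<integral>\<^sup>+s. indicator {0<..} s * ennreal (measure lborel {x\<in>\<Omega>. s \<le> \<bar>G p x\<bar>} powr (1 / CARD('n))) \<partial>lborel) < \<infinity>" for p
    using spec[OF G, of p] by (simp_all add: Q_def split_beta)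
  have \<Omega>f: "\<Omega> \<in> sets borel" "emeasure lborel \<Omega> < \<infinity>"
    using \<Omega> emeasure_bounded_finite by auto
  obtain R M where RM: "R \<in> borel_measurable borel" "\<And>\<sigma>. exp (- \<sigma>) \<le> R \<sigma>" "0 < M"
    "(\<integral>\<^sup>+\<sigma>. indicator {0<..} \<sigma> * ennreal (R \<sigma>) \<partial>lborel) \<le> ennreal M"
    "\<And>p. p \<in> (UNIV :: ('n \<times> 'n) set) \<Longrightarrow>
      (\<integral>\<^sup>+y. indicator \<Omega> y * layer_weight (CARD('n) - 1) R (2 * \<bar>G p y\<bar>) \<partial>lborel) \<le> ennreal M"
    by (rule lorentz_weight[of "UNIV :: ('n \<times> 'n) set" G, OF finite Gp(1) \<Omega>f Gp(2)]) (rule that)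
  show thesis
  proof (rule that[of R M "\<lambda>k l. G (k, l)"])
    show "weak_gradient (\<lambda>y. U y $ k) (\<lambda>l. G (k, l)) \<Omega>" for k
    proof
      show "continuous_on UNIV (\<lambda>y. U y $ k)" by (rule Uk)
      show "G (k, l) \<in> borel_measurable borel" for l by (rule Gp(1))
      show "integrable lborel (\<lambda>y. indicator K y * G (k, l) y)" if "compact K" "K \<subseteq> \<Omega>" for l K
        using spec[OF G, of "(k, l)"] that by (simp add: Q_def)
      show "(\<integral>y. U y $ k * frechet_derivative \<phi> (at y) (axis l 1) \<partial>lborel) = - (\<integral>y. G (k, l) y * \<phi> y \<partial>lborel)"
        if "test_fun \<Omega> \<phi>" for l \<phi>
        using spec[OF G, of "(k, l)"] that by (simp add: Q_def)
    qed
    show "(\<integral>\<^sup>+y. indicator \<Omega> y * layer_weight (CARD('n) - 1) R (2 * \<bar>G (k, l) y\<bar>) \<partial>lborel) \<le> ennreal M" for k l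
      by (rule RM(5)) simp
  qed (rule RM(1-4))+
qed

lemma differentiable_componentwise_vec:
  fixes U :: "real^'n \<Rightarrow> real^'m"
  assumes "\<And>k. (\<lambda>y. U y $ k) differentiable (at x)"
  shows "U differentiable (at x)"
  using assms by (subst differentiable_componentwise_within) (auto simp: Basis_vec_def inner_axis)

text \<open>The Lorentz hypothesis is local; balls of integer radius exhaust the space, and finitely
  many components are treated together.\<close>

lemma negligible_nondiff_set:
  fixes U :: "real^'n \<Rightarrow> real^'n"
  assumes U: "continuous_on UNIV U"
    and lor: "\<And>\<Omega> k l. open \<Omega> \<Longrightarrow> bounded \<Omega> \<Longrightarrow> \<exists>g. weak_partial \<Omega> (\<lambda>y. U y $ k) l g \<and> lorentz_N1 \<Omega> g"
  shows "negligible (nondiff_set U)"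
proof -
  have "AE x in lebesgue. x \<in> ball 0 (real m) \<longrightarrow> U differentiable (at x)" for m :: nat
  proof -
    let ?\<Omega> = "ball 0 (real m) :: (real^'n) set"
    have fin: "emeasure lborel ?\<Omega> < \<infinity>" using emeasure_bounded_finite by auto
    obtain R M g where *: "R \<in> borel_measurable borel" "\<And>\<sigma>. exp (- \<sigma>) \<le> R \<sigma>" "0 < M"
      "(\<integral>\<^sup>+\<sigma>. indicator {0<..} \<sigma> * ennreal (R \<sigma>) \<partial>lborel) \<le> ennreal M"
      "\<And>k. weak_gradient (\<lambda>y. U y $ k) (g k) ?\<Omega>"
      "\<And>k l. (\<integral>\<^sup>+y. indicator ?\<Omega> y * layer_weight (CARD('n) - 1) R (2 * \<bar>g k l y\<bar>) \<partial>lborel) \<le> ennreal M"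
      by (rule lorentz_gradient[OF U open_ball bounded_ball lor[OF open_ball bounded_ball]]) (rule that)
    have "AE x in lebesgue. x \<in> ?\<Omega> \<longrightarrow> (\<lambda>y. U y $ k) differentiable (at x)" for k
      by (rule weak_gradient.AE_differentiable[OF *(5) *(1) open_ball fin *(2) *(4) *(3) *(6)])
    then have "AE x in lebesgue. \<forall>k. x \<in> ?\<Omega> \<longrightarrow> (\<lambda>y. U y $ k) differentiable (at x)"
      by (subst AE_all_countable) simp
    then show ?thesis
    proof (rule AE_mp, intro AE_I2 impI)
      fix x assume "\<forall>k. x \<in> ?\<Omega> \<longrightarrow> (\<lambda>y. U y $ k) differentiable (at x)" "x \<in> ?\<Omega>"
      then show "U differentiable (at x)" by (intro differentiable_componentwise_vec) simp
    qed
  qed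
  then have "AE x in lebesgue. \<forall>m::nat. x \<in> ball 0 (real m) \<longrightarrow> U differentiable (at x)"
    by (subst AE_all_countable) simp
  then have "AE x in lebesgue. x \<notin> nondiff_set U"
  proof (rule AE_mp, intro AE_I2 impI)
    fix x :: "real^'n" assume *: "\<forall>m::nat. x \<in> ball 0 (real m) \<longrightarrow> U differentiable (at x)"
    obtain m :: nat where "norm x < real m" using reals_Archimedean2 by blast
    then have "x \<in> ball 0 (real m)" by simp
    with spec[OF *, of m] have "U differentiable (at x)" by blast
    then show "x \<notin> nondiff_set U" by (simp add: nondiff_set_def)
  qed
  then obtain N where "{x \<in> space lebesgue. \<not> x \<notin> nondiff_set U} \<subseteq> N" "emeasure lebesgue N = 0" "N \<in> sets lebesgue"
    by (rule AE_E)
  then show ?thesis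
    by (intro negligible_subset[of N "nondiff_set U"]) (simp_all add: negligible_iff_null_sets null_sets_def)
qed

text \<open>One density controls both terms in the bound on \<open>F\<close>: the weights of the
  components control the oscillation of \<open>U\<close>, and the summand 1 controls the
  displacement in \<open>x\<close> through the volume of the cube.\<close>

lemma negligible_image_of_lorentz_gradient:
  fixes U F :: "real^'n \<Rightarrow> real^'n"
  assumes U: "continuous_on UNIV U"
    and lor: "\<And>\<Omega> k l. open \<Omega> \<Longrightarrow> bounded \<Omega> \<Longrightarrow> \<exists>g. weak_partial \<Omega> (\<lambda>y. U y $ k) l g \<and> lorentz_N1 \<Omega> g"
    and F: "\<And>x y. norm (F x - F y) \<le> L * (norm (x - y) + norm (U x - U y))" and L: "L > 0"
    and A: "negligible A"
  shows "negligible (F ` A)"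
proof -
  define n where "n = CARD('n)"
  have n: "n > 0" by (simp add: n_def)
  have "negligible (F ` (A \<inter> ball 0 (real m)))" for m :: nat
  proof -
    let ?\<Omega> = "ball 0 (real m) :: (real^'n) set"
    have fin: "emeasure lborel ?\<Omega> < \<infinity>" using emeasure_bounded_finite by auto
    have \<Omega>b: "?\<Omega> \<in> sets borel" by simp
    obtain R M g where *: "R \<in> borel_measurable borel" "\<And>\<sigma>. exp (- \<sigma>) \<le> R \<sigma>" "0 < M"
      "(\<integral>\<^sup>+\<sigma>. indicator {0<..} \<sigma> * ennreal (R \<sigma>) \<partial>lborel) \<le> ennreal M"
      "\<And>k. weak_gradient (\<lambda>y. U y $ k) (g k) ?\<Omega>"
      "\<And>k l. (\<integral>\<^sup>+y. indicator ?\<Omega> y * layer_weight (CARD('n) - 1) R (2 * \<bar>g k l y\<bar>) \<partial>lborel) \<le> ennreal M"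
      by (rule lorentz_gradient[OF U open_ball bounded_ball lor[OF open_ball bounded_ball]]) (rule that)
    note [measurable] = *(1)
    have gm [measurable]: "g k l \<in> borel_measurable borel" for k l by (rule weak_gradient.g_meas[OF *(5)])
    define w where "w k y = (\<Sum>l\<in>UNIV. layer_weight (CARD('n) - 1) R \<bar>g k l y - 0 $ l\<bar>)" for k and y :: "real^'n"
    have wm [measurable]: "w k \<in> borel_measurable borel" for k
      unfolding w_def[abs_def] by measurable
    define \<Theta> where "\<Theta> y = indicator ?\<Omega> y * (1 + (\<Sum>k\<in>UNIV. w k y))" for y
    define c where "c = 2 * osc_const TYPE('n) * root n (M ^ (n - 1))"
    have "c > 0" using osc_const_pos[where 'n = 'n] *(3) n by (simp add: c_def)
    have "(\<lambda>y. 1 + (\<Sum>k\<in>UNIV. w k y)) \<in> borel_measurable borel" by measurable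
    with borel_measurable_indicator[OF \<Omega>b] have \<Theta>m: "\<Theta> \<in> borel_measurable borel"
      unfolding \<Theta>_def[abs_def] by (intro borel_measurable_times_ennreal)
    have \<Omega>wm: "(\<lambda>y. indicator ?\<Omega> y * w k y) \<in> borel_measurable borel" for k
      by (rule borel_measurable_times_ennreal[OF borel_measurable_indicator[OF \<Omega>b] wm])
    have \<Theta>w: "w k y \<le> \<Theta> y" if "y \<in> ?\<Omega>" for k y
    proof -
      have "w k y \<le> (\<Sum>k\<in>UNIV. w k y)" by (rule member_le_sum) simp_all
      also have "\<dots> \<le> \<Theta> y" unfolding \<Theta>_def using that by simp
      finally show ?thesis .
    qed
    have \<Theta>1: "1 \<le> \<Theta> y" if "y \<in> ?\<Omega>" for y unfolding \<Theta>_def using that by simp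
    have wfin: "(\<integral>\<^sup>+y. indicator ?\<Omega> y * w k y \<partial>lborel) < \<infinity>" for k
      unfolding w_def by (rule weak_gradient.weight_integrable[OF *(5) *(1) \<Omega>b fin *(2) *(6)])
    have "(\<integral>\<^sup>+y. \<Theta> y \<partial>lborel) = (\<integral>\<^sup>+y. indicator ?\<Omega> y + (\<Sum>k\<in>UNIV. indicator ?\<Omega> y * w k y) \<partial>lborel)"
      unfolding \<Theta>_def distrib_left sum_distrib_left mult_1_right ..
    also have "\<dots> = (\<integral>\<^sup>+y. indicator ?\<Omega> y \<partial>lborel) + (\<integral>\<^sup>+y. (\<Sum>k\<in>UNIV. indicator ?\<Omega> y * w k y) \<partial>lborel)"
    proof (rule nn_integral_add)
      show "(\<lambda>y. indicator ?\<Omega> y :: ennreal) \<in> borel_measurable lborel"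
        using borel_measurable_indicator[OF \<Omega>b] by (simp only: measurable_lborel2)
      show "(\<lambda>y. \<Sum>k\<in>UNIV. indicator ?\<Omega> y * w k y) \<in> borel_measurable lborel"
        using \<Omega>wm by (intro borel_measurable_sum) (simp only: measurable_lborel2)
    qed
    also have "(\<integral>\<^sup>+y. (\<Sum>k\<in>UNIV. indicator ?\<Omega> y * w k y) \<partial>lborel) = (\<Sum>k\<in>UNIV. \<integral>\<^sup>+y. indicator ?\<Omega> y * w k y \<partial>lborel)"
      by (rule nn_integral_sum) (use \<Omega>wm in \<open>simp only: measurable_lborel2\<close>)
    also have "(\<integral>\<^sup>+y. indicator ?\<Omega> y \<partial>lborel) = emeasure lborel ?\<Omega>"
      by (rule nn_integral_indicator) simp
    also have "emeasure lborel ?\<Omega> + (\<Sum>k\<in>UNIV. \<integral>\<^sup>+y. indicator ?\<Omega> y * w k y \<partial>lborel) < \<infinity>"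
      using fin wfin by simp
    finally have \<Theta>fin: "(\<integral>\<^sup>+y. \<Theta> y \<partial>lborel) < \<infinity>" .
    show ?thesis
    \<comment> \<open>The enclosing cube has half side \<open>m + 1\<close>, which is positive also
      for \<open>m = 0\<close>. In the constant, the factors \<open>n\<close> pass from coordinates
      to the norm.\<close>
    proof (rule lusin_N[of \<Theta> ?\<Omega> "L * (n + n * c)" F _ "real m + 1"])
      fix a r x y T
      assume r: "0 < r" and Q: "hcube a r \<subseteq> ?\<Omega>" and xy: "x \<in> hcube a r" "y \<in> hcube a r" and T: "0 < T"
        and I: "(\<integral>\<^sup>+z. indicator (hcube a r) z * \<Theta> z \<partial>lborel) \<le> ennreal T"
      have "\<bar>U x $ k - U y $ k\<bar> \<le> c * root n T" for k
      proof -
        have "(\<integral>\<^sup>+z. indicator (hcube a r) z * w k z \<partial>lborel) \<le> (\<integral>\<^sup>+z. indicator (hcube a r) z * \<Theta> z \<partial>lborel)"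
          using \<Theta>w Q by (intro nn_integral_mono) (auto simp: indicator_def)
        also note I
        finally have I': "(\<integral>\<^sup>+z. indicator (hcube a r) z * w k z \<partial>lborel) \<le> ennreal T" .
        have R0: "0 < R \<sigma>" for \<sigma> using less_le_trans[OF exp_gt_zero *(2)] .
        show ?thesis
          using weak_gradient.oscillation_root[OF *(5) *(1) R0 *(4) *(3) r Q xy I'[unfolded w_def] T]
          by (simp add: c_def n_def)
      qed
      then have "(\<Sum>k\<in>UNIV. \<bar>(U x - U y) $ k\<bar>) \<le> (\<Sum>k\<in>(UNIV :: 'n set). c * root n T)"
        by (intro sum_mono) simp
      then have dU: "norm (U x - U y) \<le> n * (c * root n T)"
        using norm_le_l1_cart[of "U x - U y"] by (simp add: n_def)
      \<comment> \<open>Since \<Theta> is at least 1 on the cube, the volume is at most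
        \<open>T\<close>, so the side is at most the root of \<open>T\<close>.\<close>
      have "ennreal ((2 * r) ^ n) = (\<integral>\<^sup>+z. indicator (hcube a r) z \<partial>lborel)"
        using emeasure_hcube[of r a] r by (simp add: n_def)
      also have "\<dots> \<le> (\<integral>\<^sup>+z. indicator (hcube a r) z * \<Theta> z \<partial>lborel)"
        using \<Theta>1 Q by (intro nn_integral_mono) (auto simp: indicator_def)
      also note I
      finally have "(2 * r) ^ n \<le> T" using T by (simp add: ennreal_le_iff)
      from real_root_le_mono[OF n this] have "root n ((2 * r) ^ n) \<le> root n T" .
      moreover have "root n ((2 * r) ^ n) = 2 * r" using n r by (intro real_root_power_cancel) simp_all
      ultimately have rT: "2 * r \<le> root n T" by (simp only:)
      have "\<bar>(x - y) $ k\<bar> \<le> root n T" for k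
      proof -
        have "\<bar>x $ k - a $ k\<bar> \<le> r" "\<bar>y $ k - a $ k\<bar> \<le> r" using xy by (simp_all add: mem_hcube)
        then show ?thesis using rT by (simp add: vector_minus_component)
      qed
      then have "(\<Sum>k\<in>UNIV. \<bar>(x - y) $ k\<bar>) \<le> (\<Sum>k\<in>(UNIV :: 'n set). root n T)"
        by (intro sum_mono)
      then have dx: "norm (x - y) \<le> n * root n T"
        using norm_le_l1_cart[of "x - y"] by (simp add: n_def)
      have "norm (F x - F y) \<le> L * (norm (x - y) + norm (U x - U y))" by (rule F)
      also have "\<dots> \<le> L * (n * root n T + n * (c * root n T))"
        using dx dU L by simp
      also have "\<dots> = L * (n + n * c) * root CARD('n) T" by (simp add: n_def algebra_simps)
      finally show "norm (F x - F y) \<le> L * (n + n * c) * root CARD('n) T" .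
    next
      show "L * (n + n * c) > 0" using L n \<open>c > 0\<close> by (simp add: add_pos_pos)
      show "A \<inter> ?\<Omega> \<subseteq> hcube 0 (real m + 1)"
        using cball_subset_hcube[of "0 :: real^'n" "real m + 1"] by fastforce
      show "negligible (A \<inter> ?\<Omega>)" using A by (rule negligible_subset) simp
    qed (use \<Theta>m \<Theta>fin \<Theta>1 in \<open>simp_all\<close>)
  qed
  then have "negligible (\<Union>m::nat. F ` (A \<inter> ball 0 (real m)))"
    by (intro negligible_countable_Union) auto
  moreover have "F ` A \<subseteq> (\<Union>m::nat. F ` (A \<inter> ball 0 (real m)))"
  proof
    fix z assume "z \<in> F ` A"
    then obtain x where x: "x \<in> A" "z = F x" by blast
    obtain m :: nat where "norm x < real m" using reals_Archimedean2 by blast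
    then have "x \<in> A \<inter> ball 0 (real m)" using x by simp
    then show "z \<in> (\<Union>m::nat. F ` (A \<inter> ball 0 (real m)))" using x by blast
  qed
  ultimately show ?thesis by (rule negligible_subset)
qed

section \<open>Transport of monokinetic measures\<close>

lemma bounded_linear_ham_field: "bounded_linear (ham_field :: 'a::euclidean_space \<times> 'a \<Rightarrow> 'a \<times> 'a)"
proof -
  have eq: "ham_field = (\<lambda>g :: 'a \<times> 'a. (snd g, - fst g))" by (simp add: ham_field_def fun_eq_iff)
  show ?thesis
    unfolding eq by (intro bounded_linear_Pair bounded_linear_snd bounded_linear_minus bounded_linear_fst)
qed

lemma norm_ham_field: "norm (ham_field p) = norm p"
  by (cases p) (simp add: ham_field_def norm_Pair add.commute)

text \<open>The map \<open>ham_field\<close> is a linear isometry, so the Hamiltonian vector field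
  inherits the continuity of the Hessian and its bound \<kappa>.\<close>

lemma ham_flow_regularity:
  fixes DH :: "'a::euclidean_space \<times> 'a \<Rightarrow> 'a \<times> 'a" and D2H :: "'a \<times> 'a \<Rightarrow> ('a \<times> 'a) \<Rightarrow>\<^sub>L ('a \<times> 'a)"
  assumes H_hess: "\<And>p. (DH has_derivative blinfun_apply (D2H p)) (at p)"
    and H_C2: "continuous_on UNIV D2H" and bound_hess: "\<And>p. norm (D2H p) \<le> \<kappa>"
    and flow0: "\<And>p. \<Phi> 0 p = p"
    and flow_ode: "\<And>p s. ((\<lambda>s. \<Phi> s p) has_vector_derivative ham_field (DH (\<Phi> s p))) (at s)"
  shows "\<Phi> t differentiable (at p)" "norm (\<Phi> t p - \<Phi> t q) \<le> exp ((2 * \<kappa> + 1) * \<bar>t\<bar>) * norm (p - q)"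
proof -
  define JJ :: "('a \<times> 'a) \<Rightarrow>\<^sub>L ('a \<times> 'a)" where "JJ = Blinfun ham_field"
  have JJ: "blinfun_apply JJ = ham_field"
    unfolding JJ_def by (rule bounded_linear_Blinfun_apply[OF bounded_linear_ham_field])
  have nJ: "norm JJ \<le> 1" by (rule norm_blinfun_bound) (simp_all add: JJ norm_ham_field)
  have der: "((\<lambda>p. ham_field (DH p)) has_derivative blinfun_apply (JJ o\<^sub>L D2H q)) (at q)" for q
  proof -
    have "blinfun_apply (JJ o\<^sub>L D2H q) = (\<lambda>x. ham_field (blinfun_apply (D2H q) x))"
      by (simp add: fun_eq_iff JJ)
    then show ?thesis
      using bounded_linear.has_derivative[OF bounded_linear_ham_field H_hess[of q]] by (simp only:)
  qed
  have cont: "continuous_on UNIV (\<lambda>q. JJ o\<^sub>L D2H q)"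
    by (intro continuous_intros H_C2)
  have bound: "norm (JJ o\<^sub>L D2H q) \<le> \<kappa>" for q
  proof -
    have "norm (JJ o\<^sub>L D2H q) \<le> norm JJ * norm (D2H q)" by (rule norm_blinfun_compose)
    also have "\<dots> \<le> 1 * norm (D2H q)" using nJ by (rule mult_right_mono) simp
    also have "\<dots> \<le> \<kappa>" using bound_hess[of q] by simp
    finally show ?thesis .
  qed
  show "\<Phi> t differentiable (at p)"
    by (rule flow_differentiable[OF der cont bound flow0 flow_ode])
  have lip: "norm (ham_field (DH p) - ham_field (DH q)) \<le> \<kappa> * norm (p - q)" for p q
    by (rule differentiable_bound[of UNIV "\<lambda>p. ham_field (DH p)" "\<lambda>q. blinfun_apply (JJ o\<^sub>L D2H q)" \<kappa> p q])
      (use der bound[unfolded norm_blinfun.rep_eq] in auto)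
  have "\<kappa> \<ge> 0" by (rule order_trans[OF norm_ge_zero bound_hess])
  then show "norm (\<Phi> t p - \<Phi> t q) \<le> exp ((2 * \<kappa> + 1) * \<bar>t\<bar>) * norm (p - q)"
    by (rule flow_Lipschitz[OF lip _ flow0 flow_ode])
qed

lemma emeasure_distr_density_lebesgue:
  fixes T :: "real^'n \<Rightarrow> 'b::euclidean_space"
  assumes T: "T \<in> borel_measurable borel" and \<rho>m: "\<rho> \<in> borel_measurable lebesgue" and A: "A \<in> sets borel"
  shows "emeasure (distr (density lebesgue (\<lambda>x. ennreal (\<rho> x))) borel T) A
    = (\<integral>\<^sup>+y. ennreal (\<rho> y) * indicator A (T y) \<partial>lebesgue)"
proof -
  have ind: "indicator (T -` A) y = (indicator A (T y) :: ennreal)" for y by (simp add: indicator_def)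
  have Tl: "T \<in> lebesgue \<rightarrow>\<^sub>M borel" using T by (intro measurable_completion) simp
  then have Td: "T \<in> density lebesgue (\<lambda>x. ennreal (\<rho> x)) \<rightarrow>\<^sub>M borel" by simp
  have "T -` A \<inter> space lebesgue \<in> sets lebesgue" by (rule measurable_sets[OF Tl A])
  then have v: "T -` A \<in> sets lebesgue" by simp
  have "(\<lambda>x. ennreal (\<rho> x)) \<in> borel_measurable lebesgue" using \<rho>m by measurable
  then have "emeasure (density lebesgue (\<lambda>x. ennreal (\<rho> x))) (T -` A) = (\<integral>\<^sup>+y. ennreal (\<rho> y) * indicator (T -` A) y \<partial>lebesgue)"
    by (rule emeasure_density[OF _ v])
  also have "\<dots> = (\<integral>\<^sup>+y. ennreal (\<rho> y) * indicator A (T y) \<partial>lebesgue)" by (simp only: ind)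
  finally have "emeasure (density lebesgue (\<lambda>x. ennreal (\<rho> x))) (T -` A) = (\<integral>\<^sup>+y. ennreal (\<rho> y) * indicator A (T y) \<partial>lebesgue)" .
  then show ?thesis
    using emeasure_distr[OF Td A] by simp
qed

lemma critical_set_lebesgue:
  fixes F :: "real^'n \<Rightarrow> real^'n"
  assumes E: "negligible E" and der: "\<And>y. y \<notin> E \<Longrightarrow> (F has_derivative F' y) (at y)"
  shows "{y. y \<notin> E \<and> \<bar>det (matrix (F' y))\<bar> = 0} \<in> sets lebesgue"
proof -
  have "{y \<in> space lebesgue. (if y \<in> - E then det (matrix (F' y)) else 0) = 0} \<in> sets lebesgue"
    using Jacobian_measurable[OF E der] by measurable
  from sets.Diff[OF this negligible_imp_sets[OF E]]
  have "{y \<in> space lebesgue. (if y \<in> - E then det (matrix (F' y)) else 0) = 0} - E \<in> sets lebesgue" .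
  moreover have "{y \<in> space lebesgue. (if y \<in> - E then det (matrix (F' y)) else 0) = 0} - E
      = {y. y \<notin> E \<and> \<bar>det (matrix (F' y))\<bar> = 0}"
    by auto
  ultimately show ?thesis by simp
qed

text \<open>Although \<open>C\<close> need not be a Borel set, it lies between two Borel sets carrying the same mass of
  the transported density.\<close>

lemma emeasure_critical_values:
  fixes F :: "real^'n \<Rightarrow> real^'n"
  assumes F: "continuous_on UNIV F" and E: "negligible E"
    and der: "\<And>y. y \<notin> E \<Longrightarrow> (F has_derivative F' y) (at y)"
    and N: "\<And>A. negligible A \<Longrightarrow> negligible (F ` A)"
    and \<rho>m: "\<rho> \<in> borel_measurable lebesgue" and fin: "(\<integral>\<^sup>+y. ennreal (\<rho> y) \<partial>lebesgue) < \<infinity>"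
  defines "Z \<equiv> {y. y \<notin> E \<and> \<bar>det (matrix (F' y))\<bar> = 0}"
  defines "M \<equiv> distr (density lebesgue (\<lambda>x. ennreal (\<rho> x))) borel F"
  shows "F ` (Z \<union> E) \<in> sets (completion M)"
    "emeasure (completion M) (F ` (Z \<union> E)) = (\<integral>\<^sup>+y. ennreal (\<rho> y) * indicator Z y \<partial>lebesgue)"
proof -
  have Fm: "F \<in> borel_measurable borel" using F by (rule borel_measurable_continuous_onI)
  have sM: "sets M = sets borel" by (simp add: M_def)
  have em: "emeasure M A = (\<integral>\<^sup>+y. ennreal (\<rho> y) * indicator A (F y) \<partial>lebesgue)" if "A \<in> sets borel" for A
    unfolding M_def by (rule emeasure_distr_density_lebesgue[OF Fm \<rho>m that])
  define I where "I = (\<integral>\<^sup>+y. ennreal (\<rho> y) * indicator Z y \<partial>lebesgue)"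
  have "negligible (F ` (Z \<union> E))"
    unfolding Z_def by (rule critical_values_negligible[OF E]) (rule der N, assumption)+
  then have "F ` (Z \<union> E) \<in> null_sets (completion lborel)" by (simp add: negligible_iff_null_sets)
  \<comment> \<open>The outer Borel set is Lebesgue null, so its preimage lies almost entirely in
    \<open>Z\<close>; this bounds its mass from above by \<open>I\<close>.\<close>
  then obtain B2 where B2: "B2 \<in> null_sets lborel" "F ` (Z \<union> E) \<subseteq> B2"
    unfolding null_sets_completion_iff2 by blast
  have B2b: "B2 \<in> sets borel" using B2(1) by auto
  have "emeasure M B2 = (\<integral>\<^sup>+y. ennreal (\<rho> y) * indicator B2 (F y) \<partial>lebesgue)" by (rule em[OF B2b])
  also have "\<dots> \<le> I"
    unfolding I_def
  proof (rule nn_integral_mono_AE)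
    have "AE y in lebesgue. F y \<in> B2 \<longrightarrow> y \<notin> E \<and> \<bar>det (matrix (F' y))\<bar> = 0"
      by (rule AE_preimage_null[OF F E _ B2(1)]) (rule der)
    then show "AE y in lebesgue. ennreal (\<rho> y) * indicator B2 (F y) \<le> ennreal (\<rho> y) * indicator Z y"
      by eventually_elim (auto simp: Z_def indicator_def)
  qed
  finally have up: "emeasure M B2 \<le> I" .
  have "Z \<in> sets lebesgue" unfolding Z_def by (rule critical_set_lebesgue[OF E der])
  then have ZE: "Z \<union> E \<in> sets lebesgue" by (rule sets.Un[OF _ negligible_imp_sets[OF E]])
  \<comment> \<open>For the inner set, \<open>Z \<union> E\<close> is a countable union of compact
    sets up to a null set. The image of that union is again a countable union of compact sets, hence
    Borel, and its preimage contains almost all of \<open>Z\<close>.\<close>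
  obtain D T where D: "fsigma D" "negligible T" "D \<union> T = Z \<union> E" "disjnt D T"
    by (rule lebesgue_set_almost_fsigma[OF ZE]) (rule that, simp_all add: negligible_iff_null_sets)
  obtain Q :: "nat \<Rightarrow> (real^'n) set" where Q: "range Q \<subseteq> Collect compact" "\<Union>(range Q) = D"
    using fsigma_Union_compact[of D] D(1) by blast
  define B1 where "B1 = F ` D"
  have "B1 = (\<Union>i. F ` Q i)" unfolding B1_def Q(2)[symmetric] by blast
  moreover have "F ` Q i \<in> sets borel" for i
  proof -
    have "compact (Q i)" using Q(1) by blast
    then have "compact (F ` Q i)" by (rule compact_continuous_image[OF continuous_on_subset[OF F subset_UNIV]])
    then show ?thesis by (rule borel_compact)
  qed
  ultimately have B1b: "B1 \<in> sets borel" by simp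
  have B1: "B1 \<subseteq> F ` (Z \<union> E)" unfolding B1_def D(3)[symmetric] by blast
  have "I \<le> (\<integral>\<^sup>+y. ennreal (\<rho> y) * indicator B1 (F y) \<partial>lebesgue)"
    unfolding I_def
  proof (rule nn_integral_mono_AE)
    have "AE y in lebesgue. y \<notin> T"
      using D(2) by (intro AE_not_in) (simp add: negligible_iff_null_sets)
    then show "AE y in lebesgue. ennreal (\<rho> y) * indicator Z y \<le> ennreal (\<rho> y) * indicator B1 (F y)"
    proof (rule AE_mp, intro AE_I2 impI)
      fix y assume y: "y \<notin> T"
      show "ennreal (\<rho> y) * indicator Z y \<le> ennreal (\<rho> y) * indicator B1 (F y)"
      proof (cases "y \<in> Z")
        case True
        then have "y \<in> D" using D(3) y by blast
        then have "F y \<in> B1" by (simp add: B1_def)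
        then show ?thesis using True by simp
      qed simp
    qed
  qed
  also have "\<dots> = emeasure M B1" by (rule em[OF B1b, symmetric])
  finally have low: "I \<le> emeasure M B1" .
  have B1s: "B1 \<in> sets M" and B2s: "B2 \<in> sets M" using B1b B2b by (simp_all add: sM)
  have "emeasure M B1 \<le> emeasure M B2" using B1 B2(2) B2s by (intro emeasure_mono) auto
  then have eq: "emeasure M B1 = I" "emeasure M B2 = I" using up low by auto
  show S: "F ` (Z \<union> E) \<in> sets (completion M)"
  proof (rule sets_completionI[of _ B1 "F ` (Z \<union> E) - B1" "B2 - B1"])
    \<comment> \<open>Finiteness of the total mass allows the equal masses of the two Borel sets to
      be subtracted.\<close>
    have "I \<le> (\<integral>\<^sup>+y. ennreal (\<rho> y) \<partial>lebesgue)"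
      unfolding I_def by (intro nn_integral_mono) (simp add: indicator_def)
    also note fin
    finally have "I \<noteq> \<infinity>" by simp
    then have "emeasure M (B2 - B1) = 0"
      using B1 B2(2) B1s B2s eq by (subst emeasure_Diff) auto
    then show "B2 - B1 \<in> null_sets M" using B1s B2s by (simp add: null_sets_def)
  qed (use B1 B2(2) B1s in auto)
  have "emeasure (completion M) B1 \<le> emeasure (completion M) (F ` (Z \<union> E))"
    using B1 S by (rule emeasure_mono)
  moreover have "emeasure (completion M) (F ` (Z \<union> E)) \<le> emeasure (completion M) B2"
    using B2(2) sets_completionI_sets[OF B2s] by (rule emeasure_mono)
  ultimately show "emeasure (completion M) (F ` (Z \<union> E)) = (\<integral>\<^sup>+y. ennreal (\<rho> y) * indicator Z y \<partial>lebesgue)"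
    using eq B1s B2s by (simp add: I_def)
qed

text \<open>The disintegration is with respect to Lebesgue measure, so the kernels are not
  normalised: the total mass of the kernel at \<open>x\<close> is, for almost every
  \<open>x\<close>, the density of the projected measure there. This is how the second assertion
  follows from the third.\<close>

theorem theorem2p7:
  fixes H :: "(real^'n) \<times> (real^'n) \<Rightarrow> real"
    and DH :: "(real^'n) \<times> (real^'n) \<Rightarrow> (real^'n) \<times> (real^'n)"
    and D2H :: "(real^'n) \<times> (real^'n) \<Rightarrow> ((real^'n) \<times> (real^'n)) \<Rightarrow>\<^sub>L ((real^'n) \<times> (real^'n))"
    and \<kappa> :: real and h :: "real \<Rightarrow> real"
    and \<Phi> :: "real \<Rightarrow> (real^'n) \<times> (real^'n) \<Rightarrow> (real^'n) \<times> (real^'n)"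
    and U :: "real^'n \<Rightarrow> real^'n"
    and \<rho>in :: "real^'n \<Rightarrow> real"
    and t :: real
  assumes H_grad: "\<And>p. (H has_derivative (\<lambda>v. DH p \<bullet> v)) (at p)"
    and H_hess: "\<And>p. (DH has_derivative blinfun_apply (D2H p)) (at p)"
    and H_C2: "continuous_on UNIV D2H"
    and \<kappa>_pos: "\<kappa> > 0"
    and h_cont: "continuous_on UNIV h" and h_nonneg: "\<And>r. h r \<ge> 0"
    and h_sublin: "((\<lambda>r. h r / r) \<longlongrightarrow> 0) at_top"
    and bound_xi: "\<And>x \<xi>. norm (snd (DH (x, \<xi>))) \<le> \<kappa> * (1 + norm \<xi>)"
    and bound_x: "\<And>x \<xi>. norm (fst (DH (x, \<xi>))) \<le> h (norm x) + \<kappa> * norm \<xi>"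
    and bound_hess: "\<And>p. norm (D2H p) \<le> \<kappa>"
    and flow0: "\<And>p. \<Phi> 0 p = p"
    and flow_ode: "\<And>p s. ((\<lambda>s. \<Phi> s p) has_vector_derivative ham_field (DH (\<Phi> s p))) (at s)"
    and U_cont: "continuous_on UNIV U"
    and U_sublin: "((\<lambda>y. norm (U y) / norm y) \<longlongrightarrow> 0) at_infinity"
    and U_lorentz: "\<And>\<Omega> k l. open \<Omega> \<Longrightarrow> bounded \<Omega> \<Longrightarrow>
                      \<exists>g. weak_partial \<Omega> (\<lambda>y. U y $ k) l g \<and> lorentz_N1 \<Omega> g"
    and \<rho>_meas: "\<rho>in \<in> borel_measurable lebesgue"
    and \<rho>_nonneg: "\<And>x. \<rho>in x \<ge> 0"
    and \<rho>_prob: "(\<integral>\<^sup>+ x. ennreal (\<rho>in x) \<partial>lebesgue) = 1"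
  defines "\<mu>t \<equiv> distr (monokinetic U \<rho>in) borel (\<Phi> t)"
    and "F \<equiv> Fmap \<Phi> U t"
    and "J \<equiv> Jac \<Phi> U t"
    and "Z \<equiv> Zset \<Phi> U t"
    and "C \<equiv> Cset \<Phi> U t"
  shows
    "((emeasure (completion (distr \<mu>t borel fst)) C = 0 \<longleftrightarrow> emeasure (completion (distr \<mu>t borel fst)) (UNIV - C) = 1) \<and>
      (emeasure (completion (distr \<mu>t borel fst)) (UNIV - C) = 1 \<longleftrightarrow> (AE y in lebesgue. y \<in> Z \<longrightarrow> \<rho>in y = 0)))
     \<and>
     ((AE y in lebesgue. y \<in> Z \<longrightarrow> \<rho>in y = 0) \<longrightarrow>
        absolutely_continuous lborel (distr \<mu>t borel fst) \<and>
        (\<exists>g \<in> borel_measurable borel. distr \<mu>t borel fst = density lborel g \<and>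
           (AE x in lebesgue. g x = (\<Sum>\<^sub>\<infinity>y\<in>F -` {x}. ennreal (\<rho>in y / J y)))))
     \<and>
     ((AE y in lebesgue. y \<in> Z \<longrightarrow> \<rho>in y = 0) \<longrightarrow>
        (\<exists>K :: real^'n \<Rightarrow> (real^'n) measure.
           (\<forall>x. sets (K x) = sets borel) \<and>
           (\<forall>A \<in> sets (borel :: ((real^'n) \<times> (real^'n)) measure).
              (\<lambda>x. emeasure (K x) (Pair x -` A)) \<in> borel_measurable borel \<and>
              emeasure \<mu>t A = (\<integral>\<^sup>+ x. emeasure (K x) (Pair x -` A) \<partial>lborel)) \<and>
           (AE x in lebesgue. \<forall>B \<in> sets (borel :: (real^'n) measure).
              emeasure (K x) B =
                (\<Sum>\<^sub>\<infinity>y\<in>F -` {x}. ennreal (\<rho>in y / J y) * indicator B (snd (\<Phi> t (y, U y)))))))"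
proof -
  let ?E = "nondiff_set U"
  define X where "X y = snd (\<Phi> t (y, U y))" for y
  \<comment> \<open>On \<open>?E\<close> this value need not be a derivative of \<open>F\<close>. It
    does not affect the fibre sums for almost every \<open>x\<close>, since the image of
    \<open>?E\<close> is null.\<close>
  define D where "D y = frechet_derivative F (at y)" for y
  define L where "L = exp ((2 * \<kappa> + 1) * \<bar>t\<bar>)"
  have L: "L > 0" by (simp add: L_def)
  have \<Phi>d: "\<Phi> t differentiable (at p)" for p
    by (rule ham_flow_regularity(1)[OF H_hess H_C2 bound_hess flow0 flow_ode])
  have \<Phi>L: "norm (\<Phi> t p - \<Phi> t q) \<le> L * norm (p - q)" for p q
    unfolding L_def by (rule ham_flow_regularity(2)[OF H_hess H_C2 bound_hess flow0 flow_ode])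
  have \<Phi>c: "continuous_on UNIV (\<Phi> t)"
    using \<Phi>d by (simp add: continuous_on_eq_continuous_at differentiable_imp_continuous_within)
  have Uc: "continuous_on UNIV (\<lambda>y. (y, U y))"
    by (rule continuous_on_Pair[OF continuous_on_id U_cont])
  have Tc: "continuous_on UNIV (\<lambda>y. \<Phi> t (y, U y))"
    by (rule continuous_on_compose2[OF \<Phi>c Uc]) simp
  have Fc: "continuous_on UNIV F"
    unfolding F_def Fmap_def[abs_def] by (rule continuous_on_fst[OF Tc])
  have Xc: "continuous_on UNIV X"
    unfolding X_def[abs_def] by (rule continuous_on_snd[OF Tc])
  have TFX: "\<Phi> t (y, U y) = (F y, X y)" for y by (simp add: F_def Fmap_def X_def)
  have E: "negligible ?E" by (rule negligible_nondiff_set[OF U_cont U_lorentz])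
  \<comment> \<open>The field \<open>U\<close> is only assumed continuous, so no Lipschitz bound for
    \<open>F\<close> is at hand. The Lipschitz constant of the flow bounds its increments by those
    of the position and of \<open>U\<close>, as needed for condition (N).\<close>
  have FL: "norm (F x - F y) \<le> L * (norm (x - y) + norm (U x - U y))" for x y
  proof -
    have "norm (F x - F y) = norm (fst (\<Phi> t (x, U x) - \<Phi> t (y, U y)))" by (simp add: TFX)
    also have "\<dots> \<le> norm (\<Phi> t (x, U x) - \<Phi> t (y, U y))" by (metis norm_fst_le prod.collapse)
    also have "\<dots> \<le> L * norm ((x, U x) - (y, U y))" by (rule \<Phi>L)
    also have "\<dots> \<le> L * (norm (x - y) + norm (U x - U y))"
      using norm_Pair_le[of "x - y" "U x - U y"] L by simp
    finally show ?thesis .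
  qed
  have N: "negligible (F ` A)" if "negligible A" for A
    by (rule negligible_image_of_lorentz_gradient[OF U_cont U_lorentz FL L that])
  have der: "(F has_derivative D y) (at y)" if "y \<notin> ?E" for y
  proof -
    have "U differentiable (at y)" using that by (simp add: nondiff_set_def)
    then obtain U' where "(U has_derivative U') (at y)" by (auto simp: differentiable_def)
    from has_derivative_Pair[OF has_derivative_ident this]
    have 1: "((\<lambda>y. (y, U y)) has_derivative (\<lambda>v. (v, U' v))) (at y)" .
    obtain \<Phi>' where 2: "(\<Phi> t has_derivative \<Phi>') (at (y, U y))"
      using \<Phi>d[of "(y, U y)"] by (auto simp: differentiable_def)
    have "((\<lambda>y. fst (\<Phi> t (y, U y))) has_derivative (\<lambda>v. fst (\<Phi>' (v, U' v)))) (at y)"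
      by (rule has_derivative_fst[OF has_derivative_compose[OF 1 2]])
    then have "F differentiable (at y)"
      unfolding F_def Fmap_def[abs_def] by (rule differentiableI)
    then show ?thesis unfolding D_def by (simp add: frechet_derivative_works)
  qed
  have JD: "J y = \<bar>det (matrix (D y))\<bar>" for y by (simp add: J_def Jac_def D_def F_def)
  have ZD: "Z = {y. y \<notin> ?E \<and> \<bar>det (matrix (D y))\<bar> = 0}"
    unfolding Z_def Zset_def using JD by (simp add: J_def)
  have CF: "C = F ` (Z \<union> ?E)"
    unfolding C_def Cset_def Z_def F_def by blast
  have Fm: "F \<in> borel_measurable borel" using Fc by (rule borel_measurable_continuous_onI)
  have FXm: "(\<lambda>y. (F y, X y)) \<in> borel_measurable borel"
    by (intro borel_measurable_continuous_onI continuous_on_Pair Fc Xc)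
  let ?d = "density lebesgue (\<lambda>x. ennreal (\<rho>in x))"
  have ms: "f \<in> ?d \<rightarrow>\<^sub>M borel" if "continuous_on UNIV f" for f :: "real^'n \<Rightarrow> (real^'n) \<times> (real^'n)"
  proof -
    have "f \<in> lborel \<rightarrow>\<^sub>M borel" using borel_measurable_continuous_onI[OF that] by simp
    then have "f \<in> lebesgue \<rightarrow>\<^sub>M borel" by (rule measurable_completion)
    then show ?thesis by simp
  qed
  have \<mu>t: "\<mu>t = distr ?d borel (\<lambda>y. (F y, X y))"
    unfolding \<mu>t_def monokinetic_def
    by (subst distr_distr[OF borel_measurable_continuous_onI[OF \<Phi>c] ms[OF Uc]]) (simp add: comp_def TFX)
  have fstm: "fst \<in> (borel :: ((real^'n) \<times> (real^'n)) measure) \<rightarrow>\<^sub>M borel"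
    by (intro borel_measurable_continuous_onI continuous_on_fst continuous_on_id)
  define \<nu> where "\<nu> = distr \<mu>t borel fst"
  have \<nu>: "\<nu> = distr ?d borel F"
    unfolding \<nu>_def \<mu>t by (subst distr_distr[OF fstm ms[OF continuous_on_Pair[OF Fc Xc]]]) (simp add: comp_def)
  have \<mu>e: "emeasure \<mu>t A = (\<integral>\<^sup>+y. ennreal (\<rho>in y) * indicator A (F y, X y) \<partial>lebesgue)" if "A \<in> sets borel" for A
    unfolding \<mu>t by (rule emeasure_distr_density_lebesgue[OF FXm \<rho>_meas that])
  have \<nu>e: "emeasure \<nu> B = (\<integral>\<^sup>+y. ennreal (\<rho>in y) * indicator B (F y) \<partial>lebesgue)" if "B \<in> sets borel" for B
    unfolding \<nu> by (rule emeasure_distr_density_lebesgue[OF Fm \<rho>_meas that])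
  have fin: "(\<integral>\<^sup>+y. ennreal (\<rho>in y) \<partial>lebesgue) < \<infinity>" using \<rho>_prob by simp
  have C: "C \<in> sets (completion \<nu>)"
    "emeasure (completion \<nu>) C = (\<integral>\<^sup>+y. ennreal (\<rho>in y) * indicator Z y \<partial>lebesgue)"
    unfolding CF \<nu> ZD
    by ((rule emeasure_critical_values[OF Fc E der N \<rho>_meas fin], assumption+)+)
  have Zl: "Z \<in> sets lebesgue" unfolding ZD by (rule critical_set_lebesgue[OF E der])
  have "(\<lambda>y. ennreal (\<rho>in y) * indicator Z y) \<in> borel_measurable lebesgue"
    using \<rho>_meas by (intro borel_measurable_times_ennreal borel_measurable_indicator Zl measurable_compose[OF _ measurable_ennreal])
  then have "emeasure (completion \<nu>) C = 0 \<longleftrightarrow> (AE y in lebesgue. ennreal (\<rho>in y) * indicator Z y = 0)"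
    unfolding C(2) by (rule nn_integral_0_iff_AE)
  moreover have "ennreal (\<rho>in y) * indicator Z y = 0 \<longleftrightarrow> (y \<in> Z \<longrightarrow> \<rho>in y = 0)" for y
    using \<rho>_nonneg[of y] by (auto simp: indicator_def)
  ultimately have C0: "emeasure (completion \<nu>) C = 0 \<longleftrightarrow> (AE y in lebesgue. y \<in> Z \<longrightarrow> \<rho>in y = 0)" by simp
  \<comment> \<open>The two masses add up to 1, and finite summands can be cancelled, which makes
    the first two conditions equivalent.\<close>
  have "emeasure (completion \<nu>) C + emeasure (completion \<nu>) (UNIV - C) = 1"
  proof -
    have "space (completion \<nu>) = UNIV" by (simp add: \<nu>)
    then have Cc: "UNIV - C \<in> sets (completion \<nu>)" using sets.compl_sets[OF C(1)] by simp
    have "emeasure (completion \<nu>) C + emeasure (completion \<nu>) (UNIV - C) = emeasure (completion \<nu>) (C \<union> (UNIV - C))"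
      by (rule plus_emeasure[OF C(1) Cc]) blast
    also have "C \<union> (UNIV - C) = UNIV" by blast
    also have "emeasure (completion \<nu>) UNIV = emeasure \<nu> UNIV" by (simp add: \<nu>)
    also have "\<dots> = 1" using \<nu>e[of UNIV] \<rho>_prob by simp
    finally show ?thesis .
  qed
  then have C1: "emeasure (completion \<nu>) C = 0 \<longleftrightarrow> emeasure (completion \<nu>) (UNIV - C) = 1"
    using ennreal_add_left_cancel[of 1 "emeasure (completion \<nu>) C" 0] by (auto simp: add.commute)
  have kernel: "\<exists>k :: real^'n \<Rightarrow> (real^'n) measure. (\<forall>x. sets (k x) = sets borel) \<and>
      (\<forall>A\<in>sets borel. (\<lambda>x. emeasure (k x) (Pair x -` A)) \<in> borel_measurable borel \<and>
         emeasure \<mu>t A = (\<integral>\<^sup>+x. emeasure (k x) (Pair x -` A) \<partial>lborel)) \<and>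
      (AE x in lebesgue. \<forall>B\<in>sets borel. emeasure (k x) B =
         (\<Sum>\<^sub>\<infinity>y\<in>F -` {x}. ennreal (\<rho>in y / J y) * indicator B (X y)))"
    if Z0: "AE y in lebesgue. y \<in> Z \<longrightarrow> \<rho>in y = 0"
  proof -
    have Z0': "AE y in lebesgue. y \<notin> ?E \<and> \<bar>det (matrix (D y))\<bar> = 0 \<longrightarrow> \<rho>in y = 0"
      using Z0 by (simp add: ZD)
    obtain k :: "real^'n \<Rightarrow> (real^'n) measure" where k: "\<And>x. sets (k x) = sets borel"
      "\<And>A. A \<in> sets borel \<Longrightarrow> (\<lambda>x. emeasure (k x) (Pair x -` A)) \<in> borel_measurable borel"
      "\<And>A. A \<in> sets borel \<Longrightarrow> (\<integral>\<^sup>+y. ennreal (\<rho>in y) * indicator A (F y, X y) \<partial>lebesgue) =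
         (\<integral>\<^sup>+x. emeasure (k x) (Pair x -` A) \<partial>lborel)"
      "AE x in lebesgue. \<forall>B\<in>sets borel. emeasure (k x) B =
         (\<Sum>\<^sub>\<infinity>y\<in>F -` {x}. ennreal (\<rho>in y / \<bar>det (matrix (D y))\<bar>) * indicator B (X y))"
      by (rule fibre_kernel[OF Fc Xc E der N \<rho>_meas \<rho>_nonneg Z0'], assumption, assumption) (rule that)
    have "emeasure \<mu>t A = (\<integral>\<^sup>+x. emeasure (k x) (Pair x -` A) \<partial>lborel)" if "A \<in> sets borel" for A
      unfolding \<mu>e[OF that] by (rule k(3)[OF that])
    then show ?thesis
      unfolding JD by (intro exI[of _ k] conjI allI ballI) (simp_all only: k(1,2,4))
  qed
  have density: "absolutely_continuous lborel \<nu> \<and>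
      (\<exists>g\<in>borel_measurable borel. \<nu> = density lborel g \<and>
         (AE x in lebesgue. g x = (\<Sum>\<^sub>\<infinity>y\<in>F -` {x}. ennreal (\<rho>in y / J y))))"
    if Z0: "AE y in lebesgue. y \<in> Z \<longrightarrow> \<rho>in y = 0"
  proof -
    from kernel[OF Z0] obtain k :: "real^'n \<Rightarrow> (real^'n) measure" where
      k: "\<forall>A\<in>sets borel. (\<lambda>x. emeasure (k x) (Pair x -` A)) \<in> borel_measurable borel \<and>
         emeasure \<mu>t A = (\<integral>\<^sup>+x. emeasure (k x) (Pair x -` A) \<partial>lborel)"
      and kf: "AE x in lebesgue. \<forall>B\<in>sets borel. emeasure (k x) B =
         (\<Sum>\<^sub>\<infinity>y\<in>F -` {x}. ennreal (\<rho>in y / J y) * indicator B (X y))"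
      by blast
    \<comment> \<open>The density is the total mass of the kernel: for a cylinder over
      \<open>B\<close> each fibre is either everything or empty.\<close>
    define g where "g x = emeasure (k x) UNIV" for x
    have gm: "g \<in> borel_measurable borel"
      using bspec[OF k, of UNIV] by (simp add: g_def[abs_def])
    have eq: "\<nu> = density lborel g"
    proof (rule measure_eqI)
      show "sets \<nu> = sets (density lborel g)" by (simp add: \<nu>)
      fix B assume "B \<in> sets \<nu>"
      then have B: "B \<in> sets borel" by (simp add: \<nu>)
      have fB: "fst -` B \<in> sets (borel :: ((real^'n) \<times> (real^'n)) measure)"
        using measurable_sets[OF fstm B] by simp
      have "emeasure \<nu> B = emeasure \<mu>t (fst -` B)"
        unfolding \<nu>e[OF B] \<mu>e[OF fB] by (simp add: indicator_def)
      also have "\<dots> = (\<integral>\<^sup>+x. emeasure (k x) (Pair x -` fst -` B) \<partial>lborel)"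
        using bspec[OF k fB] by simp
      also have "\<dots> = (\<integral>\<^sup>+x. g x * indicator B x \<partial>lborel)"
      proof (rule nn_integral_cong)
        fix x
        have "Pair x -` fst -` B = (if x \<in> B then UNIV else ({} :: (real^'n) set))" by auto
        then show "emeasure (k x) (Pair x -` fst -` B) = g x * indicator B x" by (simp add: g_def)
      qed
      also have "\<dots> = emeasure (density lborel g) B"
        using gm B by (simp add: emeasure_density)
      finally show "emeasure \<nu> B = emeasure (density lborel g) B" .
    qed
    have "absolutely_continuous lborel \<nu>"
      unfolding eq using gm by (intro absolutely_continuousI_density) simp
    moreover have "AE x in lebesgue. g x = (\<Sum>\<^sub>\<infinity>y\<in>F -` {x}. ennreal (\<rho>in y / J y))"
      using kf
    proof (rule AE_mp, intro AE_I2 impI)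
      fix x assume "\<forall>B\<in>sets borel. emeasure (k x) B =
         (\<Sum>\<^sub>\<infinity>y\<in>F -` {x}. ennreal (\<rho>in y / J y) * indicator B (X y))"
      from bspec[OF this, of UNIV] show "g x = (\<Sum>\<^sub>\<infinity>y\<in>F -` {x}. ennreal (\<rho>in y / J y))"
        by (simp add: g_def)
    qed
    ultimately show ?thesis using gm eq by blast
  qed
  show ?thesis
    unfolding \<nu>_def[symmetric] X_def[symmetric]
    using C0 C1 density kernel by blast
qed

end
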